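(* For any partitions $\lambda,\mu$ we have, in the ring $\widehat\Lambda(x\|a)$, $$\widehat s_\lambda(x\|a)\,\widehat s_\mu(x\|a)=\sum_\nu\widehat c_{\lambda\mu}^{\,\nu}(a)\,\widehat s_\nu(x\|a),$$ where $\widehat s_\lambda(x\|a)$ are the dual Schur functions and $\widehat c_{\lambda\mu}^{\,\nu}(a)$ are the dual Littlewood--Richardson polynomials.
   Context: Let $a=(a_i)_{i\in\mathbb Z}$ be a sequence of commuting indeterminates and $\mathbb Q[a]$ the polynomial ring in the $a_i$. The ring $\Lambda(x\|a)$: its elements are sequences $P=(P_0,P_1,P_2,\dots)$, where $P_n$ is a symmetric polynomial in $x_1,\dots,x_n$ with coefficients in $\mathbb Q[a]$, the total degrees of the $P_n$ in the $x_i$ are bounded, and $P_n(x_1,\dots,x_{n-1},a_n)=P_{n-1}(x_1,\dots,x_{n-1})$ for all $n\geqslant 1$; multiplication is componentwise. It is freely generated over $\mathbb Q[a]$ by the double power sums $p_k(x\|a)=\sum_{i\geqslant 1}(x_i^k-a_i^k)$, $k\geqslant 1$ (the sequence $\sum_{i=1}^n(x_i^k-a_i^k)$, $n\geqslant 0$). Double Schur functions: for a partition $\lambda$ with length $\ell(\lambda)\leqslant n$, $$s_\lambda(x_1,\dots,x_n\|a)=\frac{\det\big[(x_i\|a)^{\lambda_j+n-j}\big]_{i,j=1}^n}{\prod_{1\leqslant i<j\leqslant n}(x_i-x_j)},\qquad (x_i\|a)^r=(x_i-a_n)(x_i-a_{n-1})\cdots(x_i-a_{n-r+1}),\ (x_i\|a)^0=1,$$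 and $s_\lambda(x_1,\dots,x_n\|a)=0$ if $\ell(\lambda)>n$. This sequence is $s_\lambda(x\|a)\in\Lambda(x\|a)$; the $s_\lambda(x\|a)$ form a $\mathbb Q[a]$-basis of $\Lambda(x\|a)$. Dual Littlewood--Richardson polynomials: let $\Delta:\Lambda(x\|a)\to\Lambda(x\|a)\otimes_{\mathbb Q[a]}\Lambda(x\|a)$ be the $\mathbb Q[a]$-linear ring homomorphism with $\Delta(p_k(x\|a))=p_k(x\|a)\otimes 1+1\otimes p_k(x\|a)$ for all $k\geqslant 1$. The polynomials $\widehat c_{\lambda\mu}^{\,\nu}(a)\in\mathbb Q[a]$ are defined by $\Delta(s_\nu(x\|a))=\sum_{\lambda,\mu}\widehat c_{\lambda\mu}^{\,\nu}(a)\,s_\lambda(x\|a)\otimes s_\mu(x\|a)$. Dual Schur functions: let $\widehat\Lambda(x\|a)$ be the ring of formal (possibly infinite) sums $\sum_{\lambda}c_\lambda(a)s_\lambda(x)$, $c_\lambda(a)\in\mathbb Q[a]$, with $s_\lambda(x)$ the ordinary Schur functions. Let $d$ be the number of boxes on the main diagonal of $\lambda$. For $n\geqslant\ell(\lambda)$, $$\widehat s_\lambda(x_1,\dots,x_n\|a)=\frac{\det[A_{ij}]_{i,j=1}^n}{\prod_{1\leqslant i<j\leqslant n}(x_i-x_j)},$$ where $A_{ij}=\dfrac{x_i^{\lambda_j+n-j}}{(1-a_0x_i)(1-a_{-1}x_i)\cdots(1-a_{j-\lambda_j}x_i)}$ for $1\leqslant j\leqslant d$ and $A_{ij}=x_i^{\lambda_j+n-j}(1-a_1x_i)\cdots(1-a_{j-\lambda_j-1}x_i)$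 for $d<j\leqslant n$; it is $0$ if $\ell(\lambda)>n$. These are compatible with setting $x_n=0$ and define $\widehat s_\lambda(x\|a)\in\widehat\Lambda(x\|a)$. *)

theory Defs
  imports
    "HOL-Library.Poly_Mapping"
    "HOL-Library.Product_Plus"
    "HOL-Combinatorics.Permutations"
    "Jordan_Normal_Form.Determinant"
begin

section \<open>Polynomials\<close>

type_synonym ('v, 'c) mpoly = "('v \<Rightarrow>\<^sub>0 nat) \<Rightarrow>\<^sub>0 'c"

definition Const :: "'c \<Rightarrow> ('m::zero \<Rightarrow>\<^sub>0 'c::zero)"
  where "Const c = Poly_Mapping.single 0 c"

definition Var :: "'v \<Rightarrow> ('v, 'c::zero_neq_one) mpoly"
  where "Var i = Poly_Mapping.single (Poly_Mapping.single i 1) 1"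

definition mono_eval :: "('v \<Rightarrow> 'r::comm_monoid_mult) \<Rightarrow> ('v \<Rightarrow>\<^sub>0 nat) \<Rightarrow> 'r"
  where "mono_eval \<sigma> m = (\<Prod>i\<in>Poly_Mapping.keys m. \<sigma> i ^ Poly_Mapping.lookup m i)"

definition subst :: "('v \<Rightarrow> ('v, 'c) mpoly) \<Rightarrow> ('v, 'c::comm_ring_1) mpoly \<Rightarrow> ('v, 'c) mpoly"
  where "subst \<sigma> p = (\<Sum>m\<in>Poly_Mapping.keys p. Const (Poly_Mapping.lookup p m) * mono_eval \<sigma> m)"

definition vars :: "('v, 'c::zero) mpoly \<Rightarrow> 'v set"
  where "vars p = (\<Union>m\<in>Poly_Mapping.keys p. Poly_Mapping.keys m)"

definition mono_deg :: "('v \<Rightarrow>\<^sub>0 nat) \<Rightarrow> nat"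
  where "mono_deg m = (\<Sum>i\<in>Poly_Mapping.keys m. Poly_Mapping.lookup m i)"

text \<open>The total degree of \<open>p\<close> is at most \<open>d\<close>.\<close>

definition deg_le :: "('v, 'c::zero) mpoly \<Rightarrow> nat \<Rightarrow> bool"
  where "deg_le p d \<longleftrightarrow> (\<forall>m\<in>Poly_Mapping.keys p. mono_deg m \<le> d)"

lemma Const_0 [simp]: "Const 0 = 0"
  by (simp add: Const_def)

lemma Const_1 [simp]: "Const 1 = (1 :: 'm::monoid_add \<Rightarrow>\<^sub>0 'c::semiring_1)"
  by (simp add: Const_def)

lemma Const_add: "Const (c + d) = Const c + Const d"
  by (simp add: Const_def single_add)

lemma Const_mult: "Const (c * d) = Const c * (Const d :: 'm::monoid_add \<Rightarrow>\<^sub>0 'c::semiring_0)"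
  by (simp add: Const_def mult_single)

lemma mono_eval_superset:
  assumes "finite A" "Poly_Mapping.keys m \<subseteq> A"
  shows "mono_eval \<sigma> m = (\<Prod>i\<in>A. \<sigma> i ^ Poly_Mapping.lookup m i)"
  unfolding mono_eval_def using assms
  by (intro prod.mono_neutral_left) (auto simp: in_keys_iff)

lemma mono_eval_0 [simp]: "mono_eval \<sigma> 0 = 1"
  by (simp add: mono_eval_def)

lemma mono_eval_add: "mono_eval \<sigma> (m + m') = mono_eval \<sigma> m * mono_eval \<sigma> m'"
proof -
  let ?A = "Poly_Mapping.keys m \<union> Poly_Mapping.keys m'"
  have "mono_eval \<sigma> (m + m') = (\<Prod>i\<in>?A. \<sigma> i ^ Poly_Mapping.lookup (m + m') i)"
    by (intro mono_eval_superset) (auto dest: subsetD[OF keys_add])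
  also have "\<dots> = (\<Prod>i\<in>?A. \<sigma> i ^ Poly_Mapping.lookup m i) * (\<Prod>i\<in>?A. \<sigma> i ^ Poly_Mapping.lookup m' i)"
    by (simp add: lookup_add power_add prod.distrib)
  also have "\<dots> = mono_eval \<sigma> m * mono_eval \<sigma> m'"
    by (simp add: mono_eval_superset[of ?A])
  finally show ?thesis .
qed

lemma subst_superset:
  assumes "finite A" "Poly_Mapping.keys p \<subseteq> A"
  shows "subst \<sigma> p = (\<Sum>m\<in>A. Const (Poly_Mapping.lookup p m) * mono_eval \<sigma> m)"
  unfolding subst_def using assms
  by (intro sum.mono_neutral_left) (auto simp: in_keys_iff)

lemma subst_0 [simp]: "subst \<sigma> 0 = 0"
  by (simp add: subst_def)

lemma subst_add: "subst \<sigma> (p + q) = subst \<sigma> p + subst \<sigma> q"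
proof -
  let ?A = "Poly_Mapping.keys p \<union> Poly_Mapping.keys q"
  have "subst \<sigma> (p + q) = (\<Sum>m\<in>?A. Const (Poly_Mapping.lookup (p + q) m) * mono_eval \<sigma> m)"
    by (intro subst_superset) (auto dest: subsetD[OF keys_add])
  also have "\<dots> = (\<Sum>m\<in>?A. Const (Poly_Mapping.lookup p m) * mono_eval \<sigma> m)
                + (\<Sum>m\<in>?A. Const (Poly_Mapping.lookup q m) * mono_eval \<sigma> m)"
    by (simp add: lookup_add Const_add algebra_simps sum.distrib)
  also have "\<dots> = subst \<sigma> p + subst \<sigma> q"
    by (simp add: subst_superset[of ?A])
  finally show ?thesis .
qed

lemma subst_single: "subst \<sigma> (Poly_Mapping.single m c) = Const c * mono_eval \<sigma> m"
  by (cases "c = 0") (simp_all add: subst_def)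

lemma subst_Const [simp]: "subst \<sigma> (Const c) = Const c"
  by (simp add: Const_def subst_single)

lemma subst_1 [simp]: "subst \<sigma> 1 = 1"
  using subst_Const[of \<sigma> 1] by simp

lemma subst_Var [simp]: "subst \<sigma> (Var i) = \<sigma> i"
  by (simp add: Var_def subst_single mono_eval_def)

lemma subst_uminus: "subst \<sigma> (- p) = - subst \<sigma> p"
  using subst_add[of \<sigma> p "- p"] by (simp add: eq_neg_iff_add_eq_0 add.commute)

lemma subst_diff: "subst \<sigma> (p - q) = subst \<sigma> p - subst \<sigma> q"
  using subst_add[of \<sigma> p "- q"] by (simp add: subst_uminus)

lemma subst_sum: "subst \<sigma> (\<Sum>i\<in>I. f i) = (\<Sum>i\<in>I. subst \<sigma> (f i))"
  by (induction I rule: infinite_finite_induct) (simp_all add: subst_add)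

lemma poly_mapping_single_add_induct [case_names zero add]:
  assumes "P 0" and "\<And>p m c. P p \<Longrightarrow> P (p + Poly_Mapping.single m c)"
  shows "P (p :: 'm \<Rightarrow>\<^sub>0 'c::comm_monoid_add)"
proof (induction p rule: update_induct)
  case const
  show ?case by (fact assms(1))
next
  case (update p m c)
  have "Poly_Mapping.update m c p = p + Poly_Mapping.single m c"
    by (rule poly_mapping_eqI)
      (use update in \<open>auto simp: lookup_update lookup_add lookup_single in_keys_iff when_def\<close>)
  with assms(2)[OF update(3)] show ?case by simp
qed

lemma subst_mult: "subst \<sigma> (p * q) = subst \<sigma> p * subst \<sigma> q"
proof (induction p rule: poly_mapping_single_add_induct)
  case (add p m c)
  have "subst \<sigma> (Poly_Mapping.single m c * q) = subst \<sigma> (Poly_Mapping.single m c) * subst \<sigma> q"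
  proof (induction q rule: poly_mapping_single_add_induct)
    case (add q m' c')
    then show ?case
      by (simp add: algebra_simps subst_add mult_single subst_single mono_eval_add Const_mult)
  qed simp
  with add show ?case
    by (simp add: algebra_simps subst_add)
qed simp

lemma subst_power: "subst \<sigma> (p ^ k) = subst \<sigma> p ^ k"
  by (induction k) (simp_all add: subst_mult)

lemma vars_0 [simp]: "vars 0 = {}"
  by (simp add: vars_def)

lemma vars_Const [simp]: "vars (Const c) = {}"
  by (cases "c = 0") (simp_all add: vars_def Const_def)

lemma vars_1 [simp]: "vars (1 :: ('v, 'c::comm_ring_1) mpoly) = {}"
  using vars_Const[of "1 :: 'c"] by simp

lemma vars_Var [simp]: "vars (Var i :: ('v, 'c::comm_ring_1) mpoly) = {i}"
  by (simp add: vars_def Var_def)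

lemma vars_add: "vars (p + q) \<subseteq> vars p \<union> vars q"
  unfolding vars_def by (auto dest: subsetD[OF keys_add])

lemma vars_uminus [simp]: "vars (- p) = vars (p :: ('v, 'c::comm_ring_1) mpoly)"
  by (simp add: vars_def keys_def)

lemma vars_diff: "vars (p - q) \<subseteq> vars p \<union> vars (q :: ('v, 'c::comm_ring_1) mpoly)"
  using vars_add[of p "- q"] by simp

lemma vars_mult: "vars (p * q) \<subseteq> vars p \<union> vars (q :: ('v, 'c::comm_ring_1) mpoly)"
  unfolding vars_def by (fastforce dest: subsetD[OF keys_mult] subsetD[OF keys_add])

lemma vars_power: "vars (p ^ k) \<subseteq> vars (p :: ('v, 'c::comm_ring_1) mpoly)"
  by (induction k) (use vars_mult[of p] in \<open>auto\<close>)

lemma vars_sum: "vars (\<Sum>i\<in>I. f i) \<subseteq> (\<Union>i\<in>I. vars (f i))"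
  by (induction I rule: infinite_finite_induct) (use vars_add in \<open>fastforce+\<close>)

lemma mono_deg_superset:
  assumes "finite A" "Poly_Mapping.keys m \<subseteq> A"
  shows "mono_deg m = (\<Sum>i\<in>A. Poly_Mapping.lookup m i)"
  unfolding mono_deg_def using assms
  by (intro sum.mono_neutral_left) (auto simp: in_keys_iff)

lemma mono_deg_add: "mono_deg (m + m') = mono_deg m + mono_deg m'"
proof -
  let ?A = "Poly_Mapping.keys m \<union> Poly_Mapping.keys m'"
  have "mono_deg (m + m') = (\<Sum>i\<in>?A. Poly_Mapping.lookup (m + m') i)"
    by (intro mono_deg_superset) (auto dest: subsetD[OF keys_add])
  also have "\<dots> = mono_deg m + mono_deg m'"
    by (simp add: lookup_add sum.distrib mono_deg_superset[of ?A])
  finally show ?thesis .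
qed

lemma deg_le_0 [simp]: "deg_le 0 d"
  by (simp add: deg_le_def)

lemma deg_le_Const [simp]: "deg_le (Const c) d"
  by (cases "c = 0") (simp_all add: deg_le_def Const_def mono_deg_def)

lemma deg_le_1 [simp]: "deg_le (1 :: ('v, 'c::comm_ring_1) mpoly) d"
  using deg_le_Const[of "1 :: 'c"] by simp

lemma deg_le_Var: "deg_le (Var i :: ('v, 'c::comm_ring_1) mpoly) 1"
  by (simp add: deg_le_def Var_def mono_deg_def)

lemma deg_le_mono: "deg_le p d \<Longrightarrow> d \<le> e \<Longrightarrow> deg_le p e"
  by (auto simp: deg_le_def)

lemma deg_le_add: "deg_le p d \<Longrightarrow> deg_le q d \<Longrightarrow> deg_le (p + q) d"
  unfolding deg_le_def by (auto dest: subsetD[OF keys_add])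

lemma deg_le_uminus [simp]: "deg_le (- p) d \<longleftrightarrow> deg_le (p :: ('v, 'c::comm_ring_1) mpoly) d"
  by (simp add: deg_le_def keys_def)

lemma deg_le_diff: "deg_le p d \<Longrightarrow> deg_le q d \<Longrightarrow> deg_le (p - q :: ('v, 'c::comm_ring_1) mpoly) d"
  using deg_le_add[of p d "- q"] by simp

lemma deg_le_mult:
  "deg_le p d \<Longrightarrow> deg_le q e \<Longrightarrow> deg_le (p * q :: ('v, 'c::comm_ring_1) mpoly) (d + e)"
  unfolding deg_le_def
  by (auto simp: mono_deg_add dest!: subsetD[OF keys_mult] intro!: add_mono)

lemma deg_le_power:
  "deg_le p d \<Longrightarrow> deg_le (p ^ k :: ('v, 'c::comm_ring_1) mpoly) (k * d)"
  by (induction k) (auto dest: deg_le_mult)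

lemma deg_le_sum: "(\<And>i. i \<in> I \<Longrightarrow> deg_le (f i) d) \<Longrightarrow> deg_le (\<Sum>i\<in>I. f i) d"
  by (induction I rule: infinite_finite_induct) (auto intro: deg_le_add)


section \<open>Formal power series in arbitrarily many variables\<close>

typedef ('v, 'c) mfps = "UNIV :: (('v \<Rightarrow>\<^sub>0 nat) \<Rightarrow> 'c) set"
  morphisms mcoeff MFPS ..

setup_lifting type_definition_mfps

definition mono_splits :: "('v \<Rightarrow>\<^sub>0 nat) \<Rightarrow> (('v \<Rightarrow>\<^sub>0 nat) \<times> ('v \<Rightarrow>\<^sub>0 nat)) set"
  where "mono_splits m = {(u, v). u + v = m}"

lemma finite_mono_splits [simp]: "finite (mono_splits m)"
proof -
  let ?S = "{f. (\<forall>i. (i \<in> Poly_Mapping.keys m \<longrightarrow> f i \<in> {..mono_deg m}) \<and> (i \<notin> Poly_Mapping.keys m \<longrightarrow> f i = 0))}"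
  have fin: "finite ?S"
    by (intro finite_set_of_finite_funs) auto
  have bound: "Poly_Mapping.lookup u i \<le> mono_deg m \<and> (i \<notin> Poly_Mapping.keys m \<longrightarrow> Poly_Mapping.lookup u i = 0)" if "u + v = m" for u v i
  proof -
    have *: "Poly_Mapping.lookup m i = Poly_Mapping.lookup u i + Poly_Mapping.lookup v i"
      using that by (auto simp: lookup_add)
    have "Poly_Mapping.lookup m i \<le> mono_deg m"
      by (cases "i \<in> Poly_Mapping.keys m")
        (auto simp: mono_deg_def in_keys_iff intro!: member_le_sum)
    with * show ?thesis by (auto simp: in_keys_iff)
  qed
  have "inj_on (\<lambda>(u, v). Poly_Mapping.lookup u) (mono_splits m)"
    by (auto simp: inj_on_def mono_splits_def)
  moreover have "(\<lambda>(u, v). Poly_Mapping.lookup u) ` mono_splits m \<subseteq> ?S"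
    using bound by (auto simp: mono_splits_def)
  ultimately show ?thesis
    using fin by (meson finite_imageD finite_subset)
qed

instantiation mfps :: (type, comm_ring_1) comm_ring_1
begin

lift_definition zero_mfps :: "('a, 'b) mfps" is "\<lambda>_. 0" .
lift_definition one_mfps :: "('a, 'b) mfps" is "\<lambda>m. if m = 0 then 1 else 0" .
lift_definition plus_mfps :: "('a, 'b) mfps \<Rightarrow> ('a, 'b) mfps \<Rightarrow> ('a, 'b) mfps"
  is "\<lambda>f g m. f m + g m" .
lift_definition minus_mfps :: "('a, 'b) mfps \<Rightarrow> ('a, 'b) mfps \<Rightarrow> ('a, 'b) mfps"
  is "\<lambda>f g m. f m - g m" .
lift_definition uminus_mfps :: "('a, 'b) mfps \<Rightarrow> ('a, 'b) mfps"
  is "\<lambda>f m. - f m" .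
lift_definition times_mfps :: "('a, 'b) mfps \<Rightarrow> ('a, 'b) mfps \<Rightarrow> ('a, 'b) mfps"
  is "\<lambda>f g m. \<Sum>(u, v)\<in>mono_splits m. f u * g v" .

instance
proof
  fix f g h :: "('a, 'b) mfps"
  show "f * g * h = f * (g * h)"
  proof (transfer, rule ext)
    fix f g h :: "('a \<Rightarrow>\<^sub>0 nat) \<Rightarrow> 'b" and m
    have "(\<Sum>(u, v)\<in>mono_splits m. (\<Sum>(p, q)\<in>mono_splits u. f p * g q) * h v) =
          (\<Sum>((u, v), (p, q))\<in>Sigma (mono_splits m) (\<lambda>(u, v). mono_splits u). f p * g q * h v)"
      by (subst sum.Sigma[symmetric])
        (auto simp: sum_distrib_right case_prod_unfold)
    also have "\<dots> = (\<Sum>((u, v), (p, q))\<in>Sigma (mono_splits m) (\<lambda>(u, v). mono_splits v). f u * (g p * h q))"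
      by (rule sum.reindex_bij_witness[of _
            "\<lambda>((u, v), (p, q)). ((u + p, q), (u, p))" "\<lambda>((u, v), (p, q)). ((p, q + v), (q, v))"])
        (auto simp: mono_splits_def algebra_simps)
    also have "\<dots> = (\<Sum>(u, v)\<in>mono_splits m. f u * (\<Sum>(p, q)\<in>mono_splits v. g p * h q))"
      by (subst sum.Sigma[symmetric])
        (auto simp: sum_distrib_left case_prod_unfold)
    finally show "(\<Sum>(u, v)\<in>mono_splits m. (\<Sum>(p, q)\<in>mono_splits u. f p * g q) * h v) =
        (\<Sum>(u, v)\<in>mono_splits m. f u * (\<Sum>(p, q)\<in>mono_splits v. g p * h q))" .
  qed
  show "f * g = g * f"
    by (transfer, rule ext, rule sum.reindex_bij_witness[of _ prod.swap prod.swap])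
      (auto simp: mono_splits_def algebra_simps)
  show "1 * f = f"
  proof (transfer, rule ext)
    fix f :: "('a \<Rightarrow>\<^sub>0 nat) \<Rightarrow> 'b" and m
    have "(\<Sum>(u, v)\<in>mono_splits m. (if u = 0 then 1 else 0) * f v) =
          (\<Sum>(u, v)\<in>{(0 :: 'a \<Rightarrow>\<^sub>0 nat, m)}. (if u = 0 then 1 else 0) * f v)"
      by (rule sum.mono_neutral_right[OF finite_mono_splits])
        (auto simp: mono_splits_def split: if_splits)
    then show "(\<Sum>(u, v)\<in>mono_splits m. (if u = 0 then 1 else 0) * f v) = f m"
      by simp
  qed
  show "(f + g) * h = f * h + g * h"
    by (transfer, rule ext) (simp add: case_prod_unfold algebra_simps sum.distrib)
  show "f + g + h = f + (g + h)" "f + g = g + f" "0 + f = f" "- f + f = 0" "f - g = f + - g"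
    by (transfer, simp add: algebra_simps)+
  show "(0 :: ('a, 'b) mfps) \<noteq> 1"
    by transfer (metis zero_neq_one)
qed

end

definition PS_Const :: "'c \<Rightarrow> ('v, 'c::zero) mfps"
  where "PS_Const c = MFPS (\<lambda>m. if m = 0 then c else 0)"

definition PS_Var :: "'v \<Rightarrow> ('v, 'c::zero_neq_one) mfps"
  where "PS_Var i = MFPS (\<lambda>m. if m = Poly_Mapping.single i 1 then 1 else 0)"

text \<open>Setting to zero all variables outside \<open>A\<close>.\<close>

definition PS_restrict :: "'v set \<Rightarrow> ('v, 'c::zero) mfps \<Rightarrow> ('v, 'c) mfps"
  where "PS_restrict A F = MFPS (\<lambda>m. if Poly_Mapping.keys m \<subseteq> A then mcoeff F m else 0)"

text \<open>Formal (possibly infinite) sums: each coefficient of the sum is a finite sum.\<close>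

definition has_formal_sum :: "('i \<Rightarrow> ('v, 'c::comm_monoid_add) mfps) \<Rightarrow> ('v, 'c) mfps \<Rightarrow> bool"
  where "has_formal_sum f F \<longleftrightarrow>
    (\<forall>m. finite {i. mcoeff (f i) m \<noteq> 0} \<and>
         mcoeff F m = (\<Sum>i | mcoeff (f i) m \<noteq> 0. mcoeff (f i) m))"

text \<open>The quotient of \<open>p\<close> by a divisor \<open>q\<close> that is not a zero divisor.\<close>

definition exact_quot :: "'r::comm_ring_1 \<Rightarrow> 'r \<Rightarrow> 'r"
  where "exact_quot p q = (THE r. r * q = p)"


section \<open>Partitions and bialternants\<close>

text \<open>A partition is stored with 0-based rows: \<open>row \<kappa> k\<close> is the part \<open>\<kappa>\<^sub>k\<^sub>+\<^sub>1\<close>.\<close>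

typedef partition = "{f :: nat \<Rightarrow> nat. antimono f \<and> finite {k. f k \<noteq> 0}}"
  morphisms row Partition
  by (rule exI[of _ "\<lambda>_. 0"]) (simp add: antimono_def)

definition part :: "partition \<Rightarrow> nat \<Rightarrow> nat"
  where "part \<kappa> j = row \<kappa> (j - 1)"

definition plength :: "partition \<Rightarrow> nat"
  where "plength \<kappa> = card {j. 1 \<le> j \<and> part \<kappa> j \<noteq> 0}"

definition diag_boxes :: "partition \<Rightarrow> nat"
  where "diag_boxes \<kappa> = card {j. 1 \<le> j \<and> j \<le> part \<kappa> j}"

text \<open>\<open>det [A i j] / (\<Prod>i<j. x i - x j)\<close> with indices in \<open>1, \<dots>, n\<close>
  (matrices of the library are indexed from \<open>0\<close>).\<close>

definition bialternant :: "nat \<Rightarrow> (nat \<Rightarrow> nat \<Rightarrow> 'r) \<Rightarrow> (nat \<Rightarrow> 'r) \<Rightarrow> 'r::comm_ring_1"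
  where "bialternant n A x = exact_quot
    (det (mat n n (\<lambda>(i, j). A (Suc i) (Suc j))))
    (\<Prod>(i, j) | 1 \<le> i \<and> i < j \<and> j \<le> n. x i - x j)"


section \<open>The ring of double symmetric functions\<close>

text \<open>\<open>qa\<close> is \<open>\<rat>[a]\<close>; the variables \<open>x\<^sub>i\<close> are indexed by \<open>i \<ge> 1\<close>, and index \<open>0\<close> is never used.\<close>

type_synonym qa = "(int, rat) mpoly"
type_synonym xpoly = "(nat, qa) mpoly"
type_synonym xseries = "(nat, qa) mfps"

abbreviation a :: "int \<Rightarrow> qa" where "a i \<equiv> Var i"

definition is_lam :: "(nat \<Rightarrow> xpoly) \<Rightarrow> bool"
  where "is_lam P \<longleftrightarrow>
    (\<forall>n. vars (P n) \<subseteq> {1..n}) \<and>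
    (\<forall>n \<pi>. \<pi> permutes {1..n} \<longrightarrow> subst (\<lambda>i. Var (\<pi> i)) (P n) = P n) \<and>
    (\<exists>d. \<forall>n. deg_le (P n) d) \<and>
    (\<forall>n\<ge>1. subst (Var(n := Const (a (int n)))) (P n) = P (n - 1))"

lemma is_lam_Const: "is_lam (\<lambda>_. Const c)"
  by (auto simp: is_lam_def)

lemma is_lam_add: "is_lam P \<Longrightarrow> is_lam Q \<Longrightarrow> is_lam (\<lambda>n. P n + Q n)"
  unfolding is_lam_def subst_add
  by (intro conjI; (elim conjE exE)?)
    (use vars_add in \<open>fastforce\<close>, simp,
     meson deg_le_add deg_le_mono max.cobounded1 max.cobounded2, simp)

lemma is_lam_mult: "is_lam P \<Longrightarrow> is_lam Q \<Longrightarrow> is_lam (\<lambda>n. P n * Q n)"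
  unfolding is_lam_def subst_mult
  by (intro conjI; (elim conjE exE)?)
    (use vars_mult in \<open>fastforce\<close>, simp, meson deg_le_mult, simp)

lemma is_lam_uminus: "is_lam P \<Longrightarrow> is_lam (\<lambda>n. - P n)"
  unfolding is_lam_def subst_uminus by simp

lifting_forget poly_mapping.lifting

typedef lam = "{P. is_lam P}"
  morphisms lam_seq Lam
  using is_lam_Const by blast

setup_lifting type_definition_lam

lift_definition lam_const :: "qa \<Rightarrow> lam" is "\<lambda>c _. Const c"
  by (rule is_lam_Const)

instantiation lam :: comm_ring_1
begin

lift_definition zero_lam :: lam is "\<lambda>_. 0"
  using is_lam_Const[of 0] by simp
lift_definition one_lam :: lam is "\<lambda>_. 1"
  using is_lam_Const[of 1] by simp
lift_definition plus_lam :: "lam \<Rightarrow> lam \<Rightarrow> lam" is "\<lambda>P Q n. P n + Q n"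
  by (rule is_lam_add)
lift_definition uminus_lam :: "lam \<Rightarrow> lam" is "\<lambda>P n. - P n"
  by (rule is_lam_uminus)
lift_definition minus_lam :: "lam \<Rightarrow> lam \<Rightarrow> lam" is "\<lambda>P Q n. P n - Q n"
  using is_lam_add is_lam_uminus by fastforce
lift_definition times_lam :: "lam \<Rightarrow> lam \<Rightarrow> lam" is "\<lambda>P Q n. P n * Q n"
  by (rule is_lam_mult)

instance
proof
  show "(0 :: lam) \<noteq> 1"
    by transfer (metis zero_neq_one)
qed (transfer; simp add: algebra_simps)+

end

lift_definition power_sum :: "nat \<Rightarrow> lam"
  is "\<lambda>k n. \<Sum>i = 1..n. Var i ^ k - Const (a (int i)) ^ k"
proof -
  fix k
  let ?p = "\<lambda>n. \<Sum>i = 1..n. Var i ^ k - Const (a (int i)) ^ k :: xpoly"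
  have "vars (?p n) \<subseteq> {1..n}" for n
  proof -
    have "vars (Var i ^ k - Const (a (int i)) ^ k :: xpoly) \<subseteq> {i}" for i
      using vars_diff[of "Var i ^ k :: xpoly" "Const (a (int i)) ^ k"]
        vars_power[of "Var i :: xpoly" k] vars_power[of "Const (a (int i)) :: xpoly" k]
      by auto
    then show ?thesis
      using vars_sum[of "\<lambda>i. Var i ^ k - Const (a (int i)) ^ k :: xpoly" "{1..n}"] by fastforce
  qed
  moreover have "subst (\<lambda>i. Var (\<pi> i)) (?p n) = ?p n" if "\<pi> permutes {1..n}" for n \<pi>
  proof -
    have "(\<Sum>i = 1..n. Var (\<pi> i) ^ k :: xpoly) = (\<Sum>i = 1..n. Var i ^ k)"
      using sum.permute[OF that, of "\<lambda>i. Var i ^ k :: xpoly"] by (simp add: o_def)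
    then show ?thesis
      by (simp add: subst_sum subst_diff subst_power sum_subtractf)
  qed
  moreover have "deg_le (?p n) k" for n
  proof (intro deg_le_sum deg_le_diff)
    fix i
    show "deg_le (Var i ^ k :: xpoly) k"
      using deg_le_power[OF deg_le_Var[of i], of k] by simp
    show "deg_le (Const (a (int i)) ^ k :: xpoly) k"
      using deg_le_power[OF deg_le_Const[of "a (int i)" 0], of k] deg_le_mono by fastforce
  qed
  moreover have "subst (Var(n := Const (a (int n)))) (?p n) = ?p (n - 1)" if "n \<ge> 1" for n
  proof -
    have "{1..n} = insert n {1..n - 1}"
      using that by auto
    moreover have "n \<notin> {1..n - 1}"
      using that by auto
    ultimately have "subst (Var(n := Const (a (int n)))) (?p n) =
        (\<Sum>i = 1..n - 1. subst (Var(n := Const (a (int n)))) (Var i ^ k - Const (a (int i)) ^ k))"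
      by (simp add: subst_sum subst_add subst_diff subst_power)
    also have "\<dots> = ?p (n - 1)"
      by (intro sum.cong) (use that in \<open>auto simp: subst_diff subst_power\<close>)
    finally show ?thesis .
  qed
  ultimately show "is_lam ?p"
    unfolding is_lam_def by blast
qed

text \<open>\<open>double_power n i r = (x\<^sub>i - a\<^sub>n) (x\<^sub>i - a\<^sub>n\<^sub>-\<^sub>1) \<dots> (x\<^sub>i - a\<^sub>n\<^sub>-\<^sub>r\<^sub>+\<^sub>1)\<close>\<close>

definition double_power :: "nat \<Rightarrow> nat \<Rightarrow> nat \<Rightarrow> xpoly"
  where "double_power n i r = (\<Prod>k<r. Var i - Const (a (int n - int k)))"

definition double_schur_poly :: "nat \<Rightarrow> partition \<Rightarrow> xpoly"
  where "double_schur_poly n \<kappa> =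
    (if plength \<kappa> \<le> n
     then bialternant n (\<lambda>i j. double_power n i (part \<kappa> j + n - j)) Var
     else 0)"

definition double_schur :: "partition \<Rightarrow> lam"
  where "double_schur \<kappa> = Lam (\<lambda>n. double_schur_poly n \<kappa>)"


section \<open>The tensor square\<close>

text \<open>
  A copy of the multiplicative monoid of a ring, written additively, so that
  \<open>lam mul \<times> lam mul \<Rightarrow>\<^sub>0 qa\<close> is the free \<open>\<rat>[a]\<close>-module on the symbols
  \<open>(P, Q)\<close> with the product \<open>(P, Q) (P', Q') = (P P', Q Q')\<close>.
\<close>

typedef 'r mul = "UNIV :: 'r set" morphisms unmul Mul ..

setup_lifting type_definition_mul

instantiation mul :: (comm_monoid_mult) comm_monoid_add
begin

lift_definition zero_mul :: "'a mul" is 1 .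
lift_definition plus_mul :: "'a mul \<Rightarrow> 'a mul \<Rightarrow> 'a mul" is "(*)" .

instance
  by standard (transfer; simp add: ac_simps)+

end

type_synonym lam_pairs = "(lam mul \<times> lam mul) \<Rightarrow>\<^sub>0 qa"

definition pair_gen :: "lam \<Rightarrow> lam \<Rightarrow> lam_pairs"
  where "pair_gen P Q = Poly_Mapping.single (Mul P, Mul Q) 1"

text \<open>
  The submodule spanned by the bilinearity relations. The set of these relations is stable
  under multiplication by the symbols \<open>(U, V)\<close>, so this submodule is an ideal and the
  coefficients \<open>f\<close> below may be taken from the whole ring.
\<close>

inductive_set tensor_null :: "lam_pairs set" where
  zero: "0 \<in> tensor_null"
| add_left: "g \<in> tensor_null \<Longrightarrow>
    g + f * (pair_gen (P + P') Q - pair_gen P Q - pair_gen P' Q) \<in> tensor_null"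
| add_right: "g \<in> tensor_null \<Longrightarrow>
    g + f * (pair_gen P (Q + Q') - pair_gen P Q - pair_gen P Q') \<in> tensor_null"
| scale_left: "g \<in> tensor_null \<Longrightarrow>
    g + f * (pair_gen (lam_const c * P) Q - Const c * pair_gen P Q) \<in> tensor_null"
| scale_right: "g \<in> tensor_null \<Longrightarrow>
    g + f * (pair_gen P (lam_const c * Q) - Const c * pair_gen P Q) \<in> tensor_null"

lemma tensor_null_add: "g \<in> tensor_null \<Longrightarrow> h \<in> tensor_null \<Longrightarrow> h + g \<in> tensor_null"
  by (induction g rule: tensor_null.induct)
    (auto simp: add.assoc[symmetric] intro: tensor_null.intros)

lemma tensor_null_mult: "g \<in> tensor_null \<Longrightarrow> h * g \<in> tensor_null"
  by (induction g rule: tensor_null.induct)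
    (auto simp: distrib_left mult.assoc[symmetric] intro: tensor_null.intros)

lemma tensor_null_uminus: "g \<in> tensor_null \<Longrightarrow> - g \<in> tensor_null"
  using tensor_null_mult[of g "- 1"] by simp

definition tensor_rel :: "lam_pairs \<Rightarrow> lam_pairs \<Rightarrow> bool"
  where "tensor_rel f g \<longleftrightarrow> f - g \<in> tensor_null"

quotient_type lam_tensor = lam_pairs / tensor_rel
proof (rule equivpI)
  show "reflp tensor_rel"
    by (auto simp: reflp_def tensor_rel_def tensor_null.zero)
  show "symp tensor_rel"
    by (auto simp: symp_def tensor_rel_def dest: tensor_null_uminus)
  show "transp tensor_rel"
  proof (rule transpI)
    fix f g h
    assume "tensor_rel f g" "tensor_rel g h"
    then have "(f - g) + (g - h) \<in> tensor_null"
      unfolding tensor_rel_def by (intro tensor_null_add)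
    then show "tensor_rel f h"
      by (simp add: tensor_rel_def)
  qed
qed

lift_definition tensor :: "lam \<Rightarrow> lam \<Rightarrow> lam_tensor" (infixl "\<otimes>\<^sub>\<Lambda>" 75) is pair_gen .

lift_definition tensor_const :: "qa \<Rightarrow> lam_tensor" is Const .

instantiation lam_tensor :: comm_ring
begin

lift_definition zero_lam_tensor :: lam_tensor is 0 .
lift_definition plus_lam_tensor :: "lam_tensor \<Rightarrow> lam_tensor \<Rightarrow> lam_tensor" is "(+)"
proof -
  fix f f' g g'
  assume "tensor_rel f f'" "tensor_rel g g'"
  then have "(f - f') + (g - g') \<in> tensor_null"
    unfolding tensor_rel_def by (intro tensor_null_add)
  then show "tensor_rel (f + g) (f' + g')"
    by (simp add: tensor_rel_def add_diff_add)
qed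
lift_definition uminus_lam_tensor :: "lam_tensor \<Rightarrow> lam_tensor" is uminus
proof -
  fix f f'
  assume "tensor_rel f f'"
  then have "- (f - f') \<in> tensor_null"
    unfolding tensor_rel_def by (rule tensor_null_uminus)
  then show "tensor_rel (- f) (- f')"
    by (simp add: tensor_rel_def)
qed
definition minus_lam_tensor :: "lam_tensor \<Rightarrow> lam_tensor \<Rightarrow> lam_tensor"
  where "minus_lam_tensor s t = s + - t"
lift_definition times_lam_tensor :: "lam_tensor \<Rightarrow> lam_tensor \<Rightarrow> lam_tensor" is "(*)"
proof -
  fix f f' g g'
  assume "tensor_rel f f'" "tensor_rel g g'"
  then have "g * (f - f') \<in> tensor_null" "f' * (g - g') \<in> tensor_null"
    by (auto simp: tensor_rel_def intro: tensor_null_mult)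
  then have "g * (f - f') + f' * (g - g') \<in> tensor_null"
    using tensor_null_add by blast
  then show "tensor_rel (f * g) (f' * g')"
    by (simp add: tensor_rel_def algebra_simps)
qed

instance
proof
  have eq: "tensor_rel f g" if "f = g" for f g
    using that by (simp add: tensor_rel_def tensor_null.zero)
  fix r s t :: lam_tensor
  show "r + s + t = r + (s + t)"
    by (transfer, rule eq) (rule add.assoc)
  show "r + s = s + r"
    by (transfer, rule eq) (rule add.commute)
  show "0 + r = r"
    by (transfer, rule eq) (rule add_0)
  show "- r + r = 0"
    by (transfer, rule eq) (rule left_minus)
  show "r - s = r + - s"
    by (rule minus_lam_tensor_def)
  show "r * s * t = r * (s * t)"
    by (transfer, rule eq) (rule mult.assoc)
  show "r * s = s * r"
    by (transfer, rule eq) (rule mult.commute)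
  show "(r + s) * t = r * t + s * t"
    by (transfer, rule eq) (rule distrib_right)
qed

end


section \<open>Dual Littlewood--Richardson polynomials\<close>

text \<open>The \<open>\<rat>[a]\<close>-linear ring homomorphism for which all power sums are primitive.
  The unit of the tensor square is \<open>1 \<otimes>\<^sub>\<Lambda> 1\<close>.\<close>

definition is_comult :: "(lam \<Rightarrow> lam_tensor) \<Rightarrow> bool"
  where "is_comult \<Delta> \<longleftrightarrow>
    \<Delta> 1 = 1 \<otimes>\<^sub>\<Lambda> 1 \<and>
    (\<forall>P Q. \<Delta> (P + Q) = \<Delta> P + \<Delta> Q) \<and>
    (\<forall>P Q. \<Delta> (P * Q) = \<Delta> P * \<Delta> Q) \<and>
    (\<forall>c P. \<Delta> (lam_const c * P) = tensor_const c * \<Delta> P) \<and>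
    (\<forall>k\<ge>1. \<Delta> (power_sum k) = power_sum k \<otimes>\<^sub>\<Lambda> 1 + 1 \<otimes>\<^sub>\<Lambda> power_sum k)"

definition comult :: "lam \<Rightarrow> lam_tensor"
  where "comult = (THE \<Delta>. is_comult \<Delta>)"

text \<open>The finitely supported family of coefficients of the comultiplication of a double
  Schur function in the basis of products of double Schur functions.\<close>

definition comult_coeffs :: "partition \<Rightarrow> (partition \<times> partition) \<Rightarrow>\<^sub>0 qa"
  where "comult_coeffs \<nu> = (THE c. comult (double_schur \<nu>) =
    (\<Sum>(\<kappa>, \<mu>)\<in>Poly_Mapping.keys c.
      tensor_const (Poly_Mapping.lookup c (\<kappa>, \<mu>)) * (double_schur \<kappa> \<otimes>\<^sub>\<Lambda> double_schur \<mu>)))"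

definition dual_LR :: "partition \<Rightarrow> partition \<Rightarrow> partition \<Rightarrow> qa"
  where "dual_LR \<kappa> \<mu> \<nu> = Poly_Mapping.lookup (comult_coeffs \<nu>) (\<kappa>, \<mu>)"


section \<open>Dual Schur functions\<close>

text \<open>The series in \<open>x\<^sub>1, x\<^sub>2, \<dots>\<close> defined by a sequence of series \<open>F n\<close> in \<open>x\<^sub>1, \<dots>, x\<^sub>n\<close>
  compatible with setting \<open>x\<^sub>n = 0\<close>.\<close>

definition stable_limit :: "(nat \<Rightarrow> xseries) \<Rightarrow> xseries"
  where "stable_limit F =
    (THE G. PS_restrict {1..} G = G \<and> (\<forall>n. PS_restrict {1..n} G = F n))"

definition schur :: "partition \<Rightarrow> xseries"
  where "schur \<kappa> = stable_limit (\<lambda>n.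
    if plength \<kappa> \<le> n
    then bialternant n (\<lambda>i j. PS_Var i ^ (part \<kappa> j + n - j)) PS_Var
    else 0)"

text \<open>The ring of formal sums \<open>\<Sum>\<kappa>. c \<kappa> s\<^sub>\<kappa>(x)\<close>, realised inside the power series in
  \<open>x\<^sub>1, x\<^sub>2, \<dots>\<close> over \<open>\<rat>[a]\<close>.\<close>

definition hat_lam :: "xseries set"
  where "hat_lam = {F. \<exists>c. has_formal_sum (\<lambda>\<kappa>. PS_Const (c \<kappa>) * schur \<kappa>) F}"

definition dual_entry :: "nat \<Rightarrow> partition \<Rightarrow> nat \<Rightarrow> nat \<Rightarrow> xseries"
  where "dual_entry n \<kappa> i j =
    (if j \<le> diag_boxes \<kappa>
     then exact_quot (PS_Var i ^ (part \<kappa> j + n - j))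
       (\<Prod>k\<in>{int j - int (part \<kappa> j)..0}. 1 - PS_Const (a k) * PS_Var i)
     else PS_Var i ^ (part \<kappa> j + n - j) *
       (\<Prod>k\<in>{1..int j - int (part \<kappa> j) - 1}. 1 - PS_Const (a k) * PS_Var i))"

definition dual_schur_series :: "nat \<Rightarrow> partition \<Rightarrow> xseries"
  where "dual_schur_series n \<kappa> =
    (if plength \<kappa> \<le> n then bialternant n (dual_entry n \<kappa>) PS_Var else 0)"

definition dual_schur :: "partition \<Rightarrow> xseries"
  where "dual_schur \<kappa> = stable_limit (\<lambda>n. dual_schur_series n \<kappa>)"

end

(*
Put h(y) = \<Prod>_i (1 - a_i y) / (1 - x_i y) and let h_k, in Lambda(x||a), be the coefficient of y^k.
For an exponent vector \<beta> let h_\<beta> be the product of the h_{\<beta>_j}. The Cauchy identity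
  \<Prod>_j h(y_j) = \<Sum>_\<nu> s_\<nu>(x||a) s^_\<nu>(y||a)
says that [y^\<beta>] s^_\<nu> is the coefficient of s_\<nu>(x||a) in h_\<beta>. Restricted to n variables x and y
it follows from Cauchy's determinant, the Cauchy-Binet formula and Newton interpolation of
1 / (1 - x y) at the nodes a_n, a_{n-1}, ...; taken as a definition, it shows that the dual Schur
functions exist and are stable.

Symmetric series in y expand in the dual Schur functions by unitriangularity, which defines
coefficients c with s^_\<lambda> s^_\<mu> = \<Sum>_\<nu> c_\<nu> s^_\<nu>. The linear map sending s_\<nu>(x||a) to the sum of the
c_\<nu> s_\<lambda> \<otimes> s_\<mu> then sends h_\<beta> to \<Sum>_{u + v = \<beta>} h_u \<otimes> h_v, by comparing coefficients of y^\<beta>. As the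
h_\<beta> span Lambda(x||a), the map is a ring homomorphism, and Newton's identities
k h_k = \<Sum>_i p_i h_{k-i} show that the power sums are primitive and that it is the only such map. So it is
the comultiplication, and the c are the dual Littlewood-Richardson polynomials.
*)
theory Submission
  imports Defs "HOL-Computational_Algebra.Formal_Power_Series"
begin

section \<open>Alternants\<close>

declare One_nat_def [simp del]

text \<open>The quotients, limits, comultiplication and coefficients in the definitions are definite
  descriptions, so existence and uniqueness must be shown for each of them. Cauchy's determinant
  supplies most of this. Its coefficients in y show that the Vandermonde product divides all
  alternants in question, and its symmetry in x gives the antisymmetry of the Vandermonde product.
  Division is postponed throughout: identities are stated after multiplication by a Vandermonde
  product, which in power series over any commutative ring is not a zero divisor.

  Two limits have to be handled. The kernel identity holds only for n variables x at a time, so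
  coefficients in the basis s_\<nu>(x||a) must be readable at a single level n. In y the limit is
  avoided, because a coefficient of h_\<beta> is defined for all exponents \<beta> at once, and the
  determinant formulas are compared with restrictions of the resulting series.

  Characteristic 0 enters in two places: 2 is not a zero divisor, so alternating series live on
  distinct exponents; and Newton's identities can be solved for h_k, which makes the
  comultiplication unique.\<close>

definition alt :: "nat \<Rightarrow> (nat \<Rightarrow> nat \<Rightarrow> 'r) \<Rightarrow> 'r::comm_ring_1"
  where "alt n A = (\<Sum>\<pi> | \<pi> permutes {1..n}. of_int (sign \<pi>) * (\<Prod>j\<in>{1..n}. A (\<pi> j) j))"

definition vdm :: "nat \<Rightarrow> (nat \<Rightarrow> 'r) \<Rightarrow> 'r::comm_ring_1"
  where "vdm n x = (\<Prod>(i, j) | 1 \<le> i \<and> i < j \<and> j \<le> n. x i - x j)"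

lemma alt_cong:
  assumes "\<And>i j. i \<in> {1..n} \<Longrightarrow> j \<in> {1..n} \<Longrightarrow> A i j = B i j"
  shows "alt n A = alt n B"
  unfolding alt_def
proof (rule sum.cong[OF refl])
  fix \<pi> assume "\<pi> \<in> {\<pi>. \<pi> permutes {1..n}}"
  then have p: "\<pi> permutes {1..n}" by simp
  have "(\<Prod>j\<in>{1..n}. A (\<pi> j) j) = (\<Prod>j\<in>{1..n}. B (\<pi> j) j)"
    by (intro prod.cong refl assms) (use permutes_in_image[OF p] in auto)
  then show "of_int (sign \<pi>) * (\<Prod>j\<in>{1..n}. A (\<pi> j) j) = of_int (sign \<pi>) * (\<Prod>j\<in>{1..n}. B (\<pi> j) j)"
    by simp
qed

text \<open>Conjugation by \<open>Suc\<close> carries permutations of {0..<n} to those of {1..n} and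
  preserves signs; the transposition moves the permutation from the column index to the row
  index.\<close>

lemma det_eq_alt: "det (mat n n (\<lambda>(i, j). A (Suc i) (Suc j))) = alt n A"
proof -
  let ?M = "mat n n (\<lambda>(i, j). A (Suc i) (Suc j))"
  have "det ?M = (\<Sum>p | p permutes {0..<n}. signof p * (\<Prod>i = 0..<n. transpose_mat ?M $$ (i, p i)))"
    by (subst det_transpose[of ?M n, symmetric]) (simp_all add: Determinant.det_def)
  also have "\<dots> = (\<Sum>p | p permutes {0..<n}. of_int (sign p) * (\<Prod>i = 0..<n. A (Suc (p i)) (Suc i)))"
  proof (rule sum.cong[OF refl], clarify)
    fix p assume p: "p permutes {0..<n}"
    have "(\<Prod>i = 0..<n. transpose_mat ?M $$ (i, p i)) = (\<Prod>i = 0..<n. A (Suc (p i)) (Suc i))"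
      by (rule prod.cong[OF refl]) (use permutes_in_image[OF p] in auto)
    moreover have "signof p = (of_int (sign p) :: 'a)"
      by (simp add: sign_def)
    ultimately show "signof p * (\<Prod>i = 0..<n. transpose_mat ?M $$ (i, p i)) =
        of_int (sign p) * (\<Prod>i = 0..<n. A (Suc (p i)) (Suc i))" by simp
  qed
  also have "\<dots> = alt n A"
  proof -
    have inj: "inj_on Suc {0..<n}" and bij: "bij_betw Suc {0..<n} {1..n}"
      by (auto simp: bij_betw_def image_Suc_atLeastLessThan atLeastLessThanSuc_atLeastAtMost)
    have bij': "bij_betw (\<lambda>i. i - 1) {1..n} {0..<n}"
      by (rule bij_betw_byWitness[where f' = Suc]) auto
    have *: "(\<Prod>j\<in>{1..n}. A (map_permutation {0..<n} Suc p j) j) = (\<Prod>i = 0..<n. A (Suc (p i)) (Suc i))" for p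
    proof -
      have "(\<Prod>i = 0..<n. A (Suc (p i)) (Suc i)) = (\<Prod>i = 0..<n. A (map_permutation {0..<n} Suc p (Suc i)) (Suc i))"
        by (rule prod.cong[OF refl]) (use map_permutation_apply[OF inj] in simp)
      also have "\<dots> = (\<Prod>j\<in>{1..n}. A (map_permutation {0..<n} Suc p j) j)"
        using prod.reindex_bij_betw[OF bij, of "\<lambda>j. A (map_permutation {0..<n} Suc p j) j"] .
      finally show ?thesis by simp
    qed
    have bb: "bij_betw (map_permutation {0..<n} Suc) {p. p permutes {0..<n}} {p. p permutes {1..n}}"
    proof (rule bij_betw_byWitness[where f' = "map_permutation {1..n} (\<lambda>i. i - 1)"])
      show "\<forall>a\<in>{p. p permutes {0..<n}}. map_permutation {1..n} (\<lambda>i. i - 1) (map_permutation {0..<n} Suc a) = a"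
        by (intro ballI map_permutation_compose_inv[OF bij]) auto
      show "\<forall>a\<in>{p. p permutes {1..n}}. map_permutation {0..<n} Suc (map_permutation {1..n} (\<lambda>i. i - 1) a) = a"
        by (intro ballI map_permutation_compose_inv[OF bij']) auto
      show "map_permutation {0..<n} Suc ` {p. p permutes {0..<n}} \<subseteq> {p. p permutes {1..n}}"
        using map_permutation_permutes[OF bij] by auto
      show "map_permutation {1..n} (\<lambda>i. i - 1) ` {p. p permutes {1..n}} \<subseteq> {p. p permutes {0..<n}}"
        using map_permutation_permutes[OF bij'] by auto
    qed
    have sg: "sign (map_permutation {0..<n} Suc p) = sign p" if "p permutes {0..<n}" for p
      using sign_map_permutation[OF inj that] by simp
    show ?thesis
      unfolding alt_def
      by (subst sum.reindex_bij_betw[OF bb, symmetric])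
        (rule sum.cong[OF refl], simp only: * mem_Collect_eq sg)
  qed
  finally show ?thesis .
qed

lemma bialternant_eq: "bialternant n A x = exact_quot (alt n A) (vdm n x)"
  by (simp add: bialternant_def det_eq_alt vdm_def)

lemma alt_scale_cols: "alt n (\<lambda>i j. c j * A i j) = (\<Prod>j\<in>{1..n}. c j) * alt n A"
  by (simp add: alt_def sum_distrib_left prod.distrib mult.left_commute)

lemma alt_transpose: "alt n (\<lambda>i j. A j i) = alt n A"
proof -
  have "alt n (\<lambda>i j. A j i) = det (transpose_mat (mat n n (\<lambda>(i, j). A (Suc i) (Suc j))))"
    unfolding det_eq_alt[symmetric] by (rule arg_cong[of _ _ det]) auto
  also have "\<dots> = alt n A" by (simp add: det_transpose[of _ n] det_eq_alt)
  finally show ?thesis .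
qed

lemma alt_scale_rows: "alt n (\<lambda>i j. c i * A i j) = (\<Prod>i\<in>{1..n}. c i) * alt n A"
  using alt_scale_cols[of n c "\<lambda>i j. A j i"] by (simp add: alt_transpose[of n A] alt_transpose[of n "\<lambda>i j. c i * A i j"])

lemma alt_permute_rows:
  assumes \<rho>: "\<rho> permutes {1..n}"
  shows "alt n (\<lambda>i. A (\<rho> i)) = of_int (sign \<rho>) * alt n A"
proof -
  have "alt n A = (\<Sum>\<pi> | \<pi> permutes {1..n}. of_int (sign (\<rho> \<circ> \<pi>)) * (\<Prod>j\<in>{1..n}. A ((\<rho> \<circ> \<pi>) j) j))"
    unfolding alt_def by (rule setum_permutations_compose_left[OF \<rho>])
  also have "\<dots> = of_int (sign \<rho>) * alt n (\<lambda>i. A (\<rho> i))"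
    unfolding alt_def sum_distrib_left
    by (rule sum.cong[OF refl])
      (use \<rho> in \<open>auto simp: sign_compose permutes_imp_permutation[OF finite_atLeastAtMost] mult.assoc\<close>)
  finally have "of_int (sign \<rho>) * alt n A = of_int (sign \<rho> * sign \<rho>) * alt n (\<lambda>i. A (\<rho> i))"
    by (simp only: of_int_mult mult.assoc)
  then show ?thesis by (simp only: sign_idempotent of_int_1 mult_1)
qed

lemma alt_permute_cols:
  assumes \<rho>: "\<rho> permutes {1..n}"
  shows "alt n (\<lambda>i j. A i (\<rho> j)) = of_int (sign \<rho>) * alt n A"
  using alt_permute_rows[OF \<rho>, of "\<lambda>i j. A j i"]
  unfolding alt_transpose[of n A] alt_transpose[of n "\<lambda>i j. A i (\<rho> j)"] .

lemma alt_identical_cols: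
  assumes "j \<in> {1..n}" "k \<in> {1..n}" "j \<noteq> k" "\<And>i. A i j = A i k"
  shows "alt n A = 0"
  unfolding det_eq_alt[symmetric]
  by (rule det_identical_columns[of _ n "j - 1" "k - 1"])
    (use assms in \<open>auto intro!: eq_vecI\<close>)

text \<open>A permutation that moves \<open>Suc n\<close> picks an entry of the last row in an
  earlier column, which vanishes. The remaining ones are the permutations of the first
  \<open>n\<close> indices.\<close>

lemma alt_last_row:
  assumes "\<And>j. j \<in> {1..n} \<Longrightarrow> A (Suc n) j = 0"
  shows "alt (Suc n) A = A (Suc n) (Suc n) * alt n A"
proof -
  have "alt (Suc n) A =
      (\<Sum>\<pi> | \<pi> permutes {1..n}. of_int (sign \<pi>) * (\<Prod>j\<in>{1..Suc n}. A (\<pi> j) j))"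
    unfolding alt_def
  proof (rule sum.mono_neutral_right)
    show "finite {\<pi>. \<pi> permutes {1..Suc n}}" by (simp add: finite_permutations)
    show "{\<pi>. \<pi> permutes {1..n}} \<subseteq> {\<pi>. \<pi> permutes {1..Suc n}}"
      by (auto intro: permutes_subset)
    show "\<forall>\<pi>\<in>{\<pi>. \<pi> permutes {1..Suc n}} - {\<pi>. \<pi> permutes {1..n}}.
        of_int (sign \<pi>) * (\<Prod>j\<in>{1..Suc n}. A (\<pi> j) j) = 0"
    proof
      fix \<pi> assume "\<pi> \<in> {\<pi>. \<pi> permutes {1..Suc n}} - {\<pi>. \<pi> permutes {1..n}}"
      then have p: "\<pi> permutes {1..Suc n}" and np: "\<not> \<pi> permutes {1..n}" by auto
      obtain j where j: "j \<in> {1..Suc n}" "\<pi> j = Suc n"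
        using permutes_image[OF p] by (metis Suc_leI atLeastAtMost_iff imageE le_refl zero_less_Suc One_nat_def)
      have "j \<noteq> Suc n"
      proof
        assume "j = Suc n"
        then have "\<pi> permutes {1..n}"
          using j by (intro permutes_superset[OF p]) (auto simp: le_Suc_eq)
        with np show False by simp
      qed
      with j have "j \<in> {1..n}" by auto
      then have "A (\<pi> j) j = 0" using assms j by simp
      then have "(\<Prod>j\<in>{1..Suc n}. A (\<pi> j) j) = 0"
        using j by (intro prod_zero bexI[of _ j]) auto
      then show "of_int (sign \<pi>) * (\<Prod>j\<in>{1..Suc n}. A (\<pi> j) j) = 0" by simp
    qed
  qed
  also have "\<dots> = (\<Sum>\<pi> | \<pi> permutes {1..n}. A (Suc n) (Suc n) * (of_int (sign \<pi>) * (\<Prod>j\<in>{1..n}. A (\<pi> j) j)))"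
  proof (rule sum.cong[OF refl], clarify)
    fix \<pi> assume "\<pi> permutes {1..n}"
    then have "\<pi> (Suc n) = Suc n" by (simp add: permutes_def)
    then show "of_int (sign \<pi>) * (\<Prod>j\<in>{1..Suc n}. A (\<pi> j) j) =
        A (Suc n) (Suc n) * (of_int (sign \<pi>) * (\<Prod>j\<in>{1..n}. A (\<pi> j) j))"
      by (simp add: mult_ac)
  qed
  finally show ?thesis by (simp add: alt_def sum_distrib_left)
qed

lemma prod_list_neutral: "(\<And>x. x \<in> set xs \<Longrightarrow> x = (1::'a::monoid_mult)) \<Longrightarrow> prod_list xs = 1"
  by (induction xs) auto

text \<open>Left multiplication by a unitriangular matrix treats all rows at once, which is the form
  needed in the induction for Cauchy's determinant.\<close>

lemma alt_add_last_row:
  "alt (Suc n) (\<lambda>i j. if i = Suc n then A i j else A i j - A (Suc n) j) = alt (Suc n) A"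
proof -
  let ?N = "Suc n"
  let ?M = "mat ?N ?N (\<lambda>(i, j). A (Suc i) (Suc j))"
  let ?L = "mat ?N ?N (\<lambda>(i, j). if i = j then 1 else if j = n then - 1 else 0 :: 'a)"
  have "det ?L = prod_list (diag_mat ?L)"
    by (rule det_upper_triangular[of _ ?N]) auto
  also have "\<dots> = 1"
    by (intro prod_list_neutral) (auto simp: diag_mat_def simp del: upt_Suc)
  finally have L: "det ?L = 1" .
  have "?L * ?M = mat ?N ?N (\<lambda>(i, j). (\<lambda>i j. if i = Suc n then A i j else A i j - A (Suc n) j) (Suc i) (Suc j))"
  proof (rule eq_matI)
    fix i j assume "i < dim_row (mat ?N ?N (\<lambda>(i, j). (\<lambda>i j. if i = Suc n then A i j else A i j - A (Suc n) j) (Suc i) (Suc j)))"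
      "j < dim_col (mat ?N ?N (\<lambda>(i, j). (\<lambda>i j. if i = Suc n then A i j else A i j - A (Suc n) j) (Suc i) (Suc j)))"
    then have ij: "i \<le> n" "j \<le> n" by auto
    have "(?L * ?M) $$ (i, j) = (\<Sum>k = 0..<?N. (if i = k then 1 else if k = n then - 1 else 0) * A (Suc k) (Suc j))"
      using ij by (simp add: scalar_prod_def)
    also have "\<dots> = (\<Sum>k = 0..<n. (if i = k then A (Suc k) (Suc j) else 0)) + (if i = n then 1 else - 1) * A (Suc n) (Suc j)"
    proof -
      have "(\<Sum>k = 0..<n. (if i = k then 1 else if k = n then - 1 else 0) * A (Suc k) (Suc j)) =
          (\<Sum>k = 0..<n. if i = k then A (Suc k) (Suc j) else 0)"
        by (rule sum.cong) auto
      then show ?thesis by (simp only: sum.atLeast0_lessThan_Suc) simp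
    qed
    also have "\<dots> = (if i = n then A (Suc i) (Suc j) else A (Suc i) (Suc j) - A (Suc n) (Suc j))"
      using ij by auto
    finally show "(?L * ?M) $$ (i, j) = mat ?N ?N (\<lambda>(i, j). (\<lambda>i j. if i = Suc n then A i j else A i j - A (Suc n) j) (Suc i) (Suc j)) $$ (i, j)"
      using ij by simp
  qed auto
  then have "alt ?N (\<lambda>i j. if i = Suc n then A i j else A i j - A (Suc n) j) = det (?L * ?M)"
    by (simp only: det_eq_alt[symmetric])
  also have "\<dots> = det ?M"
    by (subst det_mult[of _ ?N]) (auto simp: L)
  finally show ?thesis by (simp only: det_eq_alt)
qed

lemma alt_add_last_col:
  "alt (Suc n) (\<lambda>i j. if j = Suc n then A i j else A i j - A i (Suc n)) = alt (Suc n) A"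
  using alt_add_last_row[of n "\<lambda>i j. A j i"]
  unfolding alt_transpose[of "Suc n" A]
    alt_transpose[of "Suc n" "\<lambda>i j. if j = Suc n then A i j else A i j - A i (Suc n)"] .

section \<open>Vandermonde products and Cauchy's determinant\<close>

lemma vdm_0 [simp]: "vdm 0 x = 1"
proof -
  have "{(i, j). 1 \<le> i \<and> i < j \<and> j \<le> (0 :: nat)} = ({} :: (nat \<times> nat) set)" by auto
  then show ?thesis by (simp only: vdm_def prod.empty)
qed

lemma finite_vdm_pairs: "finite {(i, j). 1 \<le> i \<and> i < j \<and> j \<le> (n :: nat)}"
  by (rule finite_subset[of _ "{1..n} \<times> {1..n}"]) auto

lemma vdm_Suc: "vdm (Suc n) x = vdm n x * (\<Prod>i\<in>{1..n}. x i - x (Suc n))"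
proof -
  have "{(i, j). 1 \<le> i \<and> i < j \<and> j \<le> Suc n} =
      {(i, j). 1 \<le> i \<and> i < j \<and> j \<le> n} \<union> (\<lambda>i. (i, Suc n)) ` {1..n}" by auto
  then have "vdm (Suc n) x = vdm n x * (\<Prod>(i, j)\<in>(\<lambda>i. (i, Suc n)) ` {1..n}. x i - x j)"
    unfolding vdm_def
    by (simp only: ) (rule prod.union_disjoint[OF finite_vdm_pairs], auto)
  also have "(\<Prod>(i, j)\<in>(\<lambda>i. (i, Suc n)) ` {1..n}. x i - x j) = (\<Prod>i\<in>{1..n}. x i - x (Suc n))"
    by (subst prod.reindex) (auto simp: inj_on_def)
  finally show ?thesis .
qed

text \<open>\<open>r i j\<close> stands for 1 / (1 - x_i y_j), given as an inverse so that the
  identity makes sense in every commutative ring. Subtracting the last row and then the last column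
  leaves, up to factors of rows and columns, the same determinant of smaller size.\<close>

lemma cauchy_alternant:
  assumes r: "\<And>i j. r i j * (1 - x i * y j) = 1"
  shows "alt n r = vdm n x * vdm n y * (\<Prod>i\<in>{1..n}. \<Prod>j\<in>{1..n}. r i j)"
proof (induction n)
  case 0
  then show ?case by (simp add: alt_def)
next
  case (Suc n)
  let ?N = "Suc n"
  have row: "r i j - r k j = (x i - x k) * (r k j * (y j * r i j))" for i j k
  proof -
    have "r i j - r k j = r i j * (r k j * (1 - x k * y j)) - r k j * (r i j * (1 - x i * y j))"
      by (simp add: r)
    also have "\<dots> = (x i - x k) * (r k j * (y j * r i j))" by (simp add: algebra_simps)
    finally show ?thesis .
  qed
  have col: "y j * r i j - y k * r i k = (y j - y k) * (r i k * r i j)" for i j k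
  proof -
    have "y j * r i j - y k * r i k = y j * r i j * (r i k * (1 - x i * y k)) - y k * r i k * (r i j * (1 - x i * y j))"
      by (simp add: r)
    also have "\<dots> = (y j - y k) * (r i k * r i j)" by (simp add: algebra_simps)
    finally show ?thesis .
  qed
  \<comment> \<open>What remains once r_{Nj} is taken out of column j and x_i - x_N out of each row
    i < N: a last row of ones.\<close>
  let ?B = "\<lambda>i j. if i = ?N then 1 else y j * r i j"
  have "alt ?N r = alt ?N (\<lambda>i j. if i = ?N then r i j else r i j - r ?N j)"
    by (rule alt_add_last_row[symmetric])
  also have "\<dots> = alt ?N (\<lambda>i j. (if i = ?N then 1 else x i - x ?N) * (r ?N j * ?B i j))"
    by (rule alt_cong) (auto simp: row)
  also have "\<dots> = (\<Prod>i\<in>{1..n}. x i - x ?N) * ((\<Prod>j\<in>{1..?N}. r ?N j) * alt ?N ?B)"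
    by (simp add: alt_scale_rows alt_scale_cols)
  \<comment> \<open>Subtracting the last column turns the row of ones into (0, ..., 0, 1), so the
    size drops by one.\<close>
  also have "alt ?N ?B = alt ?N (\<lambda>i j. if j = ?N then ?B i j else ?B i j - ?B i ?N)"
    by (rule alt_add_last_col[symmetric])
  also have "\<dots> = alt n (\<lambda>i j. if j = ?N then ?B i j else ?B i j - ?B i ?N)"
    by (subst alt_last_row) auto
  also have "\<dots> = alt n (\<lambda>i j. (y j - y ?N) * (r i ?N * r i j))"
    by (rule alt_cong) (auto simp: col)
  also have "\<dots> = (\<Prod>j\<in>{1..n}. y j - y ?N) * ((\<Prod>i\<in>{1..n}. r i ?N) * alt n r)"
    by (simp add: alt_scale_rows alt_scale_cols)
  finally have *: "alt ?N r = (\<Prod>i\<in>{1..n}. x i - x ?N) * ((\<Prod>j\<in>{1..?N}. r ?N j) *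
    ((\<Prod>j\<in>{1..n}. y j - y ?N) * ((\<Prod>i\<in>{1..n}. r i ?N) * alt n r)))" .
  have "(\<Prod>i\<in>{1..?N}. \<Prod>j\<in>{1..?N}. r i j) =
      (\<Prod>i\<in>{1..n}. \<Prod>j\<in>{1..n}. r i j) * (\<Prod>i\<in>{1..n}. r i ?N) * (\<Prod>j\<in>{1..?N}. r ?N j)"
    by (simp add: prod.distrib)
  then show ?case unfolding * Suc vdm_Suc by (simp only: mult_ac)
qed

section \<open>Formal power series\<close>

lemma comm_ring_homI:
  assumes "h 1 = 1" "\<And>x y. h (x + y) = h x + h y" "\<And>x y. h (x * y) = h x * h y"
  shows "comm_ring_hom (h :: 'a::comm_ring_1 \<Rightarrow> 'b::comm_ring_1)"
proof -
  have "h 0 + h 0 = h 0 + 0" using assms(2)[of 0 0] by simp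
  then have "h 0 = 0" by (simp only: add_left_cancel)
  with assms show ?thesis by unfold_locales auto
qed

context comm_ring_hom
begin

lemma hom_alt: "hom (alt n A) = alt n (\<lambda>i j. hom (A i j))"
  by (simp add: alt_def hom_sum hom_mult hom_prod hom_of_int)

lemma hom_vdm: "hom (vdm n x) = vdm n (\<lambda>i. hom (x i))"
  by (simp add: vdm_def hom_prod hom_minus case_prod_unfold)

end

lemma mfps_eqI: "(\<And>m. mcoeff F m = mcoeff G m) \<Longrightarrow> F = G"
  by (simp add: mcoeff_inject[symmetric] fun_eq_iff)

lemma mcoeff_MFPS [simp]: "mcoeff (MFPS f) = f"
  by (simp add: MFPS_inverse)

lemma mcoeff_0 [simp]: "mcoeff 0 m = 0" by transfer simp
lemma mcoeff_1: "mcoeff 1 m = (if m = 0 then 1 else 0)" by transfer simp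
lemma mcoeff_add [simp]: "mcoeff (F + G) m = mcoeff F m + mcoeff G m" by transfer simp
lemma mcoeff_diff [simp]: "mcoeff (F - G) m = mcoeff F m - mcoeff G m" by transfer simp
lemma mcoeff_mult: "mcoeff (F * G) m = (\<Sum>(u, v)\<in>mono_splits m. mcoeff F u * mcoeff G v)"
  by transfer simp
lemma mcoeff_sum [simp]: "mcoeff (\<Sum>i\<in>I. F i) m = (\<Sum>i\<in>I. mcoeff (F i) m)"
  by (induction I rule: infinite_finite_induct) auto

lemma mcoeff_PS_Const: "mcoeff (PS_Const c) m = (if m = 0 then c else 0)"
  by (simp add: PS_Const_def)

lemma mcoeff_PS_Var: "mcoeff (PS_Var i) m = (if m = Poly_Mapping.single i 1 then 1 else 0)"
  by (simp add: PS_Var_def)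

lemma mcoeff_PS_restrict: "mcoeff (PS_restrict A F) m = (if Poly_Mapping.keys m \<subseteq> A then mcoeff F m else 0)"
  by (simp add: PS_restrict_def)

lemma mem_mono_splits [simp]: "(u, v) \<in> mono_splits m \<longleftrightarrow> u + v = m"
  by (simp add: mono_splits_def)

lemma mcoeff_mult_single_split:
  assumes "u0 + v0 = m" "\<And>u v. u + v = m \<Longrightarrow> (u, v) \<noteq> (u0, v0) \<Longrightarrow> mcoeff F u * mcoeff G v = 0"
  shows "mcoeff (F * G) m = mcoeff F u0 * mcoeff G v0"
proof -
  have "(\<Sum>(u, v)\<in>mono_splits m. mcoeff F u * mcoeff G v) = (\<Sum>(u, v)\<in>{(u0, v0)}. mcoeff F u * mcoeff G v)"
    by (rule sum.mono_neutral_right[OF finite_mono_splits])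
      (use assms(1) in simp, use assms(2) in \<open>clarsimp, metis prod.inject\<close>)
  then show ?thesis by (simp add: mcoeff_mult)
qed

lemma mcoeff_mult_eq_0:
  assumes "\<And>u v. u + v = m \<Longrightarrow> mcoeff F u * mcoeff G v = 0"
  shows "mcoeff (F * G) m = 0"
  unfolding mcoeff_mult by (rule sum.neutral) (use assms in auto)

lemma mcoeff_PS_Const_mult [simp]: "mcoeff (PS_Const c * F) m = c * mcoeff F m"
  by (subst mcoeff_mult_single_split[of 0 m]) (auto simp: mcoeff_PS_Const)

lemma PS_Const_hom: "comm_ring_hom (PS_Const :: 'c \<Rightarrow> ('v, 'c::comm_ring_1) mfps)"
proof (rule comm_ring_homI)
  fix x y :: 'c
  show "(PS_Const (x * y) :: ('v, 'c) mfps) = PS_Const x * PS_Const y"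
    by (rule mfps_eqI) (simp add: mcoeff_PS_Const)
qed (auto intro!: mfps_eqI simp: mcoeff_PS_Const mcoeff_1)

lemma keys_add_nat: "Poly_Mapping.keys (u + v) = Poly_Mapping.keys u \<union> Poly_Mapping.keys (v :: 'v \<Rightarrow>\<^sub>0 nat)"
  by (auto simp: in_keys_iff lookup_add)

lemma mono_eq_single:
  assumes "Poly_Mapping.keys m \<subseteq> {i}"
  shows "m = Poly_Mapping.single i (Poly_Mapping.lookup m i)"
  using assms by (intro poly_mapping_eqI) (auto simp: lookup_single when_def in_keys_iff)

section \<open>Series in one variable placed inside series in many variables\<close>

definition fps_at :: "'v \<Rightarrow> 'c fps \<Rightarrow> ('v, 'c::comm_ring_1) mfps"
  where "fps_at i F = MFPS (\<lambda>m. if Poly_Mapping.keys m \<subseteq> {i} then fps_nth F (Poly_Mapping.lookup m i) else 0)"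

lemma mcoeff_fps_at:
  "mcoeff (fps_at i F) m = (if Poly_Mapping.keys m \<subseteq> {i} then fps_nth F (Poly_Mapping.lookup m i) else 0)"
  by (simp add: fps_at_def)

lemma fps_at_mult: "fps_at i (F * G) = fps_at i F * fps_at i G"
proof (rule mfps_eqI)
  fix m
  show "mcoeff (fps_at i (F * G)) m = mcoeff (fps_at i F * fps_at i G) m"
  proof (cases "Poly_Mapping.keys m \<subseteq> {i}")
    case False
    then have "mcoeff (fps_at i F * fps_at i G) m = 0"
      by (intro mcoeff_mult_eq_0) (auto simp: mcoeff_fps_at keys_add_nat)
    with False show ?thesis by (simp add: mcoeff_fps_at)
  next
    case True
    define k where "k = Poly_Mapping.lookup m i"
    have m: "m = Poly_Mapping.single i k"
      using mono_eq_single[OF True] by (simp add: k_def)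
    have "mcoeff (fps_at i F * fps_at i G) m = (\<Sum>(u, v)\<in>mono_splits m. fps_nth F (Poly_Mapping.lookup u i) * fps_nth G (Poly_Mapping.lookup v i))"
      unfolding mcoeff_mult
      by (rule sum.cong[OF refl]) (use True in \<open>clarsimp simp: mcoeff_fps_at keys_add_nat\<close>)
    also have "\<dots> = (\<Sum>l = 0..k. fps_nth F l * fps_nth G (k - l))"
    proof (rule sum.reindex_bij_witness[of _ "\<lambda>l. (Poly_Mapping.single i l, Poly_Mapping.single i (k - l))" "\<lambda>(u, v). Poly_Mapping.lookup u i"])
      fix p assume p: "p \<in> mono_splits m"
      obtain u v where uv: "p = (u, v)" by (cases p)
      with p have s: "u + v = m" by simp
      then have "Poly_Mapping.keys u \<subseteq> {i}" "Poly_Mapping.keys v \<subseteq> {i}"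
        using True by (auto simp: keys_add_nat)
      then have su: "Poly_Mapping.single i (Poly_Mapping.lookup u i) = u"
        and sv: "Poly_Mapping.single i (Poly_Mapping.lookup v i) = v"
        using mono_eq_single by metis+
      have k: "k = Poly_Mapping.lookup u i + Poly_Mapping.lookup v i"
        unfolding k_def s[symmetric] by (simp add: lookup_add)
      show "(\<lambda>l. (Poly_Mapping.single i l, Poly_Mapping.single i (k - l))) ((\<lambda>(u, v). Poly_Mapping.lookup u i) p) = p"
        by (simp add: uv su k sv)
      show "(\<lambda>(u, v). Poly_Mapping.lookup u i) p \<in> {0..k}" by (simp add: uv k)
      show "fps_nth F ((\<lambda>(u, v). Poly_Mapping.lookup u i) p) * fps_nth G (k - (\<lambda>(u, v). Poly_Mapping.lookup u i) p) =
          (case p of (u, v) \<Rightarrow> fps_nth F (Poly_Mapping.lookup u i) * fps_nth G (Poly_Mapping.lookup v i))"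
        by (simp add: uv k)
    qed (auto simp: m single_add[symmetric])
    also have "\<dots> = mcoeff (fps_at i (F * G)) m"
      using True by (simp add: mcoeff_fps_at fps_mult_nth k_def)
    finally show ?thesis by simp
  qed
qed

lemma fps_at_hom: "comm_ring_hom (fps_at i :: 'c fps \<Rightarrow> ('v, 'c::comm_ring_1) mfps)"
proof (rule comm_ring_homI)
  show "fps_at i (1 :: 'c fps) = 1"
  proof (rule mfps_eqI)
    fix m :: "'v \<Rightarrow>\<^sub>0 nat"
    show "mcoeff (fps_at i (1 :: 'c fps)) m = mcoeff 1 m"
      using mono_eq_single[of m i] by (auto simp: mcoeff_fps_at mcoeff_1)
  qed
qed (auto intro!: mfps_eqI simp: mcoeff_fps_at fps_at_mult)

lemma fps_at_X: "fps_at i fps_X = PS_Var i"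
proof (rule mfps_eqI)
  fix m
  show "mcoeff (fps_at i fps_X) m = mcoeff (PS_Var i) m"
    using mono_eq_single[of m i] by (auto simp: mcoeff_fps_at mcoeff_PS_Var fps_X_def)
qed

lemma fps_at_const: "fps_at i (fps_const c) = PS_Const c"
proof (rule mfps_eqI)
  fix m
  show "mcoeff (fps_at i (fps_const c)) m = mcoeff (PS_Const c) m"
    using mono_eq_single[of m i] by (auto simp: mcoeff_fps_at mcoeff_PS_Const)
qed

text \<open>Series in distinct variables do not interact: only one way of splitting the exponent
  contributes to a given coefficient of the product.\<close>

lemma mcoeff_prod_fps_at:
  assumes "finite A"
  shows "mcoeff (\<Prod>i\<in>A. fps_at i (F i)) m =
    (if Poly_Mapping.keys m \<subseteq> A then \<Prod>i\<in>A. fps_nth (F i) (Poly_Mapping.lookup m i) else 0)"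
  using assms
proof (induction A arbitrary: m rule: finite_induct)
  case empty
  then show ?case by (simp add: mcoeff_1)
next
  case (insert i A)
  let ?G = "\<Prod>i\<in>A. fps_at i (F i)"
  show ?case
  proof (cases "Poly_Mapping.keys m \<subseteq> insert i A")
    case False
    have "mcoeff (fps_at i (F i) * ?G) m = 0"
      by (rule mcoeff_mult_eq_0)
        (use False in \<open>auto simp: mcoeff_fps_at insert.IH keys_add_nat split: if_splits\<close>)
    with False insert show ?thesis by simp
  next
    case True
    \<comment> \<open>The part of \<open>m\<close> in the variable \<open>i\<close>; together with
      the rest it forms the only split that can contribute.\<close>
    define u0 where "u0 = Poly_Mapping.single i (Poly_Mapping.lookup m i)"
    define v0 where "v0 = Poly_Mapping.update i 0 m"
    have s: "u0 + v0 = m"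
      by (rule poly_mapping_eqI) (auto simp: u0_def v0_def lookup_add lookup_single lookup_update when_def)
    have "mcoeff (fps_at i (F i) * ?G) m = mcoeff (fps_at i (F i)) u0 * mcoeff ?G v0"
    proof (rule mcoeff_mult_single_split[OF s])
      fix u v assume uv: "u + v = m" "(u, v) \<noteq> (u0, v0)"
      show "mcoeff (fps_at i (F i)) u * mcoeff ?G v = 0"
      proof (rule ccontr)
        assume "mcoeff (fps_at i (F i)) u * mcoeff ?G v \<noteq> 0"
        then have k: "Poly_Mapping.keys u \<subseteq> {i}" "Poly_Mapping.keys v \<subseteq> A"
          by (auto simp: mcoeff_fps_at insert.IH split: if_splits)
        with insert have "Poly_Mapping.lookup v i = 0" by (auto simp: in_keys_iff)
        then have "Poly_Mapping.lookup u i = Poly_Mapping.lookup m i"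
          using uv by (auto simp: lookup_add)
        then have "u = u0" using mono_eq_single[OF k(1)] by (simp add: u0_def)
        with uv s have "v = v0" by auto
        with \<open>u = u0\<close> uv show False by simp
      qed
    qed
    moreover have "Poly_Mapping.keys v0 \<subseteq> A"
    proof
      fix x assume "x \<in> Poly_Mapping.keys v0"
      then have "x \<noteq> i" "x \<in> Poly_Mapping.keys m"
        by (auto simp: v0_def in_keys_iff lookup_update split: if_splits)
      with True show "x \<in> A" by auto
    qed
    moreover have "(\<Prod>j\<in>A. fps_nth (F j) (Poly_Mapping.lookup v0 j)) = (\<Prod>j\<in>A. fps_nth (F j) (Poly_Mapping.lookup m j))"
      by (rule prod.cong) (use insert in \<open>auto simp: v0_def lookup_update\<close>)
    ultimately show ?thesis using True insert
      by (simp add: mcoeff_fps_at u0_def)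
  qed
qed

text \<open>When row i involves only the variable of index i, taking a coefficient acts row by row
  and so commutes with the determinant. The transposition makes each Leibniz term a product over
  rows, as \<open>mcoeff_prod_fps_at\<close> requires.\<close>

lemma mcoeff_alt_fps_at:
  assumes "Poly_Mapping.keys m \<subseteq> {1..n}"
  shows "mcoeff (alt n (\<lambda>i j. fps_at i (F i j))) m = alt n (\<lambda>i j. fps_nth (F i j) (Poly_Mapping.lookup m i))"
proof -
  have "mcoeff (alt n (\<lambda>i j. fps_at i (F i j))) m = mcoeff (alt n (\<lambda>j i. fps_at i (F i j))) m"
    by (simp add: alt_transpose[of n "\<lambda>i j. fps_at i (F i j)"])
  also have "\<dots> = (\<Sum>\<pi> | \<pi> permutes {1..n}. mcoeff (PS_Const (of_int (sign \<pi>)) * (\<Prod>i\<in>{1..n}. fps_at i (F i (\<pi> i)))) m)"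
    unfolding alt_def by (simp add: ring_hom.hom_of_int comm_ring_hom.axioms PS_Const_hom)
  also have "\<dots> = alt n (\<lambda>j i. fps_nth (F i j) (Poly_Mapping.lookup m i))"
    unfolding alt_def using assms by (simp add: mcoeff_prod_fps_at)
  finally show ?thesis by (simp add: alt_transpose[of n "\<lambda>i j. fps_nth (F i j) (Poly_Mapping.lookup m i)"])
qed

lemma mcoeff_alt_fps_at_outside:
  assumes "\<not> Poly_Mapping.keys m \<subseteq> {1..n}"
  shows "mcoeff (alt n (\<lambda>i j. fps_at i (F i j))) m = 0"
proof -
  have "alt n (\<lambda>i j. fps_at i (F i j)) = (\<Sum>\<pi> | \<pi> permutes {1..n}. PS_Const (of_int (sign \<pi>)) * (\<Prod>i\<in>{1..n}. fps_at i (F i (\<pi> i))))"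
    unfolding alt_transpose[of n "\<lambda>i j. fps_at i (F i j)", symmetric]
    unfolding alt_def by (simp add: ring_hom.hom_of_int comm_ring_hom.axioms PS_Const_hom)
  then show ?thesis using assms by (simp add: mcoeff_prod_fps_at)
qed

section \<open>Change of coefficients, restriction and permutation of variables\<close>

definition map_mfps :: "('c \<Rightarrow> 'd) \<Rightarrow> ('v, 'c) mfps \<Rightarrow> ('v, 'd) mfps"
  where "map_mfps h F = MFPS (\<lambda>m. h (mcoeff F m))"

definition map_fps :: "('c \<Rightarrow> 'd) \<Rightarrow> 'c fps \<Rightarrow> 'd fps"
  where "map_fps h F = Abs_fps (\<lambda>k. h (fps_nth F k))"

lemma mcoeff_map_mfps [simp]: "mcoeff (map_mfps h F) m = h (mcoeff F m)"
  by (simp add: map_mfps_def)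

lemma nth_map_fps [simp]: "fps_nth (map_fps h F) k = h (fps_nth F k)"
  by (simp add: map_fps_def)

context comm_ring_hom
begin

lemma map_mfps_hom: "comm_ring_hom (map_mfps hom :: ('v, 'a) mfps \<Rightarrow> ('v, 'b) mfps)"
  by (rule comm_ring_homI)
    (auto intro!: mfps_eqI simp: mcoeff_1 mcoeff_mult hom_add hom_sum hom_mult case_prod_unfold)

lemma map_fps_hom: "comm_ring_hom (map_fps hom)"
  by (rule comm_ring_homI)
    (auto intro!: fps_ext simp: fps_mult_nth hom_add hom_sum hom_mult)

lemma map_mfps_fps_at: "map_mfps hom (fps_at i F) = fps_at i (map_fps hom F)"
  by (rule mfps_eqI) (auto simp: mcoeff_fps_at)

lemma map_mfps_PS_Var: "map_mfps hom (PS_Var i) = PS_Var i"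
  by (rule mfps_eqI) (auto simp: mcoeff_PS_Var)

lemma map_fps_X: "map_fps hom fps_X = fps_X"
  by (rule fps_ext) (auto simp: fps_X_def)

lemma map_fps_const: "map_fps hom (fps_const c) = fps_const (hom c)"
  by (rule fps_ext) auto

end

lemma PS_restrict_hom: "comm_ring_hom (PS_restrict A :: ('v, 'c::comm_ring_1) mfps \<Rightarrow> _)"
proof (rule comm_ring_homI)
  fix F G :: "('v, 'c) mfps"
  show "PS_restrict A (F * G) = PS_restrict A F * PS_restrict A G"
  proof (rule mfps_eqI)
    fix m
    show "mcoeff (PS_restrict A (F * G)) m = mcoeff (PS_restrict A F * PS_restrict A G) m"
    proof (cases "Poly_Mapping.keys m \<subseteq> A")
      case True
      then have "(\<Sum>(u, v)\<in>mono_splits m. mcoeff (PS_restrict A F) u * mcoeff (PS_restrict A G) v) =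
          (\<Sum>(u, v)\<in>mono_splits m. mcoeff F u * mcoeff G v)"
        by (intro sum.cong refl) (clarsimp simp: mcoeff_PS_restrict keys_add_nat)
      with True show ?thesis by (simp add: mcoeff_PS_restrict mcoeff_mult)
    next
      case False
      have "mcoeff (PS_restrict A F * PS_restrict A G) m = 0"
        by (rule mcoeff_mult_eq_0) (use False in \<open>auto simp: mcoeff_PS_restrict keys_add_nat\<close>)
      with False show ?thesis by (simp add: mcoeff_PS_restrict)
    qed
  qed
qed (auto intro!: mfps_eqI simp: mcoeff_PS_restrict mcoeff_1)

lemma PS_restrict_restrict: "PS_restrict A (PS_restrict B F) = PS_restrict (A \<inter> B) F"
  by (rule mfps_eqI) (auto simp: mcoeff_PS_restrict)

lemma single_eq_0_iff: "Poly_Mapping.single i k = 0 \<longleftrightarrow> k = 0"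
  by (metis lookup_single_eq lookup_zero single_zero)

lemma PS_restrict_fps_at: "PS_restrict A (fps_at i F) = (if i \<in> A then fps_at i F else PS_Const (fps_nth F 0))"
proof (rule mfps_eqI)
  fix m
  show "mcoeff (PS_restrict A (fps_at i F)) m = mcoeff (if i \<in> A then fps_at i F else PS_Const (fps_nth F 0)) m"
  proof (cases "Poly_Mapping.keys m \<subseteq> {i}")
    case True
    then obtain k where "m = Poly_Mapping.single i k" using mono_eq_single by metis
    then show ?thesis
      by (cases "k = 0") (simp_all add: mcoeff_PS_restrict mcoeff_fps_at mcoeff_PS_Const single_eq_0_iff)
  next
    case False
    then have "m \<noteq> 0" by auto
    with False show ?thesis
      by (simp add: mcoeff_PS_restrict mcoeff_fps_at mcoeff_PS_Const)
  qed
qed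

lemma PS_restrict_PS_Var: "PS_restrict A (PS_Var i :: ('v, 'c::comm_ring_1) mfps) = (if i \<in> A then PS_Var i else 0)"
  using PS_restrict_fps_at[of A i "fps_X :: 'c fps"] comm_ring_hom.axioms[OF PS_Const_hom]
  by (simp add: fps_at_X) (auto intro!: mfps_eqI simp: mcoeff_PS_Const)

text \<open>\<open>Poly_Mapping.map_key\<close> composes the exponent with \<pi>, so for bijective
  \<pi> the effect on series is to replace the variable of index i by that of index
  \<pi>(i).\<close>

definition PS_perm :: "('v \<Rightarrow> 'v) \<Rightarrow> ('v, 'c) mfps \<Rightarrow> ('v, 'c) mfps"
  where "PS_perm \<pi> F = MFPS (\<lambda>m. mcoeff F (Poly_Mapping.map_key \<pi> m))"

lemma mcoeff_PS_perm [simp]: "mcoeff (PS_perm \<pi> F) m = mcoeff F (Poly_Mapping.map_key \<pi> m)"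
  by (simp add: PS_perm_def)

lemma lookup_map_key: "inj f \<Longrightarrow> Poly_Mapping.lookup (Poly_Mapping.map_key f m) i = Poly_Mapping.lookup m (f i)"
  by (simp add: map_key.rep_eq)

lemma map_key_inv:
  assumes "bij f"
  shows "Poly_Mapping.map_key f (Poly_Mapping.map_key (inv_into UNIV f) m) = m"
    "Poly_Mapping.map_key (inv_into UNIV f) (Poly_Mapping.map_key f m) = m"
  using assms by (auto intro!: poly_mapping_eqI
    simp: lookup_map_key bij_is_inj bij_imp_bij_inv bij_is_surj surj_f_inv_f inv_f_f)

lemma map_key_eq_iff:
  assumes "bij (f :: 'v \<Rightarrow> 'v)"
  shows "Poly_Mapping.map_key f m = m' \<longleftrightarrow> m = Poly_Mapping.map_key (inv_into UNIV f) m'"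
  using map_key_inv[OF assms] by metis

lemma PS_perm_hom:
  assumes \<pi>: "bij (\<pi> :: 'v \<Rightarrow> 'v)"
  shows "comm_ring_hom (PS_perm \<pi> :: ('v, 'c::comm_ring_1) mfps \<Rightarrow> _)"
proof (rule comm_ring_homI)
  note inj = bij_is_inj[OF \<pi>] bij_is_inj[OF bij_imp_bij_inv[OF \<pi>]]
  fix F G :: "('v, 'c) mfps"
  show "PS_perm \<pi> (F * G) = PS_perm \<pi> F * PS_perm \<pi> G"
  proof (rule mfps_eqI)
    fix m
    show "mcoeff (PS_perm \<pi> (F * G)) m = mcoeff (PS_perm \<pi> F * PS_perm \<pi> G) m"
      unfolding mcoeff_mult mcoeff_PS_perm
    proof (rule sum.reindex_bij_witness[of _ "\<lambda>(u, v). (Poly_Mapping.map_key \<pi> u, Poly_Mapping.map_key \<pi> v)"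
        "\<lambda>(u, v). (Poly_Mapping.map_key (inv_into UNIV \<pi>) u, Poly_Mapping.map_key (inv_into UNIV \<pi>) v)"])
    qed (use \<pi> inj in \<open>auto simp: map_key_inv map_key_plus[symmetric] map_key_eq_iff\<close>)
  qed
next
  have "Poly_Mapping.map_key \<pi> m = 0 \<longleftrightarrow> m = 0" for m :: "'v \<Rightarrow>\<^sub>0 nat"
    by (simp add: map_key_eq_iff[OF \<pi>] bij_is_inj bij_imp_bij_inv \<pi>)
  then show "PS_perm \<pi> (1 :: ('v, 'c) mfps) = 1"
    by (intro mfps_eqI) (simp add: mcoeff_1)
qed (auto intro!: mfps_eqI)

lemma PS_perm_PS_Var:
  assumes \<pi>: "bij \<pi>"
  shows "PS_perm \<pi> (PS_Var i) = PS_Var (\<pi> i)"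
proof (rule mfps_eqI)
  fix m
  have "Poly_Mapping.map_key \<pi> m = Poly_Mapping.single i 1 \<longleftrightarrow> m = Poly_Mapping.single (\<pi> i) (1::nat)"
  proof -
    have "Poly_Mapping.map_key \<pi> (Poly_Mapping.single (\<pi> i) (1::nat)) = Poly_Mapping.single i 1"
      by (rule map_key_single[OF bij_is_inj[OF \<pi>]])
    then show ?thesis using map_key_eq_iff[OF \<pi>] by metis
  qed
  then show "mcoeff (PS_perm \<pi> (PS_Var i)) m = mcoeff (PS_Var (\<pi> i)) m"
    by (simp add: mcoeff_PS_Var)
qed

section \<open>Multiplication by variables and cancellation\<close>

lemma mcoeff_PS_Var_mult:
  "mcoeff (PS_Var i * F) m = (if Poly_Mapping.lookup m i = 0 then 0 else mcoeff F (m - Poly_Mapping.single i 1))"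
proof (cases "Poly_Mapping.lookup m i = 0")
  case True
  have "mcoeff (PS_Var i * F) m = 0"
    by (rule mcoeff_mult_eq_0) (use True in \<open>auto simp: mcoeff_PS_Var lookup_add\<close>)
  with True show ?thesis by simp
next
  case False
  have *: "Poly_Mapping.single i 1 + (m - Poly_Mapping.single i 1) = m"
    by (rule poly_mapping_eqI) (use False in \<open>auto simp: lookup_add lookup_minus lookup_single when_def\<close>)
  have "mcoeff (PS_Var i * F) m = mcoeff (PS_Var i) (Poly_Mapping.single i 1) * mcoeff F (m - Poly_Mapping.single i 1)"
    by (rule mcoeff_mult_single_split[OF *]) (auto simp: mcoeff_PS_Var)
  with False show ?thesis by (simp add: mcoeff_PS_Var)
qed

text \<open>By hypothesis a coefficient is unchanged when one unit of exponent moves from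
  \<open>j\<close> to \<open>i\<close>. Once the exponent of \<open>j\<close> is used up, the
  coefficient must vanish. No property of the coefficient ring enters.\<close>

lemma PS_Var_diff_cancel:
  assumes "i \<noteq> j" "(PS_Var i - PS_Var j) * F = 0"
  shows "F = 0"
proof -
  have eq: "mcoeff (PS_Var i * F) m = mcoeff (PS_Var j * F) m" for m
    using assms(2) by (metis eq_iff_diff_eq_0 left_diff_distrib)
  have "mcoeff F m = 0" if "Poly_Mapping.lookup m j = k" for m k
    using that
  proof (induction k arbitrary: m)
    case 0
    with eq[of "m + Poly_Mapping.single i 1"] assms(1) show ?case
      by (simp add: mcoeff_PS_Var_mult lookup_add lookup_single when_def)
  next
    case (Suc k)
    have "mcoeff F m = mcoeff F (m + Poly_Mapping.single i 1 - Poly_Mapping.single j 1)"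
      using eq[of "m + Poly_Mapping.single i 1"] assms(1) Suc.prems
      by (simp add: mcoeff_PS_Var_mult lookup_add lookup_single)
    also have "\<dots> = 0"
      by (rule Suc.IH) (use assms(1) Suc.prems in \<open>auto simp: lookup_add lookup_minus lookup_single\<close>)
    finally show ?case .
  qed
  then show ?thesis by (intro mfps_eqI) simp
qed

lemma PS_Var_cancel:
  assumes "PS_Var i * F = 0"
  shows "F = 0"
proof (rule mfps_eqI)
  fix m
  show "mcoeff F m = mcoeff 0 m"
    using arg_cong[OF assms, of "\<lambda>G. mcoeff G (m + Poly_Mapping.single i 1)"]
    by (simp add: mcoeff_PS_Var_mult lookup_add)
qed

lemma prod_cancel:
  assumes "finite I" "\<And>i F. i \<in> I \<Longrightarrow> f i * F = 0 \<Longrightarrow> F = 0" "(\<Prod>i\<in>I. f i) * F = (0 :: 'r::comm_ring_1)"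
  shows "F = 0"
  using assms(1,2,3)
proof (induction I arbitrary: F rule: finite_induct)
  case (insert i I)
  then have "f i * ((\<Prod>i\<in>I. f i) * F) = 0" by (simp add: mult.assoc)
  then have "(\<Prod>i\<in>I. f i) * F = 0" using insert.prems(1)[of i] by simp
  then show ?case
  proof (rule insert.IH[rotated])
    show "F = 0" if "i \<in> I" "f i * F = 0" for i F
      using that insert.prems(1)[OF insertI2] by auto
  qed
qed simp

text \<open>Takes the place of an integral domain: it holds over every commutative ring of
  coefficients, for instance over polynomials in x when the series are in y.\<close>

lemma vdm_PS_Var_cancel:
  assumes "vdm n PS_Var * F = 0"
  shows "F = 0"
  using finite_vdm_pairs[of n] _ assms unfolding vdm_def
proof (rule prod_cancel)
  fix p F assume "p \<in> {(i, j). 1 \<le> i \<and> i < j \<and> j \<le> n}" "(case p of (i, j) \<Rightarrow> PS_Var i - PS_Var j) * F = 0"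
  then obtain i j where "i < j" "(PS_Var i - PS_Var j) * F = 0" by auto
  then show "F = 0" using PS_Var_diff_cancel[of i j F] by simp
qed

lemma vdm_PS_Var_cancel_eq:
  assumes "vdm n PS_Var * F = vdm n PS_Var * G"
  shows "F = G"
proof -
  have "vdm n PS_Var * (F - G) = 0" unfolding right_diff_distrib assms by simp
  then have "F - G = 0" by (rule vdm_PS_Var_cancel)
  then show ?thesis by simp
qed

text \<open>The series 1 / (1 - c X).\<close>

definition geo :: "'c \<Rightarrow> 'c::comm_ring_1 fps"
  where "geo c = Abs_fps (\<lambda>k. c ^ k)"

lemma nth_geo [simp]: "fps_nth (geo c) k = c ^ k"
  by (simp add: geo_def)

lemma geo_mult: "geo c * (1 - fps_const c * fps_X) = 1"
proof (rule fps_ext)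
  fix k
  have "geo c * (1 - fps_const c * fps_X) = geo c - fps_const c * (fps_X * geo c)"
    by (simp add: algebra_simps)
  then show "fps_nth (geo c * (1 - fps_const c * fps_X)) k = fps_nth 1 k"
    by (cases k) simp_all
qed

lemma fps_at_geo_mult: "fps_at j (geo c) * (1 - PS_Const c * PS_Var j) = (1 :: ('v, 'c::comm_ring_1) mfps)"
proof -
  interpret comm_ring_hom "fps_at j :: 'c fps \<Rightarrow> ('v, 'c) mfps" by (rule fps_at_hom)
  have "fps_at j (geo c * (1 - fps_const c * fps_X)) = (1 :: ('v, 'c) mfps)"
    by (simp only: geo_mult hom_one)
  then show ?thesis by (simp add: hom_mult hom_minus fps_at_const fps_at_X)
qed

text \<open>Antisymmetry of the Vandermonde product is read off from Cauchy's determinant, which is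
  antisymmetric in the \<open>x\<^sub>i\<close> by construction.\<close>

lemma vdm_permute:
  fixes c :: "nat \<Rightarrow> 'c::comm_ring_1"
  assumes \<rho>: "\<rho> permutes {1..n}"
  shows "vdm n (\<lambda>i. c (\<rho> i)) = of_int (sign \<rho>) * vdm n c"
proof -
  interpret C: comm_ring_hom "PS_Const :: 'c \<Rightarrow> (nat, 'c) mfps" by (rule PS_Const_hom)
  define r :: "nat \<Rightarrow> nat \<Rightarrow> (nat, 'c) mfps" where "r = (\<lambda>i j. fps_at j (geo (c i)))"
  let ?P = "\<Prod>i\<in>{1..n}. \<Prod>j\<in>{1..n}. r i j"
  let ?Q = "\<Prod>i\<in>{1..n}. \<Prod>j\<in>{1..n}. 1 - PS_Const (c i) * PS_Var j"
  have r: "r i j * (1 - PS_Const (c i) * PS_Var j) = 1" for i j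
    unfolding r_def by (rule fps_at_geo_mult)
  \<comment> \<open>\<open>?P\<close> is a unit and is invariant under permuting rows. After
    cancelling it and the Vandermonde product in the series variables, only the Vandermonde product
    of the \<open>c i\<close> is left.\<close>
  have PQ: "?P * ?Q = 1"
    by (simp add: prod.distrib[symmetric] r)
  have "(\<Prod>i\<in>{1..n}. \<Prod>j\<in>{1..n}. r (\<rho> i) j) = ?P"
    using prod.permute[OF \<rho>, of "\<lambda>i. \<Prod>j\<in>{1..n}. r i j"] by (simp add: o_def)
  then have "alt n (\<lambda>i. r (\<rho> i)) = vdm n (\<lambda>i. PS_Const (c (\<rho> i))) * vdm n PS_Var * ?P"
    using cauchy_alternant[of "\<lambda>i. r (\<rho> i)" "\<lambda>i. PS_Const (c (\<rho> i))" PS_Var n] r by simp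
  moreover have "alt n (\<lambda>i. r (\<rho> i)) = of_int (sign \<rho>) * (vdm n (\<lambda>i. PS_Const (c i)) * vdm n PS_Var * ?P)"
    unfolding alt_permute_rows[OF \<rho>] by (subst cauchy_alternant[OF r]) simp
  ultimately have "vdm n (\<lambda>i. PS_Const (c (\<rho> i))) * vdm n PS_Var * ?P * ?Q =
      of_int (sign \<rho>) * (vdm n (\<lambda>i. PS_Const (c i)) * vdm n PS_Var * ?P) * ?Q" by simp
  then have "vdm n (\<lambda>i. PS_Const (c (\<rho> i))) * vdm n PS_Var * (?P * ?Q) =
      of_int (sign \<rho>) * (vdm n (\<lambda>i. PS_Const (c i)) * vdm n PS_Var) * (?P * ?Q)"
    by (simp only: mult.assoc)
  then have "vdm n PS_Var * vdm n (\<lambda>i. PS_Const (c (\<rho> i))) =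
      vdm n PS_Var * (of_int (sign \<rho>) * vdm n (\<lambda>i. PS_Const (c i)))"
    unfolding PQ by (simp add: mult_ac)
  then have "vdm n (\<lambda>i. PS_Const (c (\<rho> i))) = of_int (sign \<rho>) * (vdm n (\<lambda>i. PS_Const (c i)) :: (nat, 'c) mfps)"
    by (rule vdm_PS_Var_cancel_eq)
  then have "(PS_Const (vdm n (\<lambda>i. c (\<rho> i))) :: (nat, 'c) mfps) = PS_Const (of_int (sign \<rho>) * vdm n c)"
    by (simp add: C.hom_vdm C.hom_mult C.hom_of_int)
  then have "mcoeff (PS_Const (vdm n (\<lambda>i. c (\<rho> i))) :: (nat, 'c) mfps) 0 = mcoeff (PS_Const (of_int (sign \<rho>) * vdm n c) :: (nat, 'c) mfps) 0"
    by simp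
  then show ?thesis by (simp add: mcoeff_PS_Const)
qed

section \<open>Homogeneity of the Vandermonde product\<close>

definition homogeneous :: "nat \<Rightarrow> ('v, 'c::zero) mfps \<Rightarrow> bool"
  where "homogeneous d F \<longleftrightarrow> (\<forall>m. mcoeff F m \<noteq> 0 \<longrightarrow> mono_deg m = d)"

lemma homogeneous_mult:
  assumes "homogeneous d F" "homogeneous e G"
  shows "homogeneous (d + e) (F * G)"
  unfolding homogeneous_def
proof (intro allI impI)
  fix m assume "mcoeff (F * G) m \<noteq> 0"
  then obtain u v where uv: "u + v = m" "mcoeff F u * mcoeff G v \<noteq> 0"
    using mcoeff_mult_eq_0 by metis
  then have "mcoeff F u \<noteq> 0" "mcoeff G v \<noteq> 0" by auto
  with assms uv show "mono_deg m = d + e"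
    by (auto simp: homogeneous_def mono_deg_add)
qed

lemma mono_deg_single [simp]: "mono_deg (Poly_Mapping.single i k) = k"
  by (simp add: mono_deg_def)

lemma mono_deg_0 [simp]: "mono_deg 0 = 0"
  by (simp add: mono_deg_def)

lemma homogeneous_prod:
  assumes "finite I" "\<And>i. i \<in> I \<Longrightarrow> homogeneous 1 (F i)"
  shows "homogeneous (card I) (\<Prod>i\<in>I. F i)"
  using assms
proof (induction I rule: finite_induct)
  case empty
  then show ?case by (simp add: homogeneous_def mcoeff_1)
next
  case (insert i I)
  then show ?case using homogeneous_mult[of 1 "F i" "card I" "prod F I"] by (simp add: Suc_eq_plus1_left)
qed

text \<open>The number n (n - 1) / 2, both the size of the staircase and the degree of the
  Vandermonde product.\<close>

definition tri :: "nat \<Rightarrow> nat" where "tri n = (\<Sum>j\<in>{1..n}. n - j)"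

lemma tri_Suc: "tri (Suc n) = n + tri n"
proof -
  have "tri (Suc n) = (\<Sum>j\<in>{1..n}. Suc (n - j))"
    unfolding tri_def by (auto intro!: sum.cong simp: Suc_diff_le)
  also have "\<dots> = tri n + n" unfolding Suc_eq_plus1 sum.distrib by (simp add: tri_def)
  finally show ?thesis by simp
qed

lemma homogeneous_PS_Var_diff: "homogeneous 1 (PS_Var i - PS_Var j :: ('v, 'c::comm_ring_1) mfps)"
  by (auto simp: homogeneous_def mcoeff_PS_Var split: if_splits)

lemma homogeneous_vdm: "homogeneous (tri n) (vdm n PS_Var :: (nat, 'c::comm_ring_1) mfps)"
proof (induction n)
  case 0
  then show ?case by (simp add: homogeneous_def mcoeff_1 tri_def)
next
  case (Suc n)
  have "homogeneous n (\<Prod>i\<in>{1..n}. PS_Var i - PS_Var (Suc n) :: (nat, 'c) mfps)"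
    using homogeneous_prod[of "{1..n}" "\<lambda>i. PS_Var i - PS_Var (Suc n) :: (nat, 'c) mfps"]
      homogeneous_PS_Var_diff by (metis finite_atLeastAtMost card_atLeastAtMost diff_Suc_1)
  with Suc show ?case
    unfolding vdm_Suc tri_Suc by (subst add.commute) (rule homogeneous_mult)
qed

lemma PS_restrict_vdm: "PS_restrict {1..n} (vdm n PS_Var :: (nat, 'c::comm_ring_1) mfps) = vdm n PS_Var"
proof -
  interpret comm_ring_hom "PS_restrict {1..n} :: (nat, 'c) mfps \<Rightarrow> _" by (rule PS_restrict_hom)
  show ?thesis unfolding vdm_def hom_prod
    by (rule prod.cong) (auto simp: hom_minus PS_restrict_PS_Var)
qed

lemma map_mfps_vdm:
  assumes "comm_ring_hom h"
  shows "map_mfps h (vdm n PS_Var) = vdm n PS_Var"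
proof -
  interpret h: comm_ring_hom h by fact
  interpret m: comm_ring_hom "map_mfps h :: (nat, 'a) mfps \<Rightarrow> (nat, 'b) mfps" by (rule h.map_mfps_hom)
  show ?thesis by (simp add: m.hom_vdm h.map_mfps_PS_Var)
qed

text \<open>Multiplication by a homogeneous series maps homogeneous components to homogeneous
  components, so cancellation works degree by degree. This transports degree bounds from alternants
  to their quotients.\<close>

lemma mcoeff_vdm_mult_deg:
  fixes F :: "(nat, 'c::comm_ring_1) mfps"
  assumes "\<And>m. mono_deg m = d + tri n \<Longrightarrow> mcoeff (vdm n PS_Var * F) m = 0" "mono_deg m = d"
  shows "mcoeff F m = 0"
proof -
  define Fd where "Fd = MFPS (\<lambda>m. if mono_deg m = d then mcoeff F m else 0)"
  have "vdm n PS_Var * Fd = 0"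
  proof (rule mfps_eqI)
    fix m
    have *: "mcoeff (vdm n PS_Var :: (nat, 'c) mfps) u = 0 \<or> mono_deg u = tri n" for u
      using homogeneous_vdm by (auto simp: homogeneous_def)
    show "mcoeff (vdm n PS_Var * Fd) m = mcoeff 0 m"
    proof (cases "mono_deg m = d + tri n")
      case True
      have "mcoeff (vdm n PS_Var * Fd) m = mcoeff (vdm n PS_Var * F) m"
        unfolding mcoeff_mult
      proof (rule sum.cong[OF refl], clarify)
        fix u v assume "(u, v) \<in> mono_splits m"
        then have "mono_deg u + mono_deg v = d + tri n" using True by (auto simp: mono_deg_add)
        then show "mcoeff (vdm n PS_Var) u * mcoeff Fd v = mcoeff (vdm n PS_Var) u * mcoeff F v"
          using *[of u] by (auto simp: Fd_def)
      qed
      with True assms(1) show ?thesis by simp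
    next
      case False
      have "mcoeff (vdm n PS_Var * Fd) m = 0"
        by (rule mcoeff_mult_eq_0) (use * False in \<open>force simp: Fd_def mono_deg_add\<close>)
      then show ?thesis by simp
    qed
  qed
  then have "Fd = 0" by (rule vdm_PS_Var_cancel)
  then have "mcoeff Fd m = 0" by simp
  with assms(2) show ?thesis by (simp add: Fd_def)
qed

section \<open>Polynomials as power series\<close>

definition ps_of :: "('v, 'c) mpoly \<Rightarrow> ('v, 'c::zero) mfps"
  where "ps_of p = MFPS (Poly_Mapping.lookup p)"

lemma mcoeff_ps_of [simp]: "mcoeff (ps_of p) m = Poly_Mapping.lookup p m"
  by (simp add: ps_of_def)

lemma ps_of_add: "ps_of (p + q) = ps_of p + ps_of (q :: ('v, 'c::comm_ring_1) mpoly)"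
  by (rule mfps_eqI) (simp add: lookup_add)

lemma ps_of_hom: "comm_ring_hom (ps_of :: ('v, 'c::comm_ring_1) mpoly \<Rightarrow> _)"
proof (rule comm_ring_homI)
  show "ps_of (1 :: ('v, 'c) mpoly) = 1"
    by (rule mfps_eqI) (auto simp: mcoeff_1 lookup_one when_def)
  fix p q :: "('v, 'c) mpoly"
  show "ps_of (p * q) = ps_of p * ps_of q"
  proof (induction p rule: poly_mapping_single_add_induct)
    case zero
    have "ps_of (0 :: ('v, 'c) mpoly) = 0" by (rule mfps_eqI) simp
    then show ?case by simp
  next
    case (add p m c)
    have "ps_of (Poly_Mapping.single m c * q) = ps_of (Poly_Mapping.single m c) * ps_of q"
    proof (induction q rule: poly_mapping_single_add_induct)
      case zero
      have "ps_of (0 :: ('v, 'c) mpoly) = 0" by (rule mfps_eqI) simp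
      then show ?case by simp
    next
      case (add q m' c')
      have "ps_of (Poly_Mapping.single (m + m') (c * c')) = ps_of (Poly_Mapping.single m c) * ps_of (Poly_Mapping.single m' c')"
      proof (rule mfps_eqI)
        fix M
        show "mcoeff (ps_of (Poly_Mapping.single (m + m') (c * c'))) M =
          mcoeff (ps_of (Poly_Mapping.single m c) * ps_of (Poly_Mapping.single m' c')) M"
        proof (cases "M = m + m'")
          case True
          show ?thesis
            by (subst mcoeff_mult_single_split[of m m'])
              (auto simp: True lookup_single when_def)
        next
          case False
          have "mcoeff (ps_of (Poly_Mapping.single m c) * ps_of (Poly_Mapping.single m' c')) M = 0"
            by (rule mcoeff_mult_eq_0) (use False in \<open>auto simp: lookup_single when_def\<close>)
          with False show ?thesis by (simp add: lookup_single)
        qed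
      qed
      with add show ?case by (simp add: distrib_left ps_of_add mult_single)
    qed
    with add show ?case by (simp add: distrib_right ps_of_add)
  qed
qed (rule ps_of_add)

lemma ps_of_inject: "ps_of p = ps_of q \<longleftrightarrow> p = q"
  by (metis mcoeff_ps_of poly_mapping_eqI)

lemma ps_of_Var: "ps_of (Var i) = PS_Var i"
  by (rule mfps_eqI) (auto simp: Var_def mcoeff_PS_Var lookup_single when_def)

lemma ps_of_Const: "ps_of (Const c) = PS_Const c"
  by (rule mfps_eqI) (auto simp: Const_def mcoeff_PS_Const lookup_single when_def)

lemma deg_le_ps_of: "deg_le p d \<longleftrightarrow> (\<forall>m. mcoeff (ps_of p) m \<noteq> 0 \<longrightarrow> mono_deg m \<le> d)"
  by (auto simp: deg_le_def in_keys_iff)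

lemma Const_hom: "comm_ring_hom (Const :: 'c \<Rightarrow> ('v, 'c::comm_ring_1) mpoly)"
  by (rule comm_ring_homI) (auto simp: Const_add Const_mult)

lemma subst_hom: "comm_ring_hom (subst \<sigma>)"
  by (rule comm_ring_homI) (auto simp: subst_add subst_mult)

section \<open>Partitions and the Cauchy--Binet formula\<close>

definition psize :: "partition \<Rightarrow> nat"
  where "psize \<nu> = (\<Sum>k | row \<nu> k \<noteq> 0. row \<nu> k)"

text \<open>The strictly decreasing exponents \<nu> + (n - 1, ..., 1, 0) of an alternant.\<close>

definition stair :: "nat \<Rightarrow> partition \<Rightarrow> nat \<Rightarrow> nat"
  where "stair n \<nu> j = part \<nu> j + n - j"

lemma row_antimono: "i \<le> j \<Longrightarrow> row \<nu> j \<le> row \<nu> i"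
  using row[of \<nu>] by (auto simp: antimono_def)

lemma finite_row_support: "finite {k. row \<nu> k \<noteq> 0}"
  using row[of \<nu>] by auto

lemma part_antimono: "i \<le> j \<Longrightarrow> part \<nu> j \<le> part \<nu> i"
  by (simp add: part_def row_antimono)

text \<open>Allows the cardinalities that define the length and the number of diagonal boxes to be
  used as last indices.\<close>

lemma initial_segment_card:
  assumes "finite S" "\<And>j. j \<in> S \<Longrightarrow> 1 \<le> (j :: nat)" "\<And>i j. j \<in> S \<Longrightarrow> 1 \<le> i \<Longrightarrow> i \<le> j \<Longrightarrow> i \<in> S"
  shows "S = {1..card S}"
proof (cases "S = {}")
  case False
  have eq: "S = {1..Max S}"
  proof (intro equalityI subsetI)
    fix j assume "j \<in> {1..Max S}"
    then show "j \<in> S" using assms(3)[OF Max_in[OF assms(1) False]] by auto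
  qed (use assms(1,2) in auto)
  have cd: "card S = Max S" using arg_cong[OF eq, of card] by simp
  show ?thesis unfolding cd by (rule eq)
qed simp

lemma part_support: "{j. 1 \<le> j \<and> part \<nu> j \<noteq> 0} = {1..plength \<nu>}"
proof -
  let ?S = "{j. 1 \<le> j \<and> part \<nu> j \<noteq> 0}"
  have "?S = Suc ` {k. row \<nu> k \<noteq> 0}"
    by (auto simp: part_def image_iff Suc_le_eq One_nat_def) (metis Suc_pred)
  then have fin: "finite ?S" using finite_row_support by simp
  then have "?S = {1..card ?S}"
    by (rule initial_segment_card) (use part_antimono[of _ _ \<nu>] in \<open>auto intro: less_le_trans\<close>)
  then show ?thesis by (simp add: plength_def)
qed

lemma part_eq_0_iff: "1 \<le> j \<Longrightarrow> part \<nu> j = 0 \<longleftrightarrow> plength \<nu> < j"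
proof -
  assume "1 \<le> j"
  then have "part \<nu> j \<noteq> 0 \<longleftrightarrow> j \<in> {j. 1 \<le> j \<and> part \<nu> j \<noteq> 0}" by simp
  also have "\<dots> \<longleftrightarrow> j \<le> plength \<nu>" using \<open>1 \<le> j\<close> unfolding part_support by simp
  finally show ?thesis by auto
qed

lemma partition_eqI:
  assumes "\<And>j. 1 \<le> j \<Longrightarrow> part \<nu> j = part \<mu> j"
  shows "\<nu> = \<mu>"
proof -
  have "row \<nu> k = row \<mu> k" for k using assms[of "Suc k"] by (simp add: part_def One_nat_def)
  then show ?thesis by (simp add: row_inject[symmetric] fun_eq_iff)
qed

lemma psize_eq:
  assumes "plength \<nu> \<le> n"
  shows "psize \<nu> = (\<Sum>j\<in>{1..n}. part \<nu> j)"
proof -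
  have "(\<Sum>j\<in>{1..n}. part \<nu> j) = (\<Sum>k\<in>{0..<n}. row \<nu> k)"
    by (rule sum.reindex_bij_witness[of _ Suc "\<lambda>j. j - 1"]) (auto simp: part_def One_nat_def)
  also have "\<dots> = psize \<nu>"
    unfolding psize_def
  proof (rule sum.mono_neutral_right)
    show "{k. row \<nu> k \<noteq> 0} \<subseteq> {0..<n}"
    proof
      fix k assume "k \<in> {k. row \<nu> k \<noteq> 0}"
      then have "part \<nu> (Suc k) \<noteq> 0" by (simp add: part_def One_nat_def)
      then have "Suc k \<le> plength \<nu>" using part_eq_0_iff[of "Suc k" \<nu>] by simp
      with assms show "k \<in> {0..<n}" by simp
    qed
  qed auto
  finally show ?thesis by simp
qed

lemma plength_le_psize: "plength \<nu> \<le> psize \<nu>"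
proof -
  have "(\<Sum>j\<in>{1..plength \<nu>}. 1) \<le> (\<Sum>j\<in>{1..plength \<nu>}. part \<nu> j)"
  proof (rule sum_mono)
    fix j assume "j \<in> {1..plength \<nu>}"
    then have "part \<nu> j \<noteq> 0" using part_eq_0_iff[of j \<nu>] by auto
    then show "1 \<le> part \<nu> j" by simp
  qed
  then show ?thesis by (simp add: psize_eq[of \<nu> "plength \<nu>"])
qed

text \<open>A partition of size at most \<open>N\<close> fits into a square of side
  \<open>N\<close>. The graded sums over partitions below are finite for this reason.\<close>

lemma finite_psize: "finite {\<nu>. psize \<nu> \<le> N}"
proof -
  have "row ` {\<nu>. psize \<nu> \<le> N} \<subseteq> {f. \<forall>i. (i \<in> {0..<N} \<longrightarrow> f i \<in> {..N}) \<and> (i \<notin> {0..<N} \<longrightarrow> f i = 0)}"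
  proof (clarsimp, intro conjI impI)
    fix \<nu> i assume *: "psize \<nu> \<le> N"
    have "row \<nu> i \<le> psize \<nu>"
    proof (cases "row \<nu> i = 0")
      case False
      then show ?thesis unfolding psize_def using finite_row_support by (intro member_le_sum) auto
    qed simp
    with * show "row \<nu> i \<le> N" by simp
    assume "\<not> i < N"
    with * plength_le_psize[of \<nu>] have "plength \<nu> < Suc i" by simp
    then have "part \<nu> (Suc i) = 0" using part_eq_0_iff[of "Suc i" \<nu>] by simp
    then show "row \<nu> i = 0" by (simp add: part_def One_nat_def)
  qed
  then have "finite (row ` {\<nu>. psize \<nu> \<le> N})"
    by (rule finite_subset) (rule finite_set_of_finite_funs, auto)
  then show ?thesis by (rule finite_imageD) (simp add: inj_on_def row_inject)
qed

lemma sum_stair: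
  assumes "plength \<nu> \<le> n"
  shows "(\<Sum>j\<in>{1..n}. stair n \<nu> j) = psize \<nu> + tri n"
proof -
  have "(\<Sum>j\<in>{1..n}. stair n \<nu> j) = (\<Sum>j\<in>{1..n}. part \<nu> j + (n - j))"
    by (rule sum.cong) (auto simp: stair_def)
  then show ?thesis unfolding sum.distrib psize_eq[OF assms] tri_def .
qed

lemma stair_strict: "i < j \<Longrightarrow> j \<le> n \<Longrightarrow> stair n \<nu> j < stair n \<nu> i"
  using part_antimono[of i j \<nu>] by (simp add: stair_def)

lemma stair_eq_iff: "i \<in> {1..n} \<Longrightarrow> j \<in> {1..n} \<Longrightarrow> stair n \<nu> i = stair n \<nu> j \<longleftrightarrow> i = j"
  using stair_strict[of i j n \<nu>] stair_strict[of j i n \<nu>] by (cases i j rule: linorder_cases) auto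

lemma stair_less_iff: "i \<in> {1..n} \<Longrightarrow> j \<in> {1..n} \<Longrightarrow> stair n \<nu> i < stair n \<nu> j \<longleftrightarrow> j < i"
  using stair_strict[of i j n \<nu>] stair_strict[of j i n \<nu>] by (cases i j rule: linorder_cases) auto

text \<open>The position of an entry in a strictly decreasing sequence is determined by the number
  of larger entries, and \<sigma> preserves that number.\<close>

lemma stair_unique:
  assumes \<sigma>: "\<sigma> permutes {1..n}" and eq: "\<And>j. j \<in> {1..n} \<Longrightarrow> stair n \<nu> j = stair n \<mu> (\<sigma> j)"
    and len: "plength \<nu> \<le> n" "plength \<mu> \<le> n"
  shows "\<sigma> = id" "\<nu> = \<mu>"
proof -
  have fix1: "\<sigma> j = j" if j: "j \<in> {1..n}" for j
  proof -
    have \<sigma>j: "\<sigma> j \<in> {1..n}" using permutes_in_image[OF \<sigma>] j by simp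
    have count: "{l \<in> {1..n}. stair n \<kappa> l > stair n \<kappa> i} = {1..<i}" if "i \<in> {1..n}" for \<kappa> i
      using that by (auto simp: stair_less_iff)
    have "bij_betw \<sigma> {l \<in> {1..n}. stair n \<nu> l > stair n \<nu> j} {l \<in> {1..n}. stair n \<mu> l > stair n \<mu> (\<sigma> j)}"
      by (rule bij_betw_Collect[OF permutes_imp_bij[OF \<sigma>]]) (use eq j in auto)
    then have "card {1..<j} = card {1..<\<sigma> j}"
      unfolding count[OF j] count[OF \<sigma>j] by (rule bij_betw_same_card)
    with j \<sigma>j have "j - 1 = \<sigma> j - 1 \<and> 1 \<le> j \<and> 1 \<le> \<sigma> j" by simp
    then show ?thesis by linarith
  qed
  show "\<sigma> = id"
  proof
    fix j show "\<sigma> j = id j"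
      by (cases "j \<in> {1..n}") (use fix1 \<sigma> in \<open>auto simp: permutes_def\<close>)
  qed
  show "\<nu> = \<mu>"
  proof (rule partition_eqI)
    fix j :: nat assume j: "1 \<le> j"
    show "part \<nu> j = part \<mu> j"
    proof (cases "j \<le> n")
      case True
      with j eq[of j] fix1[of j] show ?thesis by (auto simp: stair_def)
    next
      case False
      with len j show ?thesis using part_eq_0_iff[of j \<nu>] part_eq_0_iff[of j \<mu>] by simp
    qed
  qed
qed

text \<open>Sort the values in decreasing order and subtract the staircase. Distinct natural numbers
  drop by at least one at each step, so the differences are still weakly decreasing.\<close>

lemma stair_exists:
  assumes inj: "inj_on \<gamma> {1..n}"
  shows "\<exists>\<nu> \<pi>. plength \<nu> \<le> n \<and> \<pi> permutes {1..n} \<and> (\<forall>j\<in>{1..n}. \<gamma> (\<pi> j) = stair n \<nu> j)"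
proof -
  define S where "S = \<gamma> ` {1..n}"
  define xs where "xs = rev (sorted_list_of_set S)"
  have S: "finite S" "card S = n" by (auto simp: S_def card_image[OF inj])
  have len: "length xs = n" by (simp add: xs_def S)
  have set: "set xs = S" by (simp add: xs_def S)
  have dec: "xs ! l < xs ! k" if "k < l" "l < n" for k l
  proof -
    have "sorted_wrt (<) (rev xs)" by (simp add: xs_def)
    then have "sorted_wrt (\<lambda>x y. y < x) xs" by (simp add: sorted_wrt_rev)
    then show ?thesis using that len by (simp add: sorted_wrt_iff_nth_less)
  qed
  \<comment> \<open>Guarantees that the truncated subtraction in the definition of \<open>f\<close>
    is exact.\<close>
  have lower: "n - 1 - k \<le> xs ! k" if "k < n" for k
    using that
  proof (induction "n - 1 - k" arbitrary: k)
    case (Suc d)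
    then have "n - 1 - Suc k \<le> xs ! Suc k" by (intro Suc.hyps(1)) auto
    moreover have "xs ! Suc k < xs ! k" using Suc by (intro dec) auto
    ultimately show ?case by simp
  qed simp
  define f where "f = (\<lambda>k. if k < n then xs ! k - (n - 1 - k) else 0)"
  have "antimono f"
  proof (rule decseq_SucI)
    fix k show "f (Suc k) \<le> f k"
      using dec[of k "Suc k"] lower[of k] lower[of "Suc k"] by (auto simp: f_def)
  qed
  moreover have "finite {k. f k \<noteq> 0}"
    by (rule finite_subset[of _ "{..<n}"]) (auto simp: f_def)
  ultimately have row: "row (Partition f) = f" by (intro Partition_inverse) simp
  define \<nu> where "\<nu> = Partition f"
  have st: "stair n \<nu> j = xs ! (j - 1)" if "j \<in> {1..n}" for j
    using that lower[of "j - 1"] by (auto simp: stair_def part_def \<nu>_def row) (auto simp: f_def)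
  have pl: "plength \<nu> \<le> n"
    using part_eq_0_iff[of "Suc n" \<nu>] unfolding part_def \<nu>_def row by (auto simp: f_def One_nat_def)
  define g where "g = the_inv_into {1..n} \<gamma>"
  define \<pi> where "\<pi> = (\<lambda>j. if j \<in> {1..n} then g (xs ! (j - 1)) else j)"
  have memS: "xs ! (j - 1) \<in> S" if "j \<in> {1..n}" for j
    using that set len by (metis One_nat_def Suc_le_eq Suc_pred atLeastAtMost_iff le_0_eq nth_mem not_gr_zero)
  have g: "\<gamma> (g y) = y" "g y \<in> {1..n}" if "y \<in> S" for y
    using that inj by (auto simp: g_def S_def f_the_inv_into_f the_inv_into_into simp del: atLeastAtMost_iff)
  have "\<pi> permutes {1..n}"
  proof (rule bij_imp_permutes)
    have "inj_on \<pi> {1..n}"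
    proof (rule inj_onI)
      fix i j assume ij: "i \<in> {1..n}" "j \<in> {1..n}" "\<pi> i = \<pi> j"
      then have "xs ! (i - 1) = xs ! (j - 1)" using g memS by (metis \<pi>_def)
      then have "stair n \<nu> i = stair n \<nu> j" using st ij by simp
      with ij show "i = j" by (simp add: stair_eq_iff)
    qed
    moreover have "\<pi> ` {1..n} \<subseteq> {1..n}" using g memS by (auto simp: \<pi>_def simp del: atLeastAtMost_iff)
    ultimately show "bij_betw \<pi> {1..n} {1..n}"
      by (simp add: bij_betw_def endo_inj_surj)
  qed (auto simp: \<pi>_def)
  moreover have "\<forall>j\<in>{1..n}. \<gamma> (\<pi> j) = stair n \<nu> j"
    using g memS st by (auto simp: \<pi>_def simp del: atLeastAtMost_iff)
  ultimately show ?thesis using pl by blast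
qed

text \<open>A nonzero Leibniz term needs
  \<open>stair n \<nu> j \<le> stair n \<mu> (\<pi> j)\<close> for every \<open>j\<close>. The size
  hypothesis bounds the sum of the right sides by that of the left sides, so all these are
  equalities, and \<open>stair_unique\<close> leaves only the identity.\<close>

lemma alt_stair_triangular:
  fixes M :: "nat \<Rightarrow> nat \<Rightarrow> 'r::comm_ring_1"
  assumes M: "\<And>k b. b < k \<Longrightarrow> M k b = 0" "\<And>k. M k k = 1"
    and len: "plength \<nu> \<le> n" "plength \<mu> \<le> n" and sz: "psize \<mu> \<le> psize \<nu>"
  shows "alt n (\<lambda>i j. M (stair n \<nu> j) (stair n \<mu> i)) = (if \<mu> = \<nu> then 1 else 0)"
proof -
  have z: "of_int (sign \<pi>) * (\<Prod>j\<in>{1..n}. M (stair n \<nu> j) (stair n \<mu> (\<pi> j))) = 0"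
    if \<pi>: "\<pi> permutes {1..n}" and ne: "\<not> (\<pi> = id \<and> \<mu> = \<nu>)" for \<pi>
  proof (rule ccontr)
    assume "of_int (sign \<pi>) * (\<Prod>j\<in>{1..n}. M (stair n \<nu> j) (stair n \<mu> (\<pi> j))) \<noteq> 0"
    then have "(\<Prod>j\<in>{1..n}. M (stair n \<nu> j) (stair n \<mu> (\<pi> j))) \<noteq> 0" by auto
    then have le: "stair n \<nu> j \<le> stair n \<mu> (\<pi> j)" if "j \<in> {1..n}" for j
      using M(1) that prod_zero[of "{1..n}" "\<lambda>j. M (stair n \<nu> j) (stair n \<mu> (\<pi> j))"]
      by (metis finite_atLeastAtMost not_le)
    have "(\<Sum>j\<in>{1..n}. stair n \<mu> (\<pi> j)) = (\<Sum>j\<in>{1..n}. stair n \<mu> j)"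
      using sum.permute[OF \<pi>, of "stair n \<mu>"] by (simp add: o_def)
    then have tot: "(\<Sum>j\<in>{1..n}. stair n \<mu> (\<pi> j)) \<le> (\<Sum>j\<in>{1..n}. stair n \<nu> j)"
      using sz by (simp add: sum_stair len)
    have "stair n \<nu> j = stair n \<mu> (\<pi> j)" if j: "j \<in> {1..n}" for j
    proof (rule ccontr)
      assume "stair n \<nu> j \<noteq> stair n \<mu> (\<pi> j)"
      with le[OF j] have "stair n \<nu> j < stair n \<mu> (\<pi> j)" by simp
      then have "(\<Sum>j\<in>{1..n}. stair n \<nu> j) < (\<Sum>j\<in>{1..n}. stair n \<mu> (\<pi> j))"
        using le j by (intro sum_strict_mono_ex1) auto
      with tot show False by simp
    qed
    from stair_unique[OF \<pi> this len] ne show False by simp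
  qed
  show ?thesis
  proof (cases "\<mu> = \<nu>")
    case True
    have "alt n (\<lambda>i j. M (stair n \<nu> j) (stair n \<mu> i)) =
        (\<Sum>\<pi>\<in>{id}. of_int (sign \<pi>) * (\<Prod>j\<in>{1..n}. M (stair n \<nu> j) (stair n \<mu> (\<pi> j))))"
      unfolding alt_def
      by (rule sum.mono_neutral_right) (auto simp: finite_permutations permutes_id intro: z)
    also have "\<dots> = 1" by (simp add: True M)
    finally show ?thesis by (simp add: True)
  next
    case False
    then show ?thesis unfolding alt_def by (auto intro!: sum.neutral z)
  qed
qed

text \<open>Expand every column over the choice of one summand. A choice with a repetition produces
  two equal columns; an injective one is the staircase of a unique partition, arranged by a unique
  permutation.\<close>

lemma cauchy_binet:
  fixes u v :: "nat \<Rightarrow> nat \<Rightarrow> 'r::comm_ring_1"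
  shows "alt n (\<lambda>i j. \<Sum>m\<le>M. u i m * v j m) =
    (\<Sum>\<nu> | plength \<nu> \<le> n \<and> (\<forall>j\<in>{1..n}. stair n \<nu> j \<le> M).
      alt n (\<lambda>i j. u i (stair n \<nu> j)) * alt n (\<lambda>i j. v i (stair n \<nu> j)))"
proof -
  let ?S = "{\<nu>. plength \<nu> \<le> n \<and> (\<forall>j\<in>{1..n}. stair n \<nu> j \<le> M)}"
  let ?P = "{\<sigma>. \<sigma> permutes {1..n}}"
  let ?K = "{1..n} \<rightarrow>\<^sub>E {..M}"
  \<comment> \<open>\<open>F k\<close> collects the terms in which column \<open>j\<close>
    contributes its summand of index \<open>k j\<close>; \<open>h\<close> enumerates the injective
    choices.\<close>
  define F where "F = (\<lambda>k. (\<Prod>j\<in>{1..n}. v j (k j)) * alt n (\<lambda>i j. u i (k j)))"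
  define h where "h = (\<lambda>(\<nu>, \<sigma>). restrict (\<lambda>j. stair n \<nu> (\<sigma> j)) {1..n})"
  have bij: "bij_betw h (?S \<times> ?P) {k. k \<in> ?K \<and> inj_on k {1..n}}"
    unfolding bij_betw_def
  proof (intro conjI equalityI subsetI)
    show "inj_on h (?S \<times> ?P)"
    proof (rule inj_onI)
      fix p q assume pq: "p \<in> ?S \<times> ?P" "q \<in> ?S \<times> ?P" "h p = h q"
      obtain \<nu> \<sigma> \<nu>' \<sigma>' where eqs: "p = (\<nu>, \<sigma>)" "q = (\<nu>', \<sigma>')" by (cases p, cases q)
      with pq have \<sigma>: "\<sigma> permutes {1..n}" and \<sigma>': "\<sigma>' permutes {1..n}"
        and len: "plength \<nu> \<le> n" "plength \<nu>' \<le> n" by auto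
      \<comment> \<open>Both pairs arrange the same choice, so their staircases differ by this
        permutation.\<close>
      let ?\<tau> = "\<sigma>' \<circ> inv_into UNIV \<sigma>"
      have \<tau>: "?\<tau> permutes {1..n}" by (rule permutes_compose[OF permutes_inv[OF \<sigma>] \<sigma>'])
      have st: "stair n \<nu> j = stair n \<nu>' (?\<tau> j)" if j: "j \<in> {1..n}" for j
      proof -
        have i: "inv_into UNIV \<sigma> j \<in> {1..n}" using permutes_in_image[OF permutes_inv[OF \<sigma>]] j by simp
        have "h p (inv_into UNIV \<sigma> j) = h q (inv_into UNIV \<sigma> j)" using pq by simp
        with i show ?thesis by (simp add: h_def eqs permutes_inverses[OF \<sigma>])
      qed
      note u = stair_unique[OF \<tau> st len]
      have "\<sigma>' j = \<sigma> j" for j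
        using fun_cong[OF u(1), of "\<sigma> j"] by (simp add: permutes_inverses[OF \<sigma>])
      with u(2) show "p = q" by (auto simp: eqs)
    qed
  next
    fix k assume "k \<in> h ` (?S \<times> ?P)"
    then obtain \<nu> \<sigma> where k: "k = h (\<nu>, \<sigma>)" and \<nu>: "\<nu> \<in> ?S" and \<sigma>: "\<sigma> permutes {1..n}" by auto
    have "inj_on k {1..n}"
      unfolding k using permutes_in_image[OF \<sigma>] permutes_inj[OF \<sigma>]
      by (auto simp: inj_on_def h_def stair_eq_iff dest: injD simp del: atLeastAtMost_iff)
    moreover have "k \<in> ?K"
      unfolding k using permutes_in_image[OF \<sigma>] \<nu> by (auto simp: h_def simp del: atLeastAtMost_iff)
    ultimately show "k \<in> {k. k \<in> ?K \<and> inj_on k {1..n}}" by simp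
  next
    fix k assume "k \<in> {k. k \<in> ?K \<and> inj_on k {1..n}}"
    then have k: "k \<in> ?K" and "inj_on k {1..n}" by auto
    then obtain \<nu> \<pi> where *: "plength \<nu> \<le> n" and \<pi>: "\<pi> permutes {1..n}" and
      st: "\<And>j. j \<in> {1..n} \<Longrightarrow> k (\<pi> j) = stair n \<nu> j" using stair_exists by blast
    have "stair n \<nu> j \<le> M" if "j \<in> {1..n}" for j
      using st[OF that] k permutes_in_image[OF \<pi>] that by (metis PiE_mem atMost_iff)
    with * have "\<nu> \<in> ?S" by simp
    moreover have "k = h (\<nu>, inv_into UNIV \<pi>)"
    proof
      fix j
      show "k j = h (\<nu>, inv_into UNIV \<pi>) j"
      proof (cases "j \<in> {1..n}")
        case True
        then have "inv_into UNIV \<pi> j \<in> {1..n}" using permutes_in_image[OF permutes_inv[OF \<pi>]] by simp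
        from st[OF this] True show ?thesis by (simp add: h_def permutes_inverses[OF \<pi>])
      next
        case False
        then show ?thesis using PiE_arb[OF k False] by (auto simp: h_def)
      qed
    qed
    ultimately show "k \<in> h ` (?S \<times> ?P)" using permutes_inv[OF \<pi>] by blast
  qed
  have "alt n (\<lambda>i j. \<Sum>m\<le>M. u i m * v j m) =
      (\<Sum>\<pi>\<in>?P. \<Sum>k\<in>?K. of_int (sign \<pi>) * ((\<Prod>j\<in>{1..n}. u (\<pi> j) (k j)) * (\<Prod>j\<in>{1..n}. v j (k j))))"
    unfolding alt_def
    by (rule sum.cong[OF refl]) (simp add: prod_sum_PiE sum_distrib_left prod.distrib)
  also have "\<dots> = (\<Sum>k\<in>?K. F k)"
    unfolding F_def alt_def by (subst sum.swap) (simp add: sum_distrib_left mult_ac)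
  also have "\<dots> = (\<Sum>k | k \<in> ?K \<and> inj_on k {1..n}. F k)"
  proof (rule sum.mono_neutral_right)
    show "\<forall>k\<in>?K - {k. k \<in> ?K \<and> inj_on k {1..n}}. F k = 0"
    proof
      fix k assume "k \<in> ?K - {k. k \<in> ?K \<and> inj_on k {1..n}}"
      then have "\<not> inj_on k {1..n}" by blast
      then obtain i j where "i \<in> {1..n}" "j \<in> {1..n}" "i \<noteq> j" "k i = k j" by (auto simp: inj_on_def)
      then have "alt n (\<lambda>i j. u i (k j)) = 0" by (intro alt_identical_cols[of i n j]) auto
      then show "F k = 0" by (simp add: F_def)
    qed
  qed (auto intro!: finite_PiE)
  also have "\<dots> = (\<Sum>p\<in>?S \<times> ?P. F (h p))"
    by (rule sum.reindex_bij_betw[OF bij, symmetric])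
  also have "\<dots> = (\<Sum>\<nu>\<in>?S. \<Sum>\<sigma>\<in>?P. F (restrict (\<lambda>j. stair n \<nu> (\<sigma> j)) {1..n}))"
    by (simp add: h_def sum.cartesian_product case_prod_unfold)
  also have "\<dots> = (\<Sum>\<nu>\<in>?S. alt n (\<lambda>i j. u i (stair n \<nu> j)) * alt n (\<lambda>i j. v i (stair n \<nu> j)))"
  proof (rule sum.cong[OF refl])
    fix \<nu> assume "\<nu> \<in> ?S"
    have "F (restrict (\<lambda>j. stair n \<nu> (\<sigma> j)) {1..n}) =
        alt n (\<lambda>i j. u i (stair n \<nu> j)) * (of_int (sign \<sigma>) * (\<Prod>j\<in>{1..n}. v j (stair n \<nu> (\<sigma> j))))"
      if "\<sigma> \<in> ?P" for \<sigma>
    proof -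
      have "alt n (\<lambda>i j. u i (restrict (\<lambda>j. stair n \<nu> (\<sigma> j)) {1..n} j)) = alt n (\<lambda>i j. u i (stair n \<nu> (\<sigma> j)))"
        by (rule alt_cong) simp
      also have "\<dots> = of_int (sign \<sigma>) * alt n (\<lambda>i j. u i (stair n \<nu> j))"
        using that by (intro alt_permute_cols) simp
      finally show ?thesis by (simp add: F_def mult_ac)
    qed
    then have "(\<Sum>\<sigma>\<in>?P. F (restrict (\<lambda>j. stair n \<nu> (\<sigma> j)) {1..n})) =
        alt n (\<lambda>i j. u i (stair n \<nu> j)) * alt n (\<lambda>i j. v j (stair n \<nu> i))"
      by (simp add: alt_def sum_distrib_left)
    then show "(\<Sum>\<sigma>\<in>?P. F (restrict (\<lambda>j. stair n \<nu> (\<sigma> j)) {1..n})) =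
        alt n (\<lambda>i j. u i (stair n \<nu> j)) * alt n (\<lambda>i j. v i (stair n \<nu> j))"
      by (simp add: alt_transpose[of n "\<lambda>i j. v i (stair n \<nu> j)"])
  qed
  finally show ?thesis .
qed

section \<open>Double Schur polynomials\<close>

lemma exact_quot_eq:
  assumes "\<And>F. q * F = 0 \<Longrightarrow> F = 0" "q * r = p"
  shows "exact_quot p q = r"
  unfolding exact_quot_def
proof (rule the_equality)
  show "r * q = p" using assms(2) by (simp add: mult.commute)
  fix r' assume "r' * q = p"
  then have "q * (r' - r) = 0" using assms(2) by (simp add: algebra_simps)
  then show "r' = r" using assms(1) by fastforce
qed

text \<open>The double power (X - a_n)(X - a_{n-1})... with \<open>m\<close> factors, a monic
  polynomial of degree \<open>m\<close>, kept as a series in one variable so that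
  \<open>fps_at\<close> can place it at any x_i.\<close>

definition eser :: "nat \<Rightarrow> nat \<Rightarrow> qa fps"
  where "eser n m = (\<Prod>k<m. fps_X - fps_const (a (int n - int k)))"

lemma eser_nth:
  shows "m < b \<Longrightarrow> fps_nth (eser n m) b = 0" and "fps_nth (eser n m) m = 1"
proof -
  have "(\<forall>b>m. fps_nth (eser n m) b = 0) \<and> fps_nth (eser n m) m = 1"
  proof (induction m)
    case 0
    then show ?case by (simp add: eser_def)
  next
    case (Suc m)
    have e: "eser n (Suc m) = fps_X * eser n m - fps_const (a (int n - int m)) * eser n m"
      by (simp add: eser_def algebra_simps)
    have "fps_nth (eser n (Suc m)) b = 0" if "Suc m < b" for b
      using that Suc by (cases b) (auto simp: e)
    moreover have "fps_nth (eser n (Suc m)) (Suc m) = 1"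
      using Suc by (simp add: e)
    ultimately show ?case by blast
  qed
  then show "m < b \<Longrightarrow> fps_nth (eser n m) b = 0" and "fps_nth (eser n m) m = 1" by auto
qed

lemma ps_of_double_power: "ps_of (double_power n i m) = fps_at i (eser n m)"
proof -
  interpret p: comm_ring_hom "ps_of :: xpoly \<Rightarrow> xseries" by (rule ps_of_hom)
  interpret f: comm_ring_hom "fps_at i :: qa fps \<Rightarrow> xseries" by (rule fps_at_hom)
  show ?thesis
    by (simp add: double_power_def eser_def p.hom_prod f.hom_prod p.hom_minus f.hom_minus
        ps_of_Var ps_of_Const fps_at_X fps_at_const)
qed

text \<open>The bound \<open>M\<close> is free so that all columns of an alternant can be expanded
  over the same range, as Cauchy-Binet requires.\<close>

lemma double_power_expand:
  assumes "m \<le> M"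
  shows "double_power n i m = (\<Sum>b\<le>M. Var i ^ b * Const (fps_nth (eser n m) b))"
proof -
  interpret p: comm_ring_hom "ps_of :: xpoly \<Rightarrow> xseries" by (rule ps_of_hom)
  interpret f: comm_ring_hom "fps_at i :: qa fps \<Rightarrow> xseries" by (rule fps_at_hom)
  have e: "eser n m = (\<Sum>b\<le>M. fps_X ^ b * fps_const (fps_nth (eser n m) b))" (is "_ = ?r")
  proof (rule fps_ext)
    fix k
    have "fps_nth ?r k = (\<Sum>b\<le>M. if k = b then fps_nth (eser n m) b else 0)"
      unfolding fps_sum_nth by (rule sum.cong) (auto simp: fps_X_power_nth)
    also have "\<dots> = fps_nth (eser n m) k"
      using assms eser_nth(1)[of m k n] by auto
    finally show "fps_nth (eser n m) k = fps_nth ?r k" by simp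
  qed
  have "ps_of (double_power n i m) = fps_at i ?r"
    unfolding ps_of_double_power by (rule arg_cong[OF e])
  also have "\<dots> = ps_of (\<Sum>b\<le>M. Var i ^ b * Const (fps_nth (eser n m) b))"
    by (simp add: p.hom_sum f.hom_sum p.hom_mult f.hom_mult p.hom_power f.hom_power
        ps_of_Var ps_of_Const fps_at_X fps_at_const)
  finally show ?thesis by (simp add: ps_of_inject)
qed

lemma ps_of_vdm: "ps_of (vdm n Var) = (vdm n PS_Var :: xseries)"
proof -
  interpret p: comm_ring_hom "ps_of :: xpoly \<Rightarrow> xseries" by (rule ps_of_hom)
  show ?thesis by (simp add: p.hom_vdm ps_of_Var)
qed

lemma vdm_Var_nonzero: "vdm n Var \<noteq> (0 :: xpoly)"
proof
  assume "vdm n Var = (0 :: xpoly)"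
  then have "(vdm n PS_Var :: xseries) = 0"
    unfolding ps_of_vdm[symmetric] by (simp add: mfps_eqI)
  then have "vdm n PS_Var * (1 :: xseries) = 0" by simp
  then have "(1 :: xseries) = 0" by (rule vdm_PS_Var_cancel)
  then show False by (simp only: one_neq_zero)
qed

text \<open>Cauchy's determinant, read off at the coefficient of \<open>y\<^sup>\<gamma>\<close>.\<close>

lemma vdm_mult_coeff:
  fixes P :: "xpoly fps"
  assumes "Poly_Mapping.keys \<gamma> \<subseteq> {1..n}"
  shows "vdm n Var * mcoeff (vdm n PS_Var * (\<Prod>j\<in>{1..n}. fps_at j (P * (\<Prod>i\<in>{1..n}. geo (Var i))))) \<gamma> =
    alt n (\<lambda>i j. fps_nth (P * geo (Var i)) (Poly_Mapping.lookup \<gamma> j))"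
proof -
  interpret C: comm_ring_hom "PS_Const :: xpoly \<Rightarrow> (nat, xpoly) mfps" by (rule PS_Const_hom)
  interpret f: comm_ring_hom "fps_at i :: xpoly fps \<Rightarrow> (nat, xpoly) mfps" for i by (rule fps_at_hom)
  define r :: "nat \<Rightarrow> nat \<Rightarrow> (nat, xpoly) mfps" where "r = (\<lambda>i j. fps_at j (geo (Var i)))"
  have r: "r i j * (1 - PS_Const (Var i) * PS_Var j) = 1" for i j
    unfolding r_def by (rule fps_at_geo_mult)
  \<comment> \<open>Column \<open>j\<close> carries the common factor P(y_j). With P = 1 this gives
    the divisibility of alternants; with the numerators of the kernel for P it gives the Cauchy
    identity.\<close>
  have "alt n (\<lambda>i j. fps_at j (P * geo (Var i))) = (\<Prod>j\<in>{1..n}. fps_at j P) * alt n r"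
    by (simp add: f.hom_mult r_def alt_scale_cols)
  also have "\<dots> = vdm n (\<lambda>i. PS_Const (Var i)) * (vdm n PS_Var * ((\<Prod>j\<in>{1..n}. fps_at j P) * (\<Prod>i\<in>{1..n}. \<Prod>j\<in>{1..n}. r i j)))"
    unfolding cauchy_alternant[OF r] by (simp add: mult_ac)
  also have "(\<Prod>i\<in>{1..n}. \<Prod>j\<in>{1..n}. r i j) = (\<Prod>j\<in>{1..n}. \<Prod>i\<in>{1..n}. r i j)"
    by (rule prod.swap)
  also have "(\<Prod>j\<in>{1..n}. fps_at j P) * (\<Prod>j\<in>{1..n}. \<Prod>i\<in>{1..n}. r i j) =
      (\<Prod>j\<in>{1..n}. fps_at j (P * (\<Prod>i\<in>{1..n}. geo (Var i))))"
    by (simp add: f.hom_mult f.hom_prod r_def prod.distrib)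
  also have "vdm n (\<lambda>i. PS_Const (Var i)) = (PS_Const (vdm n Var) :: (nat, xpoly) mfps)"
    by (simp add: C.hom_vdm)
  finally have "mcoeff (alt n (\<lambda>i j. fps_at j (P * geo (Var i)))) \<gamma> =
    vdm n Var * mcoeff (vdm n PS_Var * (\<Prod>j\<in>{1..n}. fps_at j (P * (\<Prod>i\<in>{1..n}. geo (Var i))))) \<gamma>"
    by simp
  moreover have "alt n (\<lambda>i j. fps_at j (P * geo (Var i))) = alt n (\<lambda>j i. fps_at j (P * geo (Var i)))"
    by (rule alt_transpose)
  moreover have "mcoeff (alt n (\<lambda>j i. fps_at j (P * geo (Var i)))) \<gamma> =
      alt n (\<lambda>j i. fps_nth (P * geo (Var i)) (Poly_Mapping.lookup \<gamma> j))"
    by (rule mcoeff_alt_fps_at[OF assms])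
  moreover have "alt n (\<lambda>j i. fps_nth (P * geo (Var i)) (Poly_Mapping.lookup \<gamma> j)) =
      alt n (\<lambda>i j. fps_nth (P * geo (Var i)) (Poly_Mapping.lookup \<gamma> j))"
    by (rule alt_transpose)
  ultimately show ?thesis by simp
qed

definition mono_of :: "nat \<Rightarrow> (nat \<Rightarrow> nat) \<Rightarrow> nat \<Rightarrow>\<^sub>0 nat"
  where "mono_of n f = (\<Sum>j\<in>{1..n}. Poly_Mapping.single j (f j))"

lemma lookup_mono_of: "Poly_Mapping.lookup (mono_of n f) i = (if i \<in> {1..n} then f i else 0)"
proof -
  have "Poly_Mapping.lookup (mono_of n f) i = (\<Sum>j\<in>{1..n}. if j = i then f j else 0)"
    unfolding mono_of_def lookup_sum by (rule sum.cong) (auto simp: lookup_single when_def)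
  then show ?thesis by simp
qed

lemma keys_mono_of: "Poly_Mapping.keys (mono_of n f) \<subseteq> {1..n}"
  by (auto simp: in_keys_iff lookup_mono_of split: if_splits)

lemma mono_deg_mono_of: "mono_deg (mono_of n f) = (\<Sum>j\<in>{1..n}. f j)"
  by (subst mono_deg_superset[OF _ keys_mono_of]) (auto simp: lookup_mono_of)

text \<open>As x_i^k is the coefficient of y^k in 1 / (1 - x_i y), every alternant of powers is a
  coefficient of Cauchy's determinant, where the Vandermonde product in x is a visible
  factor.\<close>

lemma vdm_dvd_alt_power: "vdm n Var dvd (alt n (\<lambda>i j. Var i ^ k j) :: xpoly)"
proof -
  have "alt n (\<lambda>i j. Var i ^ k j :: xpoly) =
      alt n (\<lambda>i j. fps_nth (1 * geo (Var i)) (Poly_Mapping.lookup (mono_of n k) j))"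
    by (rule alt_cong) (simp add: lookup_mono_of)
  then show ?thesis
    unfolding vdm_mult_coeff[OF keys_mono_of, symmetric] by simp
qed

text \<open>Cauchy-Binet writes this alternant as a combination of alternants of powers.\<close>

lemma vdm_dvd_alt_double_power: "vdm n Var dvd alt n (\<lambda>i j. double_power n i (k j))"
proof -
  let ?M = "\<Sum>j\<in>{1..n}. k j"
  have "alt n (\<lambda>i j. double_power n i (k j)) =
      alt n (\<lambda>i j. \<Sum>b\<le>?M. Var i ^ b * Const (fps_nth (eser n (k j)) b))"
    by (intro alt_cong double_power_expand member_le_sum) auto
  then show ?thesis
    unfolding cauchy_binet by (auto intro!: dvd_sum dvd_mult2 vdm_dvd_alt_power)
qed

lemma vdm_mult_double_schur_poly:
  assumes "plength \<nu> \<le> n"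
  shows "vdm n Var * double_schur_poly n \<nu> = alt n (\<lambda>i j. double_power n i (stair n \<nu> j))"
proof -
  obtain s where s: "alt n (\<lambda>i j. double_power n i (stair n \<nu> j)) = vdm n Var * s"
    using vdm_dvd_alt_double_power[of n "stair n \<nu>"] by (auto elim: dvdE)
  have "double_schur_poly n \<nu> = s"
    unfolding double_schur_poly_def bialternant_eq if_P[OF assms]
    using vdm_Var_nonzero s by (intro exact_quot_eq) (auto simp: stair_def)
  with s show ?thesis by simp
qed

section \<open>Variables, symmetry, degree and stability of double Schur polynomials\<close>

lemma vars_prod: "vars (\<Prod>i\<in>I. f i) \<subseteq> (\<Union>i\<in>I. vars (f i :: ('v, 'c::comm_ring_1) mpoly))"
proof (induction I rule: infinite_finite_induct)
  case (insert i I)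
  then show ?case using vars_mult[of "f i" "prod f I"] by auto
qed auto

lemma vars_subst: "vars (subst \<sigma> p) \<subseteq> (\<Union>i. vars (\<sigma> i))"
proof -
  let ?V = "\<Union>i. vars (\<sigma> i)"
  have pow: "vars (\<sigma> i ^ k) \<subseteq> ?V" for i k using vars_power[of "\<sigma> i" k] by blast
  have "vars (mono_eval \<sigma> m) \<subseteq> ?V" for m
    unfolding mono_eval_def by (rule order_trans[OF vars_prod UN_least[OF pow]])
  then have tm: "vars (Const c * mono_eval \<sigma> m) \<subseteq> ?V" for c m
    by (intro order_trans[OF vars_mult] Un_least) simp
  show ?thesis
    unfolding subst_def by (rule order_trans[OF vars_sum UN_least[OF tm]])
qed

text \<open>Replaces a statement about occurring variables by invariance under a substitution, which
  can be checked after multiplication by the Vandermonde product.\<close>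

lemma vars_subsetI:
  assumes "subst (\<lambda>i. if i \<in> A then Var i else 0) p = (p :: ('v, 'c::comm_ring_1) mpoly)"
  shows "vars p \<subseteq> A"
proof -
  have "vars p \<subseteq> (\<Union>i. vars (if i \<in> A then Var i else 0 :: ('v, 'c) mpoly))"
    by (subst assms[symmetric]) (rule vars_subst)
  also have "\<dots> \<subseteq> A" by (auto split: if_splits)
  finally show ?thesis .
qed

lemma double_power_Suc: "double_power (Suc p) i (Suc m) = (Var i - Const (a (int (Suc p)))) * double_power p i m"
  unfolding double_power_def by (subst prod.lessThan_Suc_shift) simp

lemma subst_double_power: "subst \<sigma> (double_power n i m) = (\<Prod>k<m. \<sigma> i - Const (a (int n - int k)))"
proof -
  interpret s: comm_ring_hom "subst \<sigma>" by (rule subst_hom)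
  show ?thesis by (simp add: double_power_def s.hom_prod subst_diff)
qed

text \<open>The product form survives every substitution, also one that makes the Vandermonde
  product vanish.\<close>

lemma subst_double_schur_poly:
  assumes "plength \<nu> \<le> n"
  shows "vdm n \<sigma> * subst \<sigma> (double_schur_poly n \<nu>) =
    alt n (\<lambda>i j. \<Prod>k<stair n \<nu> j. \<sigma> i - Const (a (int n - int k)))"
proof -
  interpret s: comm_ring_hom "subst \<sigma>" by (rule subst_hom)
  show ?thesis
    using arg_cong[OF vdm_mult_double_schur_poly[OF assms], of "subst \<sigma>"]
    by (simp add: subst_mult s.hom_vdm s.hom_alt subst_double_power)
qed

lemma vdm_cong: "(\<And>i. i \<in> {1..n} \<Longrightarrow> x i = y i) \<Longrightarrow> vdm n x = vdm n y"
  unfolding vdm_def by (rule prod.cong) auto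

lemma double_schur_poly_vars: "vars (double_schur_poly n \<nu>) \<subseteq> {1..n}"
proof (cases "plength \<nu> \<le> n")
  case True
  let ?\<sigma> = "\<lambda>i. if i \<in> {1..n} then Var i else 0 :: xpoly"
  have "vdm n Var * subst ?\<sigma> (double_schur_poly n \<nu>) = vdm n ?\<sigma> * subst ?\<sigma> (double_schur_poly n \<nu>)"
    by (subst vdm_cong[of n Var ?\<sigma>]) auto
  also have "\<dots> = alt n (\<lambda>i j. double_power n i (stair n \<nu> j))"
    unfolding subst_double_schur_poly[OF True] by (rule alt_cong) (auto simp: double_power_def)
  also have "\<dots> = vdm n Var * double_schur_poly n \<nu>"
    by (rule vdm_mult_double_schur_poly[OF True, symmetric])
  finally have "subst ?\<sigma> (double_schur_poly n \<nu>) = double_schur_poly n \<nu>"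
    using vdm_Var_nonzero by simp
  then show ?thesis by (rule vars_subsetI)
qed (simp add: double_schur_poly_def)

text \<open>Vandermonde product and alternant change by the same sign.\<close>

lemma double_schur_poly_sym:
  assumes \<pi>: "\<pi> permutes {1..n}"
  shows "subst (\<lambda>i. Var (\<pi> i)) (double_schur_poly n \<nu>) = double_schur_poly n \<nu>"
proof (cases "plength \<nu> \<le> n")
  case True
  have "of_int (sign \<pi>) * (vdm n Var * subst (\<lambda>i. Var (\<pi> i)) (double_schur_poly n \<nu>)) =
      alt n (\<lambda>i j. double_power n (\<pi> i) (stair n \<nu> j))"
    using subst_double_schur_poly[OF True, of "\<lambda>i. Var (\<pi> i)"]
    by (simp add: vdm_permute[OF \<pi>, of Var] double_power_def mult.assoc)
  also have "\<dots> = of_int (sign \<pi>) * (vdm n Var * double_schur_poly n \<nu>)"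
    unfolding vdm_mult_double_schur_poly[OF True] by (rule alt_permute_rows[OF \<pi>])
  finally have "of_int (sign \<pi>) * (of_int (sign \<pi>) * (vdm n Var * subst (\<lambda>i. Var (\<pi> i)) (double_schur_poly n \<nu>))) =
      of_int (sign \<pi>) * (of_int (sign \<pi>) * (vdm n Var * double_schur_poly n \<nu>))" by simp
  then have "vdm n Var * subst (\<lambda>i. Var (\<pi> i)) (double_schur_poly n \<nu>) = vdm n Var * double_schur_poly n \<nu>"
    unfolding mult.assoc[symmetric] of_int_mult[symmetric] sign_idempotent by simp
  then show ?thesis using vdm_Var_nonzero by simp
qed (simp add: double_schur_poly_def)

text \<open>In a degree above |\<nu>| + n (n - 1) / 2 every Leibniz term contains a factor whose
  degree is below the exponent asked for. Dividing by the Vandermonde product lowers the bound by n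
  (n - 1) / 2.\<close>

lemma double_schur_poly_deg: "deg_le (double_schur_poly n \<nu>) (psize \<nu>)"
proof (cases "plength \<nu> \<le> n")
  case True
  interpret p: comm_ring_hom "ps_of :: xpoly \<Rightarrow> xseries" by (rule ps_of_hom)
  have v: "vdm n PS_Var * ps_of (double_schur_poly n \<nu>) = alt n (\<lambda>i j. fps_at i (eser n (stair n \<nu> j)))"
    using arg_cong[OF vdm_mult_double_schur_poly[OF True], of ps_of]
    by (simp add: p.hom_mult ps_of_vdm p.hom_alt ps_of_double_power)
  have z: "mcoeff (vdm n PS_Var * ps_of (double_schur_poly n \<nu>)) m = 0" if m: "mono_deg m > psize \<nu> + tri n" for m
  proof (cases "Poly_Mapping.keys m \<subseteq> {1..n}")
    case False
    then show ?thesis unfolding v by (rule mcoeff_alt_fps_at_outside)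
  next
    case keys: True
    have "of_int (sign \<pi>) * (\<Prod>j\<in>{1..n}. fps_nth (eser n (stair n \<nu> j)) (Poly_Mapping.lookup m (\<pi> j))) = 0"
      if \<pi>: "\<pi> permutes {1..n}" for \<pi>
    proof -
      have "\<exists>j\<in>{1..n}. stair n \<nu> j < Poly_Mapping.lookup m (\<pi> j)"
      proof (rule ccontr)
        assume "\<not> ?thesis"
        then have "(\<Sum>j\<in>{1..n}. Poly_Mapping.lookup m (\<pi> j)) \<le> (\<Sum>j\<in>{1..n}. stair n \<nu> j)"
          by (intro sum_mono) (auto simp: not_less)
        moreover have "(\<Sum>j\<in>{1..n}. Poly_Mapping.lookup m (\<pi> j)) = mono_deg m"
          using sum.permute[OF \<pi>, of "Poly_Mapping.lookup m"] keys
          by (simp add: o_def mono_deg_superset[of "{1..n}"])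
        ultimately show False using m by (simp add: sum_stair True)
      qed
      then have "\<exists>j\<in>{1..n}. fps_nth (eser n (stair n \<nu> j)) (Poly_Mapping.lookup m (\<pi> j)) = 0"
        using eser_nth(1) by blast
      then have "(\<Prod>j\<in>{1..n}. fps_nth (eser n (stair n \<nu> j)) (Poly_Mapping.lookup m (\<pi> j))) = 0"
        by (intro prod_zero) auto
      then show ?thesis by simp
    qed
    then have "alt n (\<lambda>i j. fps_nth (eser n (stair n \<nu> j)) (Poly_Mapping.lookup m i)) = 0"
      unfolding alt_def by (intro sum.neutral) auto
    then show ?thesis unfolding v mcoeff_alt_fps_at[OF keys] .
  qed
  have "mcoeff (ps_of (double_schur_poly n \<nu>)) m = 0" if "mono_deg m > psize \<nu>" for m
    by (rule mcoeff_vdm_mult_deg[of "mono_deg m" n]) (use z that in auto)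
  then show ?thesis unfolding deg_le_ps_of by (meson not_le)
qed (simp add: double_schur_poly_def)

text \<open>At x_n = a_n, with n = \<open>Suc p\<close>, double powers of positive exponent vanish
  in the last row. If the last exponent is 0, the determinant loses its last row and column, and
  each remaining row has a factor x_i - a_n matching one in the Vandermonde product. Otherwise the
  whole last row is zero.\<close>

lemma double_schur_poly_stable:
  "subst (Var(Suc p := Const (a (int (Suc p))))) (double_schur_poly (Suc p) \<nu>) = double_schur_poly p \<nu>"
proof (cases "plength \<nu> \<le> Suc p")
  case True
  let ?n = "Suc p" and ?c = "Const (a (int (Suc p))) :: xpoly"
  let ?\<sigma> = "Var(?n := ?c)"
  let ?s = "subst ?\<sigma> (double_schur_poly ?n \<nu>)"
  let ?A = "\<lambda>i j. \<Prod>k<stair ?n \<nu> j. ?\<sigma> i - Const (a (int ?n - int k))"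
  have st: "stair ?n \<nu> j = Suc (stair p \<nu> j)" if "j \<in> {1..p}" for j
    using that by (auto simp: stair_def)
  have z: "(\<Prod>k<Suc m. ?c - Const (a (int ?n - int k))) = 0" for m
    by (rule prod_zero) (auto intro!: bexI[of _ 0])
  have "vdm ?n ?\<sigma> = vdm p Var * (\<Prod>i\<in>{1..p}. Var i - ?c)"
  proof -
    have "vdm p ?\<sigma> = vdm p Var" by (rule vdm_cong) auto
    moreover have "(\<Prod>i\<in>{1..p}. ?\<sigma> i - ?\<sigma> ?n) = (\<Prod>i\<in>{1..p}. Var i - ?c)"
      by (rule prod.cong) auto
    ultimately show ?thesis by (simp only: vdm_Suc)
  qed
  then have "vdm p Var * (\<Prod>i\<in>{1..p}. Var i - ?c) * ?s = alt ?n ?A"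
    using subst_double_schur_poly[OF True, of ?\<sigma>] by simp
  also have "\<dots> = ?A ?n ?n * alt p ?A"
    by (rule alt_last_row) (simp only: st fun_upd_same z)
  also have "alt p ?A = alt p (\<lambda>i j. (Var i - ?c) * double_power p i (stair p \<nu> j))"
  proof (rule alt_cong)
    fix i j assume ij: "i \<in> {1..p}" "j \<in> {1..p}"
    have "?A i j = double_power ?n i (Suc (stair p \<nu> j))"
      using ij st[of j] by (auto simp: double_power_def)
    then show "?A i j = (Var i - ?c) * double_power p i (stair p \<nu> j)"
      by (simp only: double_power_Suc)
  qed
  also have "\<dots> = (\<Prod>i\<in>{1..p}. Var i - ?c) * alt p (\<lambda>i j. double_power p i (stair p \<nu> j))"
    by (rule alt_scale_rows)
  also have "?A ?n ?n * \<dots> = vdm p Var * (\<Prod>i\<in>{1..p}. Var i - ?c) * double_schur_poly p \<nu>"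
  proof (cases "plength \<nu> \<le> p")
    case True
    then have "stair ?n \<nu> ?n = 0" using part_eq_0_iff[of ?n \<nu>] by (simp add: stair_def)
    with vdm_mult_double_schur_poly[OF True] show ?thesis by (simp add: mult_ac)
  next
    case False
    then have "part \<nu> ?n \<noteq> 0" using part_eq_0_iff[of ?n \<nu>] by simp
    then obtain m where "stair ?n \<nu> ?n = Suc m" by (auto simp: stair_def gr0_conv_Suc)
    then have "?A ?n ?n = 0" by (simp only: fun_upd_same z)
    moreover have "double_schur_poly p \<nu> = 0" using False by (simp add: double_schur_poly_def)
    ultimately show ?thesis by (simp only: mult_zero_left mult_zero_right)
  qed
  finally have "vdm p Var * (\<Prod>i\<in>{1..p}. Var i - ?c) * ?s = vdm p Var * (\<Prod>i\<in>{1..p}. Var i - ?c) * double_schur_poly p \<nu>" .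
  moreover have "(\<Prod>i\<in>{1..p}. Var i - ?c) \<noteq> 0"
  proof -
    have "Var i - ?c \<noteq> 0" for i
    proof
      assume "Var i - ?c = 0"
      then have "Var i = ?c" by simp
      then have "vars (Var i :: xpoly) = vars ?c" by simp
      then show False by simp
    qed
    then show ?thesis by simp
  qed
  ultimately show ?thesis using vdm_Var_nonzero by simp
qed (simp add: double_schur_poly_def)

lemma is_lam_double_schur_poly: "is_lam (\<lambda>n. double_schur_poly n \<nu>)"
  unfolding is_lam_def
proof (intro conjI allI impI)
  show "\<exists>d. \<forall>n. deg_le (double_schur_poly n \<nu>) d" using double_schur_poly_deg by blast
  fix n :: nat assume "n \<ge> 1"
  then obtain p where "n = Suc p" by (cases n) auto
  then show "subst (Var(n := Const (a (int n)))) (double_schur_poly n \<nu>) = double_schur_poly (n - 1) \<nu>"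
    using double_schur_poly_stable by simp
qed (use double_schur_poly_vars double_schur_poly_sym in auto)

lemma lam_seq_double_schur: "lam_seq (double_schur \<nu>) n = double_schur_poly n \<nu>"
  by (simp add: double_schur_def Lam_inverse is_lam_double_schur_poly)

section \<open>Alternating series\<close>

lemma keys_map_key_bij: "bij \<pi> \<Longrightarrow> i \<in> Poly_Mapping.keys (Poly_Mapping.map_key \<pi> m) \<longleftrightarrow> \<pi> i \<in> Poly_Mapping.keys m"
  by (simp add: in_keys_iff lookup_map_key bij_is_inj)

lemma PS_perm_fps_at:
  assumes \<pi>: "bij \<pi>"
  shows "PS_perm \<pi> (fps_at i F) = fps_at (\<pi> i) F"
proof (rule mfps_eqI)
  fix m
  show "mcoeff (PS_perm \<pi> (fps_at i F)) m = mcoeff (fps_at (\<pi> i) F) m"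
  proof (cases "Poly_Mapping.keys m \<subseteq> {\<pi> i}")
    case True
    then have "Poly_Mapping.keys (Poly_Mapping.map_key \<pi> m) \<subseteq> {i}"
      using bij_is_inj[OF \<pi>] by (auto simp: keys_map_key_bij[OF \<pi>] dest: injD)
    with True show ?thesis by (simp add: mcoeff_fps_at lookup_map_key bij_is_inj[OF \<pi>])
  next
    case False
    then obtain j where j: "j \<in> Poly_Mapping.keys m" "j \<noteq> \<pi> i" by auto
    obtain k where "j = \<pi> k" using bij_is_surj[OF \<pi>] by (metis surjD)
    with j have "k \<in> Poly_Mapping.keys (Poly_Mapping.map_key \<pi> m)" "k \<noteq> i"
      by (auto simp: keys_map_key_bij[OF \<pi>])
    then have "\<not> Poly_Mapping.keys (Poly_Mapping.map_key \<pi> m) \<subseteq> {i}" by auto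
    with False show ?thesis by (simp add: mcoeff_fps_at)
  qed
qed

lemma PS_perm_PS_Const: "bij \<pi> \<Longrightarrow> PS_perm \<pi> (PS_Const c) = (PS_Const c :: ('v, 'c::comm_ring_1) mfps)"
  using PS_perm_fps_at[of \<pi> undefined "fps_const c"] by (simp add: fps_at_const)

lemma mono_deg_map_key:
  fixes n :: nat
  assumes \<pi>: "\<pi> permutes {1..n}" and m: "Poly_Mapping.keys m \<subseteq> {1..n}"
  shows "mono_deg (Poly_Mapping.map_key \<pi> m) = mono_deg m"
proof -
  have "Poly_Mapping.keys (Poly_Mapping.map_key \<pi> m) \<subseteq> {1..n}"
  proof
    fix i assume "i \<in> Poly_Mapping.keys (Poly_Mapping.map_key \<pi> m)"
    then have "\<pi> i \<in> {1..n}" using m by (auto simp: keys_map_key_bij[OF permutes_bij[OF \<pi>]])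
    then show "i \<in> {1..n}" using permutes_in_image[OF \<pi>] by simp
  qed
  then have "mono_deg (Poly_Mapping.map_key \<pi> m) = (\<Sum>i\<in>{1..n}. Poly_Mapping.lookup m (\<pi> i))"
    by (subst mono_deg_superset[of "{1..n}"]) (auto simp: lookup_map_key permutes_inj[OF \<pi>])
  also have "\<dots> = (\<Sum>i\<in>{1..n}. Poly_Mapping.lookup m i)"
    using sum.permute[OF \<pi>, of "Poly_Mapping.lookup m"] by (simp add: o_def)
  also have "\<dots> = mono_deg m"
    using m by (subst mono_deg_superset[of "{1..n}"]) auto
  finally show ?thesis .
qed

definition alternating :: "nat \<Rightarrow> (nat, 'c::comm_ring_1) mfps \<Rightarrow> bool"
  where "alternating n A \<longleftrightarrow> PS_restrict {1..n} A = A \<and>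
    (\<forall>\<pi>. \<pi> permutes {1..n} \<longrightarrow> PS_perm \<pi> A = of_int (sign \<pi>) * A)"

lemma of_int_mfps: "(of_int k :: ('v, 'c::comm_ring_1) mfps) = PS_Const (of_int k)"
proof -
  interpret C: comm_ring_hom "PS_Const :: 'c \<Rightarrow> ('v, 'c) mfps" by (rule PS_Const_hom)
  show ?thesis by (simp add: C.hom_of_int)
qed

lemma alternating_diff: "alternating n A \<Longrightarrow> alternating n B \<Longrightarrow> alternating n (A - B)"
  unfolding alternating_def
proof (intro conjI allI impI; elim conjE)
  fix \<pi> :: "nat \<Rightarrow> nat" assume *: "\<pi> permutes {1..n}" "\<forall>\<pi>. \<pi> permutes {1..n} \<longrightarrow> PS_perm \<pi> A = of_int (sign \<pi>) * A"
    "\<forall>\<pi>. \<pi> permutes {1..n} \<longrightarrow> PS_perm \<pi> B = of_int (sign \<pi>) * B"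
  interpret p: comm_ring_hom "PS_perm \<pi> :: (nat, 'a) mfps \<Rightarrow> _" by (rule PS_perm_hom[OF permutes_bij[OF *(1)]])
  show "PS_perm \<pi> (A - B) = of_int (sign \<pi>) * (A - B)"
    using * by (simp add: p.hom_minus right_diff_distrib)
next
  interpret p: comm_ring_hom "PS_restrict {1..n} :: (nat, 'a) mfps \<Rightarrow> _" by (rule PS_restrict_hom)
  assume "PS_restrict {1..n} A = A" "PS_restrict {1..n} B = B"
  then show "PS_restrict {1..n} (A - B) = A - B" by (simp add: p.hom_minus)
qed

lemma alternating_combination:
  assumes "\<And>i. i \<in> I \<Longrightarrow> alternating n (A i)"
  shows "alternating n (\<Sum>i\<in>I. PS_Const (c i) * A i)"
  unfolding alternating_def
proof (intro conjI allI impI)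
  fix \<pi> :: "nat \<Rightarrow> nat" assume \<pi>: "\<pi> permutes {1..n}"
  interpret p: comm_ring_hom "PS_perm \<pi> :: (nat, 'b) mfps \<Rightarrow> _" by (rule PS_perm_hom[OF permutes_bij[OF \<pi>]])
  show "PS_perm \<pi> (\<Sum>i\<in>I. PS_Const (c i) * A i) = of_int (sign \<pi>) * (\<Sum>i\<in>I. PS_Const (c i) * A i)"
    unfolding p.hom_sum p.hom_mult PS_perm_PS_Const[OF permutes_bij[OF \<pi>]] sum_distrib_left
    by (rule sum.cong) (use assms \<pi> in \<open>auto simp: alternating_def mult_ac\<close>)
next
  interpret p: comm_ring_hom "PS_restrict {1..n} :: (nat, 'b) mfps \<Rightarrow> _" by (rule PS_restrict_hom)
  have "PS_restrict {1..n} (PS_Const c) = (PS_Const c :: (nat, 'b) mfps)" for c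
    by (rule mfps_eqI) (auto simp: mcoeff_PS_restrict mcoeff_PS_Const)
  then show "PS_restrict {1..n} (\<Sum>i\<in>I. PS_Const (c i) * A i) = (\<Sum>i\<in>I. PS_Const (c i) * A i)"
    unfolding p.hom_sum p.hom_mult
    by (intro sum.cong) (use assms in \<open>auto simp: alternating_def\<close>)
qed

lemma alternating_alt_fps_at: "alternating n (alt n (\<lambda>i j. fps_at i (F j)))"
  unfolding alternating_def
proof (intro conjI allI impI)
  fix \<pi> :: "nat \<Rightarrow> nat" assume \<pi>: "\<pi> permutes {1..n}"
  interpret p: comm_ring_hom "PS_perm \<pi> :: (nat, 'a) mfps \<Rightarrow> _" by (rule PS_perm_hom[OF permutes_bij[OF \<pi>]])
  show "PS_perm \<pi> (alt n (\<lambda>i j. fps_at i (F j))) = of_int (sign \<pi>) * alt n (\<lambda>i j. fps_at i (F j))"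
    unfolding p.hom_alt PS_perm_fps_at[OF permutes_bij[OF \<pi>]]
    by (rule alt_permute_rows[OF \<pi>, of "\<lambda>i j. fps_at i (F j)"])
next
  show "PS_restrict {1..n} (alt n (\<lambda>i j. fps_at i (F j))) = alt n (\<lambda>i j. fps_at i (F j))"
    by (rule mfps_eqI) (auto simp: mcoeff_PS_restrict mcoeff_alt_fps_at_outside)
qed

lemma alternating_vdm_mult:
  assumes "PS_restrict {1..n} F = F" "\<And>\<pi>. \<pi> permutes {1..n} \<Longrightarrow> PS_perm \<pi> F = F"
  shows "alternating n (vdm n PS_Var * F)"
  unfolding alternating_def
proof (intro conjI allI impI)
  fix \<pi> :: "nat \<Rightarrow> nat" assume \<pi>: "\<pi> permutes {1..n}"
  interpret p: comm_ring_hom "PS_perm \<pi> :: (nat, 'a) mfps \<Rightarrow> _" by (rule PS_perm_hom[OF permutes_bij[OF \<pi>]])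
  show "PS_perm \<pi> (vdm n PS_Var * F) = of_int (sign \<pi>) * (vdm n PS_Var * F)"
    unfolding p.hom_mult p.hom_vdm PS_perm_PS_Var[OF permutes_bij[OF \<pi>]] assms(2)[OF \<pi>]
    unfolding vdm_permute[OF \<pi>, of PS_Var] by (simp add: mult.assoc)
next
  interpret p: comm_ring_hom "PS_restrict {1..n} :: (nat, 'a) mfps \<Rightarrow> _" by (rule PS_restrict_hom)
  show "PS_restrict {1..n} (vdm n PS_Var * F) = vdm n PS_Var * F"
    by (simp only: p.hom_mult PS_restrict_vdm assms)
qed

text \<open>Two equal exponents would make the coefficient its own negative, hence zero in
  characteristic 0. Distinct exponents are sorted into a staircase by a permutation, at the cost of
  a sign. So an alternating series is determined by its staircase coefficients.\<close>

lemma alternating_coeff: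
  fixes A :: "(nat, 'c::{idom,ring_char_0}) mfps"
  assumes A: "alternating n A" and nz: "mcoeff A m \<noteq> 0"
  obtains \<nu> where "plength \<nu> \<le> n" "mono_deg m = psize \<nu> + tri n" "mcoeff A (mono_of n (stair n \<nu>)) \<noteq> 0"
proof -
  have keys: "Poly_Mapping.keys m \<subseteq> {1..n}"
  proof (rule ccontr)
    assume "\<not> ?thesis"
    then have "mcoeff (PS_restrict {1..n} A) m = 0" by (simp add: mcoeff_PS_restrict)
    with A nz show False by (simp add: alternating_def)
  qed
  have perm: "mcoeff A (Poly_Mapping.map_key \<pi> m) = of_int (sign \<pi>) * mcoeff A m" if "\<pi> permutes {1..n}" for \<pi>
  proof -
    have "PS_perm \<pi> A = PS_Const (of_int (sign \<pi>)) * A"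
      using A that unfolding alternating_def of_int_mfps by blast
    then have "mcoeff (PS_perm \<pi> A) m = mcoeff (PS_Const (of_int (sign \<pi>)) * A) m" by (rule arg_cong)
    then show ?thesis by simp
  qed
  have "inj_on (Poly_Mapping.lookup m) {1..n}"
  proof (rule inj_onI, rule ccontr)
    fix i j assume ij: "i \<in> {1..n}" "j \<in> {1..n}" "Poly_Mapping.lookup m i = Poly_Mapping.lookup m j" "i \<noteq> j"
    let ?\<tau> = "Transposition.transpose i j"
    have \<tau>: "?\<tau> permutes {1..n}" using ij by (intro permutes_swap_id)
    have "Poly_Mapping.map_key ?\<tau> m = m"
      by (rule poly_mapping_eqI) (use ij in \<open>auto simp: lookup_map_key permutes_inj[OF \<tau>] Transposition.transpose_def\<close>)
    then have "mcoeff A m = - mcoeff A m" using perm[OF \<tau>] ij by (simp add: sign_swap_id)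
    then have "2 * mcoeff A m = 0" by (metis add.right_inverse mult_2)
    with nz show False by simp
  qed
  from stair_exists[OF this] obtain \<nu> \<pi> where \<nu>: "plength \<nu> \<le> n" and \<pi>: "\<pi> permutes {1..n}"
    and st: "\<And>j. j \<in> {1..n} \<Longrightarrow> Poly_Mapping.lookup m (\<pi> j) = stair n \<nu> j" by blast
  have eq: "Poly_Mapping.map_key \<pi> m = mono_of n (stair n \<nu>)"
  proof (rule poly_mapping_eqI)
    fix j
    show "Poly_Mapping.lookup (Poly_Mapping.map_key \<pi> m) j = Poly_Mapping.lookup (mono_of n (stair n \<nu>)) j"
    proof (cases "j \<in> {1..n}")
      case True
      then show ?thesis by (simp only: lookup_map_key[OF permutes_inj[OF \<pi>]] lookup_mono_of st if_True)
    next
      case False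
      then have "\<pi> j = j" "Poly_Mapping.lookup m j = 0"
        using \<pi> keys by (auto simp: permutes_def in_keys_iff)
      then show ?thesis
        unfolding lookup_map_key[OF permutes_inj[OF \<pi>]] lookup_mono_of if_not_P[OF False] by simp
    qed
  qed
  show thesis
  proof (rule that[OF \<nu>])
    show "mono_deg m = psize \<nu> + tri n"
      using mono_deg_map_key[OF \<pi> keys] by (simp add: eq mono_deg_mono_of sum_stair[OF \<nu>])
    show "mcoeff A (mono_of n (stair n \<nu>)) \<noteq> 0"
      using perm[OF \<pi>] nz unfolding eq by (simp add: sign_def)
  qed
qed

section \<open>Expansion of symmetric polynomials in double Schur polynomials\<close>

definition ealt :: "nat \<Rightarrow> partition \<Rightarrow> xseries"
  where "ealt n \<nu> = alt n (\<lambda>i j. fps_at i (eser n (stair n \<nu> j)))"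

lemma vdm_mult_ps_of_double_schur_poly:
  assumes "plength \<nu> \<le> n"
  shows "vdm n PS_Var * ps_of (double_schur_poly n \<nu>) = ealt n \<nu>"
proof -
  interpret p: comm_ring_hom "ps_of :: xpoly \<Rightarrow> xseries" by (rule ps_of_hom)
  show ?thesis
    using arg_cong[OF vdm_mult_double_schur_poly[OF assms], of ps_of]
    by (simp add: ealt_def p.hom_mult ps_of_vdm p.hom_alt ps_of_double_power)
qed

lemma ealt_deg:
  assumes "plength \<nu> \<le> n" "mono_deg m > psize \<nu> + tri n"
  shows "mcoeff (ealt n \<nu>) m = 0"
proof -
  have "mcoeff (vdm n PS_Var) u * mcoeff (ps_of (double_schur_poly n \<nu>)) v = 0" if "u + v = m" for u v
  proof (rule ccontr)
    assume nz: "mcoeff (vdm n PS_Var) u * mcoeff (ps_of (double_schur_poly n \<nu>)) v \<noteq> 0"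
    then have "mcoeff (vdm n PS_Var :: xseries) u \<noteq> 0" "mcoeff (ps_of (double_schur_poly n \<nu>)) v \<noteq> 0" by auto
    then have "mono_deg u = tri n" "mono_deg v \<le> psize \<nu>"
      using homogeneous_vdm[of n, where 'c = qa] double_schur_poly_deg[of n \<nu>]
      unfolding homogeneous_def deg_le_ps_of by auto
    with that assms(2) show False by (auto simp: mono_deg_add)
  qed
  then show ?thesis
    unfolding vdm_mult_ps_of_double_schur_poly[OF assms(1), symmetric] by (intro mcoeff_mult_eq_0)
qed

lemma ealt_triangular:
  assumes "plength \<nu> \<le> n" "plength \<mu> \<le> n" "psize \<nu> \<le> psize \<mu>"
  shows "mcoeff (ealt n \<nu>) (mono_of n (stair n \<mu>)) = (if \<nu> = \<mu> then 1 else 0)"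
proof -
  have "mcoeff (ealt n \<nu>) (mono_of n (stair n \<mu>)) =
      alt n (\<lambda>i j. fps_nth (eser n (stair n \<nu> j)) (Poly_Mapping.lookup (mono_of n (stair n \<mu>)) i))"
    unfolding ealt_def by (rule mcoeff_alt_fps_at[OF keys_mono_of])
  also have "\<dots> = alt n (\<lambda>i j. fps_nth (eser n (stair n \<nu> j)) (stair n \<mu> i))"
    by (rule alt_cong) (simp add: lookup_mono_of)
  also have "\<dots> = alt n (\<lambda>i j. fps_nth (eser n (stair n \<nu> i)) (stair n \<mu> j))"
    by (rule alt_transpose)
  also have "\<dots> = (if \<nu> = \<mu> then 1 else 0)"
    by (rule alt_stair_triangular[of "\<lambda>k b. fps_nth (eser n b) k"]) (use assms in \<open>auto simp: eser_nth\<close>)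
  finally show ?thesis .
qed

text \<open>The component of highest degree is removed first. In that degree the staircase
  coefficients are dual to the alternants by \<open>ealt_triangular\<close>, and the subtracted
  alternants reach no higher degree.\<close>

lemma alternating_polynomial_expansion:
  assumes "alternating n A" "\<And>m. mono_deg m \<ge> D + tri n \<Longrightarrow> mcoeff A m = 0"
  shows "\<exists>c. A = (\<Sum>\<nu> | psize \<nu> < D \<and> plength \<nu> \<le> n. PS_Const (c \<nu>) * ealt n \<nu>)"
  using assms
proof (induction D arbitrary: A)
  case 0
  have "A = 0"
  proof (rule mfps_eqI)
    fix m show "mcoeff A m = mcoeff 0 m"
    proof (rule ccontr)
      assume "mcoeff A m \<noteq> mcoeff 0 m"
      then have nz: "mcoeff A m \<noteq> 0" by simp
      with "0.prems"(1) obtain \<nu> where "mono_deg m = psize \<nu> + tri n" by (rule alternating_coeff)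
      with "0.prems"(2)[of m] nz show False by simp
    qed
  qed
  then show ?case by simp
next
  case (Suc D)
  let ?S = "{\<nu>. psize \<nu> = D \<and> plength \<nu> \<le> n}" and ?T = "{\<nu>. psize \<nu> < D \<and> plength \<nu> \<le> n}"
  \<comment> \<open>The staircase coefficients; they are used only for partitions of size
    \<open>D\<close>, where they lie in the highest degree D + n (n - 1) / 2.\<close>
  define b where "b = (\<lambda>\<nu>. mcoeff A (mono_of n (stair n \<nu>)))"
  define A' where "A' = A - (\<Sum>\<nu>\<in>?S. PS_Const (b \<nu>) * ealt n \<nu>)"
  have fin: "finite ?S" "finite ?T"
    by (rule finite_subset[OF _ finite_psize[of D]]; auto)+
  have alt': "alternating n A'"
    unfolding A'_def
    by (intro alternating_diff alternating_combination Suc.prems(1)) (simp add: ealt_def alternating_alt_fps_at)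
  have "mcoeff A' m = 0" if m: "mono_deg m \<ge> D + tri n" for m
  proof (rule ccontr)
    assume nz: "mcoeff A' m \<noteq> 0"
    show False
    proof (cases "mono_deg m = D + tri n")
      case True
      from alt' nz obtain \<mu> where \<mu>: "plength \<mu> \<le> n" "mono_deg m = psize \<mu> + tri n"
        and nz': "mcoeff A' (mono_of n (stair n \<mu>)) \<noteq> 0" by (rule alternating_coeff)
      have "mcoeff A' (mono_of n (stair n \<mu>)) = b \<mu> - (\<Sum>\<nu>\<in>?S. if \<nu> = \<mu> then b \<nu> else 0)"
        unfolding A'_def mcoeff_diff mcoeff_sum mcoeff_PS_Const_mult
        by (intro arg_cong2[where f = minus] sum.cong) (use \<mu> True in \<open>auto simp: b_def ealt_triangular\<close>)
      also have "\<dots> = 0" using \<mu> True fin by simp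
      finally show False using nz' by simp
    next
      case False
      with m have gt: "mono_deg m \<ge> Suc D + tri n" by simp
      have "mcoeff A' m = 0"
        unfolding A'_def mcoeff_diff mcoeff_sum mcoeff_PS_Const_mult
        using Suc.prems(2)[OF gt] gt by (auto intro!: sum.neutral ealt_deg)
      with nz show False by simp
    qed
  qed
  with Suc.IH[OF alt'] obtain c where c: "A' = (\<Sum>\<nu>\<in>?T. PS_Const (c \<nu>) * ealt n \<nu>)" by blast
  have "A = (\<Sum>\<nu>\<in>?S. PS_Const (b \<nu>) * ealt n \<nu>) + (\<Sum>\<nu>\<in>?T. PS_Const (c \<nu>) * ealt n \<nu>)"
    unfolding c[symmetric] A'_def by simp
  also have "\<dots> = (\<Sum>\<nu>\<in>?S. PS_Const (if psize \<nu> = D then b \<nu> else c \<nu>) * ealt n \<nu>) +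
      (\<Sum>\<nu>\<in>?T. PS_Const (if psize \<nu> = D then b \<nu> else c \<nu>) * ealt n \<nu>)"
    by (intro arg_cong2[where f = plus] sum.cong) auto
  also have "\<dots> = (\<Sum>\<nu>\<in>?S \<union> ?T. PS_Const (if psize \<nu> = D then b \<nu> else c \<nu>) * ealt n \<nu>)"
    by (rule sum.union_disjoint[symmetric]) (use fin in auto)
  also have "?S \<union> ?T = {\<nu>. psize \<nu> < Suc D \<and> plength \<nu> \<le> n}" by auto
  finally show ?case by (intro exI[of _ "\<lambda>\<nu>. if psize \<nu> = D then b \<nu> else c \<nu>"])
qed

lemma mono_eval_Var: "mono_eval Var m = Poly_Mapping.single m (1 :: 'c::comm_ring_1)"
proof (induction m rule: poly_mapping_single_add_induct)
  case zero
  then show ?case by (simp add: single_one)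
next
  case (add m i k)
  have "Var i ^ k = (Poly_Mapping.single (Poly_Mapping.single i k) 1 :: ('a, 'c) mpoly)"
    by (induction k) (simp_all add: Var_def mult_single single_one plus_1_eq_Suc flip: single_add)
  then have "mono_eval Var (Poly_Mapping.single i k) = (Poly_Mapping.single (Poly_Mapping.single i k) 1 :: ('a, 'c) mpoly)"
    by (cases "k = 0") (simp_all add: mono_eval_def)
  with add show ?case by (simp add: mono_eval_add mult_single)
qed

text \<open>Presents a polynomial as a sum of products of variables and constants, to which ring
  homomorphisms can be applied.\<close>

lemma subst_Var_id: "subst Var p = p"
proof (induction p rule: poly_mapping_single_add_induct)
  case (add p m c)
  then show ?case
    by (simp add: subst_add subst_single mono_eval_Var Const_def mult_single)
qed simp

lemma PS_perm_ps_of: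
  assumes \<pi>: "bij \<pi>"
  shows "PS_perm \<pi> (ps_of p) = ps_of (subst (\<lambda>i. Var (\<pi> i)) (p :: ('v, 'c::comm_ring_1) mpoly))"
proof -
  interpret s: comm_ring_hom "ps_of :: ('v, 'c) mpoly \<Rightarrow> _" by (rule ps_of_hom)
  interpret p: comm_ring_hom "PS_perm \<pi> :: ('v, 'c) mfps \<Rightarrow> _" by (rule PS_perm_hom[OF \<pi>])
  have "PS_perm \<pi> (ps_of p) = PS_perm \<pi> (ps_of (subst Var p))" by (simp add: subst_Var_id)
  also have "\<dots> = ps_of (subst (\<lambda>i. Var (\<pi> i)) p)"
    unfolding subst_def mono_eval_def
    by (simp add: s.hom_sum s.hom_mult s.hom_prod s.hom_power p.hom_sum p.hom_mult p.hom_prod p.hom_power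
        ps_of_Const ps_of_Var PS_perm_PS_Const[OF \<pi>] PS_perm_PS_Var[OF \<pi>])
  finally show ?thesis .
qed

lemma PS_restrict_ps_of: "vars p \<subseteq> A \<Longrightarrow> PS_restrict A (ps_of p) = ps_of p"
proof (rule mfps_eqI)
  fix m assume "vars p \<subseteq> A"
  then have "Poly_Mapping.keys m \<subseteq> A" if "m \<in> Poly_Mapping.keys p"
    using that unfolding vars_def by blast
  then show "mcoeff (PS_restrict A (ps_of p)) m = mcoeff (ps_of p) m"
    by (auto simp: mcoeff_PS_restrict in_keys_iff)
qed

text \<open>Multiplication by the Vandermonde product turns a symmetric polynomial of degree at most
  \<open>d\<close> into an alternating one of degree at most d + n (n - 1) / 2.\<close>

lemma symmetric_polynomial_expansion:
  assumes "vars p \<subseteq> {1..n}" "\<And>\<pi>. \<pi> permutes {1..n} \<Longrightarrow> subst (\<lambda>i. Var (\<pi> i)) p = p" "deg_le p d"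
  shows "\<exists>c. p = (\<Sum>\<nu> | psize \<nu> \<le> d \<and> plength \<nu> \<le> n. Const (c \<nu>) * double_schur_poly n \<nu>)"
proof -
  interpret s: comm_ring_hom "ps_of :: xpoly \<Rightarrow> xseries" by (rule ps_of_hom)
  let ?A = "vdm n PS_Var * ps_of p"
  have "alternating n ?A"
    using assms(1,2) by (intro alternating_vdm_mult)
      (auto simp: PS_restrict_ps_of PS_perm_ps_of[OF permutes_bij])
  moreover have "mcoeff ?A m = 0" if m: "mono_deg m \<ge> Suc d + tri n" for m
  proof (rule mcoeff_mult_eq_0, rule ccontr)
    fix u v assume uv: "u + v = m" and "mcoeff (vdm n PS_Var) u * mcoeff (ps_of p) v \<noteq> 0"
    then have "mcoeff (vdm n PS_Var :: xseries) u \<noteq> 0" "mcoeff (ps_of p) v \<noteq> 0" by auto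
    then have "mono_deg u = tri n" "mono_deg v \<le> d"
      using homogeneous_vdm[of n, where 'c = qa] assms(3)
      unfolding homogeneous_def deg_le_ps_of by auto
    with uv m show False by (auto simp: mono_deg_add)
  qed
  ultimately obtain c where "?A = (\<Sum>\<nu> | psize \<nu> < Suc d \<and> plength \<nu> \<le> n. PS_Const (c \<nu>) * ealt n \<nu>)"
    using alternating_polynomial_expansion[of n ?A "Suc d"] by blast
  also have "\<dots> = (\<Sum>\<nu> | psize \<nu> \<le> d \<and> plength \<nu> \<le> n. PS_Const (c \<nu>) * (vdm n PS_Var * ps_of (double_schur_poly n \<nu>)))"
    by (rule sum.cong) (auto simp: vdm_mult_ps_of_double_schur_poly)
  also have "\<dots> = vdm n PS_Var * ps_of (\<Sum>\<nu> | psize \<nu> \<le> d \<and> plength \<nu> \<le> n. Const (c \<nu>) * double_schur_poly n \<nu>)"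
    by (simp add: s.hom_sum s.hom_mult ps_of_Const sum_distrib_left mult.left_commute)
  finally have "ps_of p = ps_of (\<Sum>\<nu> | psize \<nu> \<le> d \<and> plength \<nu> \<le> n. Const (c \<nu>) * double_schur_poly n \<nu>)"
    by (rule vdm_PS_Var_cancel_eq)
  then show ?thesis unfolding ps_of_inject by (intro exI[of _ c])
qed

text \<open>Among the partitions with nonzero coefficient take one of maximal size; its staircase
  monomial sees no other term of the sum.\<close>

lemma double_schur_poly_independent:
  assumes fin: "finite S" and len: "\<And>\<nu>. \<nu> \<in> S \<Longrightarrow> plength \<nu> \<le> n"
    and zero: "(\<Sum>\<nu>\<in>S. Const (c \<nu>) * double_schur_poly n \<nu>) = 0" and \<nu>: "\<nu> \<in> S"
  shows "c \<nu> = 0"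
proof (rule ccontr)
  interpret s: comm_ring_hom "ps_of :: xpoly \<Rightarrow> xseries" by (rule ps_of_hom)
  assume nz: "c \<nu> \<noteq> 0"
  let ?T = "{\<nu> \<in> S. c \<nu> \<noteq> 0}"
  have T: "finite ?T" "?T \<noteq> {}" using fin \<nu> nz by auto
  have "Max (psize ` ?T) \<in> psize ` ?T" using T by (intro Max_in) auto
  then obtain \<mu> where \<mu>: "\<mu> \<in> ?T" and \<mu>_max: "psize \<mu> = Max (psize ` ?T)" by auto
  have max: "psize \<kappa> \<le> psize \<mu>" if "\<kappa> \<in> ?T" for \<kappa>
    unfolding \<mu>_max using T that by (intro Max_ge) auto
  have "(\<Sum>\<kappa>\<in>S. PS_Const (c \<kappa>) * ealt n \<kappa>) = vdm n PS_Var * ps_of (\<Sum>\<nu>\<in>S. Const (c \<nu>) * double_schur_poly n \<nu>)"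
    unfolding s.hom_sum s.hom_mult ps_of_Const sum_distrib_left
    by (rule sum.cong) (simp_all add: vdm_mult_ps_of_double_schur_poly[OF len, symmetric] mult.left_commute)
  also have "\<dots> = 0" by (simp add: zero)
  finally have "mcoeff (\<Sum>\<kappa>\<in>S. PS_Const (c \<kappa>) * ealt n \<kappa>) (mono_of n (stair n \<mu>)) = 0"
    by (simp only: mcoeff_0)
  then have "(\<Sum>\<kappa>\<in>S. c \<kappa> * mcoeff (ealt n \<kappa>) (mono_of n (stair n \<mu>))) = 0"
    by (simp only: mcoeff_sum mcoeff_PS_Const_mult)
  moreover have "(\<Sum>\<kappa>\<in>S. c \<kappa> * mcoeff (ealt n \<kappa>) (mono_of n (stair n \<mu>))) = (\<Sum>\<kappa>\<in>S. if \<kappa> = \<mu> then c \<kappa> else 0)"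
  proof (rule sum.cong[OF refl])
    fix \<kappa> assume "\<kappa> \<in> S"
    then show "c \<kappa> * mcoeff (ealt n \<kappa>) (mono_of n (stair n \<mu>)) = (if \<kappa> = \<mu> then c \<kappa> else 0)"
      using max[of \<kappa>] \<mu> len by (cases "c \<kappa> = 0") (auto simp: ealt_triangular)
  qed
  ultimately show False using \<mu> fin by simp
qed

section \<open>The basis of double Schur functions\<close>

lemma lam_eqI: "(\<And>n. lam_seq P n = lam_seq Q n) \<Longrightarrow> P = Q"
  by (simp add: lam_seq_inject[symmetric] fun_eq_iff)

lemma lam_seq_hom: "comm_ring_hom (\<lambda>P. lam_seq P n)"
  by (rule comm_ring_homI) (simp_all add: one_lam.rep_eq plus_lam.rep_eq times_lam.rep_eq)

lemma lam_seq_lam_const: "lam_seq (lam_const c) n = Const c"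
  by (simp add: lam_const.rep_eq)

lemma lam_const_hom: "comm_ring_hom lam_const"
  by (rule comm_ring_homI)
    (auto intro!: lam_eqI simp: lam_const.rep_eq one_lam.rep_eq plus_lam.rep_eq times_lam.rep_eq Const_add Const_mult)

interpretation lam_seq: comm_ring_hom "\<lambda>P. lam_seq P n" for n by (rule lam_seq_hom)
interpretation lam_const: comm_ring_hom lam_const by (rule lam_const_hom)

lemma lam_seq_stable: "lam_seq P p = subst (Var(Suc p := Const (a (int (Suc p))))) (lam_seq P (Suc p))"
proof -
  have "is_lam (lam_seq P)" using lam_seq[of P] by simp
  then show ?thesis unfolding is_lam_def by (metis diff_Suc_1 le_add1 plus_1_eq_Suc)
qed

lemma lam_seq_sym: "\<pi> permutes {1..n} \<Longrightarrow> subst (\<lambda>i. Var (\<pi> i)) (lam_seq P n) = lam_seq P n"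
  using lam_seq[of P] by (simp add: is_lam_def)

lemma lam_seq_vars: "vars (lam_seq P n) \<subseteq> {1..n}"
  using lam_seq[of P] unfolding is_lam_def mem_Collect_eq by blast

definition lam_deg :: "lam \<Rightarrow> nat \<Rightarrow> bool"
  where "lam_deg P d \<longleftrightarrow> (\<forall>n. deg_le (lam_seq P n) d)"

lemma lam_deg_exists: "\<exists>d. lam_deg P d"
  using lam_seq[of P] unfolding is_lam_def mem_Collect_eq lam_deg_def by blast

lemma lam_deg_mono: "lam_deg P d \<Longrightarrow> d \<le> e \<Longrightarrow> lam_deg P e"
  unfolding lam_deg_def using deg_le_mono by blast

lemma lam_seq_combination:
  "lam_seq (\<Sum>\<nu>\<in>S. lam_const (c \<nu>) * double_schur \<nu>) n = (\<Sum>\<nu>\<in>S. Const (c \<nu>) * double_schur_poly n \<nu>)"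
  unfolding lam_seq.hom_sum lam_seq.hom_mult lam_seq_lam_const lam_seq_double_schur ..

lemma lam_deg_combination:
  assumes "\<And>\<nu>. \<nu> \<in> S \<Longrightarrow> psize \<nu> \<le> d"
  shows "lam_deg (\<Sum>\<nu>\<in>S. lam_const (c \<nu>) * double_schur \<nu>) d"
  unfolding lam_deg_def lam_seq_combination
proof (intro allI deg_le_sum)
  fix n \<nu> assume "\<nu> \<in> S"
  then have "deg_le (double_schur_poly n \<nu>) d"
    by (intro deg_le_mono[OF double_schur_poly_deg assms])
  then show "deg_le (Const (c \<nu>) * double_schur_poly n \<nu>) d"
    using deg_le_mult[OF deg_le_Const[of "c \<nu>" 0]] by fastforce
qed

text \<open>Expansions are known only level by level. At level \<open>d\<close> no partition of size
  at most \<open>d\<close> is lost, so an element of degree at most \<open>d\<close> that vanishes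
  there vanishes above by independence and below by stability. Apply this to the error of the
  expansion found at level \<open>d\<close>.\<close>

lemma double_schur_span:
  assumes P: "lam_deg P d"
  shows "\<exists>c. P = (\<Sum>\<nu> | psize \<nu> \<le> d. lam_const (c \<nu>) * double_schur \<nu>)"
proof -
  have S: "{\<nu>. psize \<nu> \<le> d \<and> plength \<nu> \<le> m} = {\<nu>. psize \<nu> \<le> d}" if "d \<le> m" for m
    using plength_le_psize that by (auto intro: order_trans)
  have level: "\<exists>c. lam_seq Q m = (\<Sum>\<nu> | psize \<nu> \<le> d. Const (c \<nu>) * double_schur_poly m \<nu>)"
    if "lam_deg Q d" "d \<le> m" for Q m
  proof -
    have "deg_le (lam_seq Q m) d" using that(1) by (simp add: lam_deg_def)
    from symmetric_polynomial_expansion[OF lam_seq_vars lam_seq_sym this] show ?thesis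
      unfolding S[OF that(2)] .
  qed
  obtain c where c: "lam_seq P d = (\<Sum>\<nu> | psize \<nu> \<le> d. Const (c \<nu>) * double_schur_poly d \<nu>)"
    using level[OF P order_refl] by blast
  define Q where "Q = P - (\<Sum>\<nu> | psize \<nu> \<le> d. lam_const (c \<nu>) * double_schur \<nu>)"
  have Q: "lam_deg Q d"
    using P lam_deg_combination[of "{\<nu>. psize \<nu> \<le> d}" d c]
    by (simp add: lam_deg_def Q_def lam_seq.hom_minus deg_le_diff)
  have Qd: "lam_seq Q d = 0"
    by (simp only: Q_def lam_seq.hom_minus lam_seq_combination c diff_self)
  have up: "lam_seq Q (d + k) = 0" for k
  proof (induction k)
    case (Suc k)
    obtain b where b: "lam_seq Q (Suc (d + k)) = (\<Sum>\<nu> | psize \<nu> \<le> d. Const (b \<nu>) * double_schur_poly (Suc (d + k)) \<nu>)"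
      using level[OF Q, of "Suc (d + k)"] by auto
    \<comment> \<open>Stability turns the expansion one level up into an expansion of zero with the
      same coefficients.\<close>
    have "(\<Sum>\<nu> | psize \<nu> \<le> d. Const (b \<nu>) * double_schur_poly (d + k) \<nu>) = lam_seq Q (d + k)"
      unfolding lam_seq_stable[of Q "d + k"] b subst_sum subst_mult subst_Const double_schur_poly_stable ..
    then have z: "(\<Sum>\<nu>\<in>{\<nu>. psize \<nu> \<le> d}. Const (b \<nu>) * double_schur_poly (d + k) \<nu>) = 0"
      using Suc by simp
    have "b \<nu> = 0" if "psize \<nu> \<le> d" for \<nu>
      by (rule double_schur_poly_independent[OF finite_psize _ z])
        (use that plength_le_psize in \<open>auto intro: order_trans trans_le_add1\<close>)
    then have "lam_seq Q (Suc (d + k)) = 0" unfolding b by simp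
    then show ?case by simp
  qed (simp add: Qd)
  have "lam_seq Q m = 0" for m
  proof (cases "d \<le> m")
    case True
    then show ?thesis using up[of "m - d"] by simp
  next
    case False
    then have "m \<le> d" by simp
    then show ?thesis
    proof (induction rule: inc_induct)
      case (step n)
      then show ?case by (simp add: lam_seq_stable[of Q n])
    qed (rule Qd)
  qed
  then have "Q = 0" by (intro lam_eqI) (simp add: lam_seq.hom_zero)
  then show ?thesis unfolding Q_def by (intro exI[of _ c]) simp
qed

lemma double_schur_independent:
  assumes "finite S" "(\<Sum>\<nu>\<in>S. lam_const (c \<nu>) * double_schur \<nu>) = 0" "\<nu> \<in> S"
  shows "c \<nu> = 0"
proof (rule double_schur_poly_independent[OF assms(1) _ _ assms(3)])
  let ?n = "\<Sum>\<nu>\<in>S. plength \<nu>"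
  show "plength \<mu> \<le> ?n" if "\<mu> \<in> S" for \<mu>
    using assms(1) that by (intro member_le_sum) auto
  show "(\<Sum>\<nu>\<in>S. Const (c \<nu>) * double_schur_poly ?n \<nu>) = 0"
    unfolding lam_seq_combination[symmetric] assms(2) by (rule lam_seq.hom_zero)
qed

section \<open>Coefficients in the basis of double Schur functions\<close>

definition lam_coeffs :: "lam \<Rightarrow> partition \<Rightarrow> qa"
  where "lam_coeffs P = (SOME c. \<exists>S. finite S \<and> (\<forall>\<nu>. \<nu> \<notin> S \<longrightarrow> c \<nu> = 0) \<and>
    P = (\<Sum>\<nu>\<in>S. lam_const (c \<nu>) * double_schur \<nu>))"

definition coef :: "partition \<Rightarrow> lam \<Rightarrow> qa" where "coef \<nu> P = lam_coeffs P \<nu>"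

lemma combination_superset:
  assumes "finite T" "S \<subseteq> T" "\<And>\<nu>. \<nu> \<notin> S \<Longrightarrow> c \<nu> = 0"
  shows "(\<Sum>\<nu>\<in>S. lam_const (c \<nu>) * double_schur \<nu>) = (\<Sum>\<nu>\<in>T. lam_const (c \<nu>) * double_schur \<nu>)"
  by (rule sum.mono_neutral_left) (use assms in \<open>auto simp: lam_const.hom_zero\<close>)

lemma coef_eq:
  assumes "finite S" "P = (\<Sum>\<nu>\<in>S. lam_const (c \<nu>) * double_schur \<nu>)"
  shows "coef \<nu> P = (if \<nu> \<in> S then c \<nu> else 0)"
proof -
  define c' where "c' = (\<lambda>\<nu>. if \<nu> \<in> S then c \<nu> else 0)"
  have P: "P = (\<Sum>\<nu>\<in>S. lam_const (c' \<nu>) * double_schur \<nu>)"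
    unfolding assms(2) by (rule sum.cong) (auto simp: c'_def)
  have "\<exists>c S. finite S \<and> (\<forall>\<nu>. \<nu> \<notin> S \<longrightarrow> c \<nu> = 0) \<and> P = (\<Sum>\<nu>\<in>S. lam_const (c \<nu>) * double_schur \<nu>)"
    by (rule exI[of _ c'], rule exI[of _ S]) (use assms(1) P in \<open>auto simp: c'_def\<close>)
  from someI_ex[OF this] obtain T where T: "finite T" "\<And>\<nu>. \<nu> \<notin> T \<Longrightarrow> lam_coeffs P \<nu> = 0"
    "P = (\<Sum>\<nu>\<in>T. lam_const (lam_coeffs P \<nu>) * double_schur \<nu>)"
    unfolding lam_coeffs_def[symmetric] by blast
  have fin: "finite (S \<union> T)" using assms(1) T(1) by simp
  have "P = (\<Sum>\<nu>\<in>S \<union> T. lam_const (lam_coeffs P \<nu>) * double_schur \<nu>)"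
    using combination_superset[OF fin, of T "lam_coeffs P"] T(2,3) by simp
  moreover have "P = (\<Sum>\<nu>\<in>S \<union> T. lam_const (c' \<nu>) * double_schur \<nu>)"
    using combination_superset[OF fin, of S c'] P by (simp add: c'_def)
  ultimately have "(\<Sum>\<nu>\<in>S \<union> T. lam_const (lam_coeffs P \<nu>) * double_schur \<nu>) = (\<Sum>\<nu>\<in>S \<union> T. lam_const (c' \<nu>) * double_schur \<nu>)"
    by simp
  then have z: "(\<Sum>\<nu>\<in>S \<union> T. lam_const (lam_coeffs P \<nu> - c' \<nu>) * double_schur \<nu>) = 0"
    by (simp add: lam_const.hom_minus left_diff_distrib sum_subtractf)
  show ?thesis
  proof (cases "\<nu> \<in> S \<union> T")
    case True
    then show ?thesis using double_schur_independent[OF fin z True] by (simp add: coef_def c'_def)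
  next
    case False
    then show ?thesis using T(2) by (simp add: coef_def)
  qed
qed

lemma coef_expansion:
  assumes "lam_deg P d"
  shows "P = (\<Sum>\<nu> | psize \<nu> \<le> d. lam_const (coef \<nu> P) * double_schur \<nu>)"
proof -
  obtain c where c: "P = (\<Sum>\<nu> | psize \<nu> \<le> d. lam_const (c \<nu>) * double_schur \<nu>)"
    using double_schur_span[OF assms] by blast
  have "(\<Sum>\<nu> | psize \<nu> \<le> d. lam_const (coef \<nu> P) * double_schur \<nu>) = (\<Sum>\<nu> | psize \<nu> \<le> d. lam_const (c \<nu>) * double_schur \<nu>)"
    by (rule sum.cong) (simp_all add: coef_eq[OF finite_psize c])
  with c show ?thesis by simp
qed

lemma coef_eq_0:
  assumes "lam_deg P d" "psize \<nu> > d"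
  shows "coef \<nu> P = 0"
proof -
  have "coef \<nu> P = (if \<nu> \<in> {\<nu>. psize \<nu> \<le> d} then coef \<nu> P else 0)"
    by (rule coef_eq[OF finite_psize coef_expansion[OF assms(1)]])
  also have "\<dots> = 0" using assms(2) by simp
  finally show ?thesis .
qed

lemma coef_double_schur: "coef \<nu> (double_schur \<mu>) = (if \<nu> = \<mu> then 1 else 0)"
  by (subst coef_eq[of "{\<mu>}" _ "\<lambda>_. 1"]) (auto simp: lam_const.hom_one)

lemma coef_add: "coef \<nu> (P + Q) = coef \<nu> P + coef \<nu> Q"
proof -
  obtain d e where "lam_deg P d" "lam_deg Q e" using lam_deg_exists by metis
  then have d: "lam_deg P (max d e)" "lam_deg Q (max d e)" using lam_deg_mono by auto
  have z: "psize \<nu> > max d e \<Longrightarrow> coef \<nu> P = 0 \<and> coef \<nu> Q = 0" using coef_eq_0 d by blast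
  have "P + Q = (\<Sum>\<nu> | psize \<nu> \<le> max d e. lam_const (coef \<nu> P + coef \<nu> Q) * double_schur \<nu>)"
    by (subst coef_expansion[OF d(1)], subst coef_expansion[OF d(2)])
      (simp add: lam_const.hom_add distrib_right sum.distrib)
  from coef_eq[OF finite_psize this, of \<nu>] z show ?thesis by (auto simp: not_le)
qed

lemma coef_scale: "coef \<nu> (lam_const c * P) = c * coef \<nu> P"
proof -
  obtain d where d: "lam_deg P d" using lam_deg_exists by metis
  have "lam_const c * P = (\<Sum>\<nu> | psize \<nu> \<le> d. lam_const (c * coef \<nu> P) * double_schur \<nu>)"
    by (subst coef_expansion[OF d]) (simp add: lam_const.hom_mult sum_distrib_left mult.assoc)
  from coef_eq[OF finite_psize this, of \<nu>] coef_eq_0[OF d, of \<nu>] show ?thesis by (auto simp: not_le)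
qed

lemma coef_0: "coef \<nu> 0 = 0"
  using coef_scale[of \<nu> 0 0] by simp

lemma coef_sum: "coef \<nu> (\<Sum>i\<in>I. F i) = (\<Sum>i\<in>I. coef \<nu> (F i))"
  by (induction I rule: infinite_finite_induct) (simp_all add: coef_add coef_0)

text \<open>Coefficients at partitions of length at most \<open>n\<close> can be read off in
  \<open>n\<close> variables, where all longer partitions contribute zero. In this way an identity
  in finitely many x gives values of \<open>coef\<close>.\<close>

lemma coef_level:
  assumes S: "finite S" "\<And>\<mu>. \<mu> \<in> S \<Longrightarrow> plength \<mu> \<le> n" "\<nu> \<in> S"
    and P: "lam_seq P n = (\<Sum>\<mu>\<in>S. Const (c \<mu>) * double_schur_poly n \<mu>)"
  shows "coef \<nu> P = c \<nu>"
proof -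
  obtain d where d: "lam_deg P d" using lam_deg_exists by metis
  define T where "T = {\<mu>. psize \<mu> \<le> d \<and> plength \<mu> \<le> n}"
  define c' where "c' = (\<lambda>\<mu>. if \<mu> \<in> S then c \<mu> else 0)"
  have finT: "finite T" unfolding T_def by (rule finite_subset[OF _ finite_psize[of d]]) auto
  have fin: "finite (S \<union> T)" using S(1) finT by simp
  have "lam_seq P n = (\<Sum>\<mu> | psize \<mu> \<le> d. Const (coef \<mu> P) * double_schur_poly n \<mu>)"
    by (subst coef_expansion[OF d]) (rule lam_seq_combination)
  also have "\<dots> = (\<Sum>\<mu>\<in>T. Const (coef \<mu> P) * double_schur_poly n \<mu>)"
    unfolding T_def by (rule sum.mono_neutral_right) (auto simp: finite_psize double_schur_poly_def)
  also have "\<dots> = (\<Sum>\<mu>\<in>S \<union> T. Const (coef \<mu> P) * double_schur_poly n \<mu>)"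
    by (rule sum.mono_neutral_left[OF fin])
      (use S(2) coef_eq_0[OF d] in \<open>auto simp: T_def, metis Const_0 not_le\<close>)
  finally have 1: "lam_seq P n = (\<Sum>\<mu>\<in>S \<union> T. Const (coef \<mu> P) * double_schur_poly n \<mu>)" .
  have "lam_seq P n = (\<Sum>\<mu>\<in>S. Const (c' \<mu>) * double_schur_poly n \<mu>)"
    unfolding P by (rule sum.cong) (auto simp: c'_def)
  also have "\<dots> = (\<Sum>\<mu>\<in>S \<union> T. Const (c' \<mu>) * double_schur_poly n \<mu>)"
    by (rule sum.mono_neutral_left[OF fin]) (auto simp: c'_def)
  finally have 2: "(\<Sum>\<mu>\<in>S \<union> T. Const (coef \<mu> P) * double_schur_poly n \<mu>) = (\<Sum>\<mu>\<in>S \<union> T. Const (c' \<mu>) * double_schur_poly n \<mu>)"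
    using 1 by simp
  interpret C: comm_ring_hom "Const :: qa \<Rightarrow> xpoly" by (rule Const_hom)
  have "(\<Sum>\<mu>\<in>S \<union> T. Const (coef \<mu> P - c' \<mu>) * double_schur_poly n \<mu>) = 0"
    using 2 by (simp add: C.hom_minus left_diff_distrib sum_subtractf)
  then have "coef \<nu> P - c' \<nu> = 0"
    by (rule double_schur_poly_independent[OF fin, rotated]) (use S in \<open>auto simp: T_def\<close>)
  then show ?thesis using S(3) by (simp add: c'_def)
qed

text \<open>The generating function \<open>\<Prod>\<^sub>i (1 - a\<^sub>i y) / (1 - x\<^sub>i y)\<close>; its coefficients play the role of the
  complete symmetric functions.\<close>

definition hser :: "nat \<Rightarrow> xpoly fps"
  where "hser n = (\<Prod>i\<in>{1..n}. (1 - fps_const (Const (a (int i))) * fps_X) * geo (Var i))"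

lemma (in comm_ring_hom) map_fps_geo: "map_fps hom (geo c) = geo (hom c)"
  by (rule fps_ext) (simp add: hom_power)

lemma map_fps_eqD: "map_fps h F = G \<Longrightarrow> h (fps_nth F k) = fps_nth G k"
  by auto

lemma map_hser:
  "map_fps (subst \<sigma>) (hser n) = (\<Prod>i\<in>{1..n}. (1 - fps_const (Const (a (int i))) * fps_X) * geo (\<sigma> i))"
proof -
  interpret s: comm_ring_hom "subst \<sigma> :: xpoly \<Rightarrow> xpoly" by (rule subst_hom)
  interpret m: comm_ring_hom "map_fps (subst \<sigma> :: xpoly \<Rightarrow> xpoly)" by (rule s.map_fps_hom)
  show ?thesis
    by (simp add: hser_def m.hom_prod m.hom_mult m.hom_minus m.hom_one s.map_fps_geo s.map_fps_const s.map_fps_X)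
qed

lemma fps_deg_mult:
  fixes F G :: "('v, 'c::comm_ring_1) mpoly fps"
  assumes "\<And>k. deg_le (fps_nth F k) k" "\<And>k. deg_le (fps_nth G k) k"
  shows "deg_le (fps_nth (F * G) k) k"
  unfolding fps_mult_nth
proof (rule deg_le_sum)
  fix i assume "i \<in> {0..k}"
  then show "deg_le (fps_nth F i * fps_nth G (k - i)) k"
    using deg_le_mult[OF assms(1)[of i] assms(2)[of "k - i"]] by simp
qed

lemma hser_deg: "deg_le (fps_nth (hser n) k) k"
  unfolding hser_def
proof (induction n arbitrary: k)
  case 0
  then show ?case by (cases k) (simp_all add: deg_le_Const[of 0, simplified])
next
  case (Suc n)
  have c: "deg_le (fps_nth (1 - fps_const (Const c) * fps_X :: xpoly fps) k) k" for c k
  proof -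
    have "fps_nth (1 - fps_const (Const c) * fps_X :: xpoly fps) k = Const (if k = 0 then 1 else if k = 1 then - c else 0)"
      by (auto simp: fps_X_def Const_def single_uminus One_nat_def)
    then show ?thesis by simp
  qed
  have g: "deg_le (fps_nth (geo (Var i) :: xpoly fps) k) k" for i k
    using deg_le_power[OF deg_le_Var[of i], of k] by simp
  have "{1..Suc n} = insert (Suc n) {1..n}" by auto
  then show ?case
    using fps_deg_mult[OF fps_deg_mult[OF c g] Suc.IH] by simp
qed

text \<open>At x_n = a_n the factor of index \<open>n\<close> becomes 1; this is the purpose of the
  numerators.\<close>

lemma is_lam_hser: "is_lam (\<lambda>n. fps_nth (hser n) k)"
  unfolding is_lam_def
proof (intro conjI allI impI)
  fix n
  let ?\<sigma> = "\<lambda>i. if i \<in> {1..n} then Var i else 0 :: xpoly"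
  have "map_fps (subst ?\<sigma>) (hser n) = hser n"
    unfolding map_hser unfolding hser_def by (rule prod.cong) auto
  then have "subst ?\<sigma> (fps_nth (hser n) k) = fps_nth (hser n) k" by (rule map_fps_eqD)
  then show "vars (fps_nth (hser n) k) \<subseteq> {1..n}" by (rule vars_subsetI)
next
  fix n and \<pi> :: "nat \<Rightarrow> nat" assume \<pi>: "\<pi> permutes {1..n}"
  have "(\<Prod>i\<in>{1..n}. geo (Var (\<pi> i)) :: xpoly fps) = (\<Prod>i\<in>{1..n}. geo (Var i))"
    using prod.permute[OF \<pi>, of "\<lambda>i. geo (Var i) :: xpoly fps"] by (simp add: o_def)
  then have "map_fps (subst (\<lambda>i. Var (\<pi> i))) (hser n) = hser n"
    unfolding map_hser unfolding hser_def prod.distrib by simp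
  then show "subst (\<lambda>i. Var (\<pi> i)) (fps_nth (hser n) k) = fps_nth (hser n) k" by (rule map_fps_eqD)
next
  show "\<exists>d. \<forall>n. deg_le (fps_nth (hser n) k) d" using hser_deg by blast
next
  fix n :: nat assume "1 \<le> n"
  then obtain p where n: "n = Suc p" by (cases n) auto
  let ?c = "Const (a (int n)) :: xpoly"
  have "map_fps (subst (Var(n := ?c))) (hser n) =
      (\<Prod>i\<in>{1..p}. (1 - fps_const (Const (a (int i))) * fps_X) * geo ((Var(n := ?c)) i)) * (geo ?c * (1 - fps_const ?c * fps_X))"
    unfolding map_hser n by (simp add: mult_ac)
  also have "\<dots> = hser (n - 1)"
    unfolding geo_mult hser_def n by (auto intro!: prod.cong)
  finally show "subst (Var(n := ?c)) (fps_nth (hser n) k) = fps_nth (hser (n - 1)) k" by (rule map_fps_eqD)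
qed

lift_definition hlam :: "nat \<Rightarrow> lam" is "\<lambda>k n. fps_nth (hser n) k"
  by (rule is_lam_hser)

lemma lam_seq_hlam: "lam_seq (hlam k) n = fps_nth (hser n) k"
  by (simp add: hlam.rep_eq)

lemma hser_0: "fps_nth (hser n) 0 = 1"
proof (induction n)
  case (Suc n)
  have "hser (Suc n) = hser n * ((1 - fps_const (Const (a (int (Suc n)))) * fps_X) * geo (Var (Suc n)))"
    by (simp add: hser_def)
  with Suc show ?case by simp
qed (simp add: hser_def)

lemma hlam_0: "hlam 0 = 1"
  by (rule lam_eqI) (simp add: lam_seq_hlam hser_0 lam_seq.hom_one)

definition hmono :: "(nat \<Rightarrow>\<^sub>0 nat) \<Rightarrow> lam"
  where "hmono \<beta> = (\<Prod>j\<in>Poly_Mapping.keys \<beta>. hlam (Poly_Mapping.lookup \<beta> j))"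

lemma hmono_superset:
  assumes "finite A" "Poly_Mapping.keys \<beta> \<subseteq> A"
  shows "hmono \<beta> = (\<Prod>j\<in>A. hlam (Poly_Mapping.lookup \<beta> j))"
  unfolding hmono_def
  by (rule prod.mono_neutral_left) (use assms in \<open>auto simp: hlam_0 in_keys_iff\<close>)

lemma deg_le_prod:
  assumes "\<And>i. i \<in> I \<Longrightarrow> deg_le (f i :: ('v, 'c::comm_ring_1) mpoly) (d i)"
  shows "deg_le (\<Prod>i\<in>I. f i) (\<Sum>i\<in>I. d i)"
  using assms by (induction I rule: infinite_finite_induct) (auto intro: deg_le_mult)

lemma hmono_deg: "lam_deg (hmono \<beta>) (mono_deg \<beta>)"
  unfolding lam_deg_def hmono_def mono_deg_def lam_seq.hom_prod lam_seq_hlam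
  by (intro allI deg_le_prod hser_deg)

section \<open>The Cauchy identity and the dual Schur functions\<close>

text \<open>Formally \<open>\<Prod>\<^sub>k\<^sub>\<le>\<^sub>n\<^sub>-\<^sub>m (1 - c\<^sub>k y) / \<Prod>\<^sub>k\<^sub>\<le>\<^sub>0 (1 - c\<^sub>k y)\<close>, after cancellation; with \<open>c = a\<close> this makes
  \<open>fser\<close> a uniform description of both cases of the entries of the dual Schur determinant.\<close>

definition qser :: "(int \<Rightarrow> 'r) \<Rightarrow> nat \<Rightarrow> nat \<Rightarrow> 'r::comm_ring_1 fps"
  where "qser c n m =
    (if m \<le> n then \<Prod>k\<in>{1..int n - int m}. 1 - fps_const (c k) * fps_X
     else \<Prod>k\<in>{int n - int m + 1..0}. geo (c k))"

definition fser :: "(int \<Rightarrow> 'r) \<Rightarrow> nat \<Rightarrow> nat \<Rightarrow> 'r::comm_ring_1 fps"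
  where "fser c n m = fps_X ^ m * qser c n (Suc m)"

text \<open>One recursion across the change of case, which happens at \<open>m = n\<close>, where
  the product is empty.\<close>

lemma qser_step:
  "qser c n (Suc m) * (1 - fps_const (c (int n - int m)) * fps_X) = qser c n m"
proof (cases "Suc m \<le> n")
  case True
  then have "{1..int n - int m} = insert (int n - int m) {1..int n - int (Suc m)}" by auto
  with True show ?thesis by (simp add: qser_def mult.commute)
next
  case False
  then have *: "qser c n (Suc m) = geo (c (int n - int m)) * (\<Prod>k\<in>{int n - int m + 1..0}. geo (c k))"
  proof -
    have "{int n - int (Suc m) + 1..0} = insert (int n - int m) {int n - int m + 1..0}"
      using False by auto
    with False show ?thesis by (simp add: qser_def)
  qed
  have "qser c n m = (\<Prod>k\<in>{int n - int m + 1..0}. geo (c k))"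
    using False by (cases "m = n") (simp_all add: qser_def)
  moreover have "geo d * P * (1 - fps_const d * fps_X) = (geo d * (1 - fps_const d * fps_X)) * P" for d :: 'a and P
    by (simp only: mult_ac)
  ultimately show ?thesis unfolding * by (simp only: geo_mult mult_1)
qed

lemma fser_nth: "b < m \<Longrightarrow> fps_nth (fser c n m) b = 0" "fps_nth (fser c n m) m = 1"
proof -
  have "fps_nth (qser c n l) 0 = 1" for l
  proof -
    have "fps_nth (\<Prod>k\<in>A. 1 - fps_const (c k) * fps_X) 0 = 1" "fps_nth (\<Prod>k\<in>A. geo (c k)) 0 = 1" for A
      by (induction A rule: infinite_finite_induct) simp_all
    then show ?thesis by (simp add: qser_def)
  qed
  then show "b < m \<Longrightarrow> fps_nth (fser c n m) b = 0" "fps_nth (fser c n m) m = 1"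
    by (simp_all add: fser_def fps_X_power_mult_nth)
qed

lemma (in comm_ring_hom) map_fps_fser: "map_fps hom (fser c n m) = fser (\<lambda>k. hom (c k)) n m"
proof -
  interpret m: comm_ring_hom "map_fps hom" by (rule map_fps_hom)
  show ?thesis
    by (simp add: fser_def qser_def m.hom_mult m.hom_power m.hom_prod m.hom_minus m.hom_one
        map_fps_X map_fps_const map_fps_geo)
qed

text \<open>Newton interpolation of \<open>1 / (1 - x y)\<close> at the nodes \<open>c n, c (n - 1), \<dots>\<close>.\<close>

lemma geo_newton_expansion:
  fixes x :: "'r::comm_ring_1"
  shows "geo x * qser c n 0 =
    (\<Sum>m<M. fps_const (\<Prod>k<m. x - c (int n - int k)) * fser c n m) +
    fps_const (\<Prod>k<M. x - c (int n - int k)) * fps_X ^ M * qser c n M * geo x"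
proof (induction M)
  case (Suc M)
  let ?e = "\<Prod>k<M. x - c (int n - int k)" and ?d = "c (int n - int M)"
  \<comment> \<open>The interpolation step: 1 - d y = (1 - x y) + (x - d) y, divided by 1 - x
    y.\<close>
  have g: "(1 - fps_const ?d * fps_X) * geo x = 1 + fps_const (x - ?d) * fps_X * geo x"
  proof -
    have "1 - fps_const ?d * fps_X = (1 - fps_const x * fps_X) + fps_const (x - ?d) * fps_X"
      by (simp add: algebra_simps flip: fps_const_sub)
    moreover have "(1 - fps_const x * fps_X) * geo x = 1"
      using geo_mult[of x] by (simp only: mult.commute)
    ultimately show ?thesis by (simp only: distrib_right)
  qed
  have "fps_const ?e * fps_X ^ M * qser c n M * geo x =
      fps_const ?e * fps_X ^ M * qser c n (Suc M) * ((1 - fps_const ?d * fps_X) * geo x)"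
    unfolding qser_step[of c n M, symmetric] by (simp only: mult_ac)
  also have "\<dots> = fps_const ?e * fser c n M +
      fps_const ?e * fps_const (x - ?d) * fps_X ^ Suc M * qser c n (Suc M) * geo x"
    unfolding g fser_def by (simp only: distrib_left mult_1 mult_1_right power_Suc mult_ac)
  finally show ?case unfolding Suc by (simp only: sum.lessThan_Suc prod.lessThan_Suc fps_const_mult add.assoc)
qed (simp add: mult.commute)

text \<open>The remainder of the expansion after \<open>Suc M\<close> terms is divisible by X^(M+1),
  hence invisible at exponents up to \<open>M\<close>.\<close>

lemma geo_newton_coeff:
  assumes "b \<le> M"
  shows "fps_nth (qser c n 0 * geo x) b = (\<Sum>m\<le>M. (\<Prod>k<m. x - c (int n - int k)) * fps_nth (fser c n m) b)"
proof -
  let ?e = "\<lambda>m. \<Prod>k<m. x - c (int n - int k)"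
  have "fps_const (?e (Suc M)) * fps_X ^ Suc M * qser c n (Suc M) * geo x =
      fps_X ^ Suc M * (fps_const (?e (Suc M)) * qser c n (Suc M) * geo x)" by (simp only: mult_ac)
  then have "fps_nth (fps_const (?e (Suc M)) * fps_X ^ Suc M * qser c n (Suc M) * geo x) b = 0"
    using assms by (simp only: fps_X_power_mult_nth) simp
  moreover have "qser c n 0 * geo x = (\<Sum>m<Suc M. fps_const (?e m) * fser c n m) +
      fps_const (?e (Suc M)) * fps_X ^ Suc M * qser c n (Suc M) * geo x"
    using geo_newton_expansion[of x c n "Suc M"] by (simp only: mult.commute)
  ultimately have "fps_nth (qser c n 0 * geo x) b = fps_nth (\<Sum>m<Suc M. fps_const (?e m) * fser c n m) b"
    by (simp only: fps_add_nth add_0_right)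
  then show ?thesis by (simp only: fps_sum_nth fps_mult_left_const_nth lessThan_Suc_atMost)
qed

lemma hser_eq: "hser n = qser (\<lambda>k. Const (a k)) n 0 * (\<Prod>i\<in>{1..n}. geo (Var i))"
proof -
  have "(\<Prod>i\<in>{1..n}. 1 - fps_const (Const (a (int i))) * fps_X :: xpoly fps) = qser (\<lambda>k. Const (a k)) n 0"
    unfolding qser_def
    by (simp, rule prod.reindex_bij_witness[of _ nat int]) auto
  then show ?thesis by (simp add: hser_def prod.distrib)
qed

abbreviation fa :: "nat \<Rightarrow> nat \<Rightarrow> qa fps" where "fa \<equiv> fser a"

text \<open>The numerator of the dual Schur function in \<open>n\<close> variables, by
  \<open>dual_entry_eq\<close>.\<close>

definition falt :: "nat \<Rightarrow> partition \<Rightarrow> xseries"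
  where "falt n \<nu> = alt n (\<lambda>i j. fps_at i (fa n (stair n \<nu> j)))"

lemma mcoeff_falt:
  assumes "Poly_Mapping.keys \<gamma> \<subseteq> {1..n}"
  shows "mcoeff (falt n \<nu>) \<gamma> = alt n (\<lambda>i j. fps_nth (fa n (stair n \<nu> j)) (Poly_Mapping.lookup \<gamma> i))"
  unfolding falt_def by (rule mcoeff_alt_fps_at[OF assms])

text \<open>The Cauchy identity in \<open>n\<close> variables \<open>x\<close> and \<open>n\<close> variables \<open>y\<close>, multiplied by the
  Vandermonde product in \<open>y\<close>.\<close>

lemma cauchy_identity_level:
  assumes keys: "Poly_Mapping.keys \<gamma> \<subseteq> {1..n}" and M: "\<And>j. Poly_Mapping.lookup \<gamma> j \<le> M"
  shows "mcoeff (vdm n PS_Var * (\<Prod>j\<in>{1..n}. fps_at j (hser n))) \<gamma> =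
    (\<Sum>\<nu> | plength \<nu> \<le> n \<and> (\<forall>j\<in>{1..n}. stair n \<nu> j \<le> M).
      Const (mcoeff (falt n \<nu>) \<gamma>) * double_schur_poly n \<nu>)" (is "?W = ?R")
proof -
  interpret C: comm_ring_hom "Const :: qa \<Rightarrow> xpoly" by (rule Const_hom)
  have f: "fps_nth (fser (\<lambda>k. Const (a k)) n m) b = (Const (fps_nth (fa n m) b) :: xpoly)" for m b
    using map_fps_eqD[OF C.map_fps_fser[of a n m], of b] by simp
  have "vdm n Var * ?W = alt n (\<lambda>i j. fps_nth (qser (\<lambda>k. Const (a k)) n 0 * geo (Var i)) (Poly_Mapping.lookup \<gamma> j))"
    unfolding hser_eq by (rule vdm_mult_coeff[OF keys])
  \<comment> \<open>Newton's expansion has the shape of a matrix product, with rows in x and columns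
    in y, as Cauchy-Binet requires.\<close>
  also have "\<dots> = alt n (\<lambda>i j. \<Sum>m\<le>M. double_power n i m * Const (fps_nth (fa n m) (Poly_Mapping.lookup \<gamma> j)))"
    unfolding geo_newton_coeff[OF M] f double_power_def ..
  also have "\<dots> = (\<Sum>\<nu> | plength \<nu> \<le> n \<and> (\<forall>j\<in>{1..n}. stair n \<nu> j \<le> M).
      alt n (\<lambda>i j. double_power n i (stair n \<nu> j)) * Const (mcoeff (falt n \<nu>) \<gamma>))"
    unfolding cauchy_binet mcoeff_falt[OF keys] C.hom_alt ..
  also have "\<dots> = vdm n Var * ?R"
    unfolding sum_distrib_left
  proof (rule sum.cong[OF refl])
    fix \<nu> assume "\<nu> \<in> {\<nu>. plength \<nu> \<le> n \<and> (\<forall>j\<in>{1..n}. stair n \<nu> j \<le> M)}"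
    then have "plength \<nu> \<le> n" by simp
    note eq = vdm_mult_double_schur_poly[OF this, symmetric]
    show "alt n (\<lambda>i j. double_power n i (stair n \<nu> j)) * Const (mcoeff (falt n \<nu>) \<gamma>) =
        vdm n Var * (Const (mcoeff (falt n \<nu>) \<gamma>) * double_schur_poly n \<nu>)"
      unfolding eq by (simp only: mult_ac)
  qed
  finally show ?thesis using vdm_Var_nonzero by simp
qed

text \<open>The coefficients of the Cauchy kernel in the basis of double Schur functions; these series
  turn out to be the dual Schur functions.\<close>

definition dser :: "partition \<Rightarrow> xseries"
  where "dser \<nu> = MFPS (\<lambda>\<beta>. if 0 \<in> Poly_Mapping.keys \<beta> then 0 else coef \<nu> (hmono \<beta>))"

lemma mcoeff_dser: "0 \<notin> Poly_Mapping.keys \<beta> \<Longrightarrow> mcoeff (dser \<nu>) \<beta> = coef \<nu> (hmono \<beta>)"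
  by (simp add: dser_def)

lemma mcoeff_dser_0: "0 \<in> Poly_Mapping.keys \<beta> \<Longrightarrow> mcoeff (dser \<nu>) \<beta> = 0"
  by (simp add: dser_def)

lemma dser_deg: "mono_deg \<beta> < psize \<nu> \<Longrightarrow> mcoeff (dser \<nu>) \<beta> = 0"
  using coef_eq_0[OF hmono_deg] by (cases "0 \<in> Poly_Mapping.keys \<beta>") (simp_all add: mcoeff_dser mcoeff_dser_0)

lemma lookup_le_mono_deg: "Poly_Mapping.lookup m i \<le> mono_deg m"
  by (cases "i \<in> Poly_Mapping.keys m") (auto simp: mono_deg_def in_keys_iff intro!: member_le_sum)

text \<open>The coefficient of y^\<gamma> in the kernel times the Vandermonde product is the value
  at level \<open>n\<close> of an element of Lambda(x||a), so \<open>coef\<close> can be applied to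
  that element.\<close>

lemma hmono_combination_level:
  assumes keys: "Poly_Mapping.keys \<gamma> \<subseteq> {1..n}"
  shows "lam_seq (\<Sum>(u, v)\<in>mono_splits \<gamma>. lam_const (mcoeff (vdm n PS_Var) u) * hmono v) n =
    mcoeff (vdm n PS_Var * (\<Prod>j\<in>{1..n}. fps_at j (hser n))) \<gamma>"
proof -
  have "Const (mcoeff (vdm n PS_Var) u) * lam_seq (hmono v) n =
      mcoeff (vdm n PS_Var) u * mcoeff (\<Prod>j\<in>{1..n}. fps_at j (hser n)) v" if "u + v = \<gamma>" for u v
  proof -
    have v: "Poly_Mapping.keys v \<subseteq> {1..n}" using keys that by (auto simp: keys_add_nat)
    have "Const (mcoeff (vdm n PS_Var) u) = (mcoeff (vdm n PS_Var) u :: xpoly)"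
      using arg_cong[OF map_mfps_vdm[OF Const_hom, of n], of "\<lambda>F. mcoeff F u"] by simp
    moreover have "lam_seq (hmono v) n = mcoeff (\<Prod>j\<in>{1..n}. fps_at j (hser n)) v"
      using v by (simp add: hmono_superset[OF _ v] lam_seq.hom_prod lam_seq_hlam mcoeff_prod_fps_at)
    ultimately show ?thesis by simp
  qed
  then show ?thesis
    unfolding mcoeff_mult lam_seq.hom_sum
    by (intro sum.cong) (auto simp: lam_seq.hom_mult lam_seq_lam_const)
qed

lemma finite_stair_le: "finite {\<nu>. plength \<nu> \<le> n \<and> (\<forall>j\<in>{1..n}. stair n \<nu> j \<le> M)}"
proof (rule finite_subset[OF _ finite_psize])
  show "{\<nu>. plength \<nu> \<le> n \<and> (\<forall>j\<in>{1..n}. stair n \<nu> j \<le> M)} \<subseteq> {\<nu>. psize \<nu> \<le> (\<Sum>j\<in>{1..n}. M)}"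
  proof clarify
    fix \<nu> assume "plength \<nu> \<le> n" "\<forall>j\<in>{1..n}. stair n \<nu> j \<le> M"
    then have "(\<Sum>j\<in>{1..n}. stair n \<nu> j) \<le> (\<Sum>j\<in>{1..n}. M)" by (intro sum_mono) auto
    then show "psize \<nu> \<le> (\<Sum>j\<in>{1..n}. M)" using sum_stair[OF \<open>plength \<nu> \<le> n\<close>] by simp
  qed
qed

text \<open>Apply \<open>coef \<nu>\<close> to the coefficient of y^\<gamma> in the kernel times the
  Vandermonde product. Linearity yields the left side, the Cauchy identity in \<open>n\<close>
  variables the right side.\<close>

lemma vdm_mult_dser:
  assumes len: "plength \<nu> \<le> n"
  shows "vdm n PS_Var * PS_restrict {1..n} (dser \<nu>) = falt n \<nu>"
proof (rule mfps_eqI)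
  fix \<gamma>
  interpret r: comm_ring_hom "PS_restrict {1..n} :: xseries \<Rightarrow> _" by (rule PS_restrict_hom)
  show "mcoeff (vdm n PS_Var * PS_restrict {1..n} (dser \<nu>)) \<gamma> = mcoeff (falt n \<nu>) \<gamma>"
  proof (cases "Poly_Mapping.keys \<gamma> \<subseteq> {1..n}")
    case False
    have "vdm n PS_Var * PS_restrict {1..n} (dser \<nu>) = PS_restrict {1..n} (vdm n PS_Var * dser \<nu>)"
      by (simp only: r.hom_mult PS_restrict_vdm)
    with False show ?thesis
      by (simp add: mcoeff_PS_restrict falt_def mcoeff_alt_fps_at_outside)
  next
    case True
    let ?W = "\<Sum>(u, v)\<in>mono_splits \<gamma>. lam_const (mcoeff (vdm n PS_Var) u) * hmono v"
    \<comment> \<open>Large enough to bound the exponents in \<gamma> and to let \<nu> take part in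
      the finite sum.\<close>
    let ?M = "mono_deg \<gamma> + (\<Sum>j\<in>{1..n}. stair n \<nu> j)"
    have "mcoeff (vdm n PS_Var * PS_restrict {1..n} (dser \<nu>)) \<gamma> =
        (\<Sum>(u, v)\<in>mono_splits \<gamma>. mcoeff (vdm n PS_Var) u * coef \<nu> (hmono v))"
      unfolding mcoeff_mult
    proof (rule sum.cong[OF refl], clarify)
      fix u v assume "(u, v) \<in> mono_splits \<gamma>"
      then have "Poly_Mapping.keys v \<subseteq> {1..n}" using True by (auto simp: keys_add_nat)
      then have "mcoeff (PS_restrict {1..n} (dser \<nu>)) v = coef \<nu> (hmono v)"
        by (subst mcoeff_dser[symmetric]) (auto simp: mcoeff_PS_restrict)
      then show "mcoeff (vdm n PS_Var) u * mcoeff (PS_restrict {1..n} (dser \<nu>)) v =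
          mcoeff (vdm n PS_Var) u * coef \<nu> (hmono v)" by simp
    qed
    also have "\<dots> = coef \<nu> ?W"
      by (simp add: coef_sum coef_scale case_prod_unfold)
    also have "\<dots> = mcoeff (falt n \<nu>) \<gamma>"
    proof (rule coef_level[OF finite_stair_le])
      show "lam_seq ?W n = (\<Sum>\<mu> | plength \<mu> \<le> n \<and> (\<forall>j\<in>{1..n}. stair n \<mu> j \<le> ?M).
          Const (mcoeff (falt n \<mu>) \<gamma>) * double_schur_poly n \<mu>)"
        unfolding hmono_combination_level[OF True]
        by (rule cauchy_identity_level[OF True]) (rule trans_le_add1[OF lookup_le_mono_deg])
      have "stair n \<nu> j \<le> ?M" if "j \<in> {1..n}" for j
        by (rule trans_le_add2) (use that in \<open>auto intro: member_le_sum\<close>)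
      with len show "\<nu> \<in> {\<mu>. plength \<mu> \<le> n \<and> (\<forall>j\<in>{1..n}. stair n \<mu> j \<le> ?M)}" by simp
    qed auto
    finally show ?thesis .
  qed
qed

section \<open>Stability, limits and the determinant formula for dual Schur functions\<close>

lemma PS_restrict_vdm_Suc:
  "PS_restrict {1..p} (vdm (Suc p) PS_Var) = vdm p PS_Var * (\<Prod>i\<in>{1..p}. PS_Var i :: (nat, 'c::comm_ring_1) mfps)"
proof -
  interpret r: comm_ring_hom "PS_restrict {1..p} :: (nat, 'c) mfps \<Rightarrow> _" by (rule PS_restrict_hom)
  show ?thesis
    by (simp add: vdm_Suc r.hom_mult PS_restrict_vdm r.hom_prod r.hom_minus PS_restrict_PS_Var)
qed

lemma vdm_prod_PS_Var_cancel:
  assumes "vdm p PS_Var * (\<Prod>i\<in>{1..p}. PS_Var i) * F = 0"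
  shows "F = 0"
proof -
  have "vdm p PS_Var * ((\<Prod>i\<in>{1..p}. PS_Var i) * F) = 0" using assms by (simp only: mult.assoc)
  then have *: "(\<Prod>i\<in>{1..p}. PS_Var i) * F = 0" by (rule vdm_PS_Var_cancel)
  show ?thesis by (rule prod_cancel[OF _ PS_Var_cancel *]) auto
qed

text \<open>In exactly \<open>plength \<nu>\<close> variables all exponents are positive, so the
  alternant vanishes when the last variable is set to 0, while the Vandermonde product becomes
  something that can be cancelled. Fewer variables follow by restricting further.\<close>

lemma PS_restrict_dser_eq_0:
  assumes "n < plength \<nu>"
  shows "PS_restrict {1..n} (dser \<nu>) = 0"
proof -
  obtain p where p: "plength \<nu> = Suc p" using assms by (cases "plength \<nu>") auto
  interpret r: comm_ring_hom "PS_restrict {1..p} :: xseries \<Rightarrow> _" by (rule PS_restrict_hom)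
  have pos: "0 < stair (Suc p) \<nu> j" if "j \<in> {1..Suc p}" for j
    using part_eq_0_iff[of j \<nu>] that p by (auto simp: stair_def)
  have z: "PS_restrict {1..p} (fps_at (Suc p) (fa (Suc p) (stair (Suc p) \<nu> j))) = 0" if "j \<in> {1..Suc p}" for j
    using fser_nth(1)[OF pos[OF that], of a "Suc p"]
    by (simp add: PS_restrict_fps_at comm_ring_hom.axioms mfps_eqI mcoeff_PS_Const)
  have "PS_restrict {1..p} (falt (Suc p) \<nu>) =
      alt (Suc p) (\<lambda>i j. PS_restrict {1..p} (fps_at i (fa (Suc p) (stair (Suc p) \<nu> j))))"
    by (simp add: falt_def r.hom_alt)
  also have "\<dots> = 0"
    using z by (subst alt_last_row) simp_all
  finally have "PS_restrict {1..p} (vdm (Suc p) PS_Var * PS_restrict {1..Suc p} (dser \<nu>)) = 0"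
    using vdm_mult_dser[of \<nu> "Suc p"] p by simp
  then have "vdm p PS_Var * (\<Prod>i\<in>{1..p}. PS_Var i) * PS_restrict {1..p} (PS_restrict {1..Suc p} (dser \<nu>)) = 0"
    by (simp only: r.hom_mult PS_restrict_vdm_Suc)
  then have "PS_restrict {1..p} (PS_restrict {1..Suc p} (dser \<nu>)) = 0" by (rule vdm_prod_PS_Var_cancel)
  then have "PS_restrict {1..n} (PS_restrict {1..p} (PS_restrict {1..Suc p} (dser \<nu>))) = PS_restrict {1..n} 0" by simp
  then have "PS_restrict ({1..n} \<inter> ({1..p} \<inter> {1..Suc p})) (dser \<nu>) = PS_restrict {1..n} 0"
    by (simp only: PS_restrict_restrict)
  moreover have "{1..n} \<inter> ({1..p} \<inter> {1..Suc p}) = {1..n}" using assms p by auto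
  moreover have "PS_restrict {1..n} 0 = (0 :: xseries)"
    by (rule mfps_eqI) (simp add: mcoeff_PS_restrict)
  ultimately show ?thesis by (simp only:)
qed

text \<open>A monomial involves finitely many variables, so the restrictions determine the
  series.\<close>

lemma stable_limit_eq:
  assumes G: "PS_restrict {1..} G = G" "\<And>n. PS_restrict {1..n} G = F n"
  shows "stable_limit F = G"
  unfolding stable_limit_def
proof (rule the_equality)
  fix G' assume G': "PS_restrict {1..} G' = G' \<and> (\<forall>n. PS_restrict {1..n} G' = F n)"
  show "G' = G"
  proof (rule mfps_eqI)
    fix m
    show "mcoeff G' m = mcoeff G m"
    proof (cases "Poly_Mapping.keys m \<subseteq> {1..}")
      case True
      then have "Poly_Mapping.keys m \<subseteq> {1..Max (insert 0 (Poly_Mapping.keys m))}"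
        by (auto intro: Max_ge)
      moreover have "mcoeff (PS_restrict {1..Max (insert 0 (Poly_Mapping.keys m))} G') m =
          mcoeff (PS_restrict {1..Max (insert 0 (Poly_Mapping.keys m))} G) m"
        using G G' by simp
      ultimately show ?thesis by (simp add: mcoeff_PS_restrict)
    next
      case False
      then have "mcoeff (PS_restrict {1..} G') m = 0" "mcoeff (PS_restrict {1..} G) m = 0"
        by (simp_all add: mcoeff_PS_restrict)
      then show ?thesis using G G' by simp
    qed
  qed
qed (use G in auto)

lemma le_diag_boxes_iff:
  assumes "1 \<le> j"
  shows "j \<le> diag_boxes \<kappa> \<longleftrightarrow> j \<le> part \<kappa> j"
proof -
  let ?S = "{j. 1 \<le> j \<and> j \<le> part \<kappa> j}"
  have "finite ?S"
  proof (rule finite_subset)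
    show "?S \<subseteq> {..part \<kappa> 1}" using part_antimono[of 1 _ \<kappa>] by (auto intro: order_trans)
  qed simp
  then have "?S = {1..card ?S}"
    by (rule initial_segment_card) (use part_antimono[of _ _ \<kappa>] in \<open>auto intro: order_trans\<close>)
  then have "?S = {1..diag_boxes \<kappa>}" by (simp add: diag_boxes_def)
  moreover have "j \<le> part \<kappa> j \<longleftrightarrow> j \<in> ?S" using assms by simp
  ultimately show ?thesis using assms by simp
qed

text \<open>For the exponent m = \<open>stair n \<kappa> j\<close> one has n - m = j - \<kappa>_j.
  Hence m \<ge> n exactly when the row meets the diagonal, and the two cases of \<open>qser\<close>
  are those of the entries.\<close>

lemma dual_entry_eq:
  assumes j: "j \<in> {1..n}"
  shows "dual_entry n \<kappa> i j = fps_at i (fa n (stair n \<kappa> j))"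
proof -
  interpret f: comm_ring_hom "fps_at i :: qa fps \<Rightarrow> xseries" by (rule fps_at_hom)
  have X: "fps_at i (fps_X ^ m) = (PS_Var i ^ m :: xseries)" for m
    by (simp add: f.hom_power fps_at_X)
  have sd: "part \<kappa> j + n - j = stair n \<kappa> j" by (simp add: stair_def)
  show ?thesis
  proof (cases "j \<le> part \<kappa> j")
    case True
    have ge: "n \<le> stair n \<kappa> j" "int n - int (Suc (stair n \<kappa> j)) + 1 = int j - int (part \<kappa> j)"
      using True j by (auto simp: stair_def)
    let ?I = "{int j - int (part \<kappa> j)..0}"
    have fa: "fa n (stair n \<kappa> j) = fps_X ^ stair n \<kappa> j * (\<Prod>k\<in>?I. geo (a k))"
      unfolding fser_def qser_def using ge by simp
    have unit: "(\<Prod>k\<in>?I. 1 - PS_Const (a k) * PS_Var i) * (\<Prod>k\<in>?I. fps_at i (geo (a k))) = (1 :: xseries)"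
      unfolding prod.distrib[symmetric] by (intro prod.neutral ballI, subst mult.commute) (rule fps_at_geo_mult)
    have "exact_quot (PS_Var i ^ stair n \<kappa> j) (\<Prod>k\<in>?I. 1 - PS_Const (a k) * PS_Var i) =
        fps_at i (fa n (stair n \<kappa> j))"
    proof (rule exact_quot_eq)
      fix F :: xseries assume "(\<Prod>k\<in>?I. 1 - PS_Const (a k) * PS_Var i) * F = 0"
      then have "(\<Prod>k\<in>?I. fps_at i (geo (a k))) * ((\<Prod>k\<in>?I. 1 - PS_Const (a k) * PS_Var i) * F) = 0" by simp
      then have "((\<Prod>k\<in>?I. 1 - PS_Const (a k) * PS_Var i) * (\<Prod>k\<in>?I. fps_at i (geo (a k)))) * F = 0"
        by (simp only: mult_ac)
      then show "F = 0" by (simp only: unit mult_1)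
    next
      have "(\<Prod>k\<in>?I. 1 - PS_Const (a k) * PS_Var i) * fps_at i (fa n (stair n \<kappa> j)) =
          PS_Var i ^ stair n \<kappa> j * ((\<Prod>k\<in>?I. 1 - PS_Const (a k) * PS_Var i) * (\<Prod>k\<in>?I. fps_at i (geo (a k))))"
        unfolding fa f.hom_mult f.hom_prod X by (simp only: mult_ac)
      then show "(\<Prod>k\<in>?I. 1 - PS_Const (a k) * PS_Var i) * fps_at i (fa n (stair n \<kappa> j)) = PS_Var i ^ stair n \<kappa> j"
        by (simp only: unit mult_1_right)
    qed
    with True j show ?thesis by (simp add: dual_entry_def le_diag_boxes_iff sd)
  next
    case False
    have ge: "Suc (stair n \<kappa> j) \<le> n" "int n - int (Suc (stair n \<kappa> j)) = int j - int (part \<kappa> j) - 1"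
      using False j by (auto simp: stair_def)
    have "fa n (stair n \<kappa> j) = fps_X ^ stair n \<kappa> j * (\<Prod>k\<in>{1..int j - int (part \<kappa> j) - 1}. 1 - fps_const (a k) * fps_X)"
      unfolding fser_def qser_def if_P[OF ge(1)] ge(2) ..
    with False j show ?thesis
      by (simp add: dual_entry_def le_diag_boxes_iff sd f.hom_mult f.hom_prod X f.hom_minus fps_at_const fps_at_X)
  qed
qed

lemma dual_schur_series_eq: "dual_schur_series n \<kappa> = PS_restrict {1..n} (dser \<kappa>)"
proof (cases "plength \<kappa> \<le> n")
  case True
  have "alt n (dual_entry n \<kappa>) = falt n \<kappa>"
    unfolding falt_def by (rule alt_cong) (rule dual_entry_eq)
  then have "bialternant n (dual_entry n \<kappa>) PS_Var = PS_restrict {1..n} (dser \<kappa>)"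
    unfolding bialternant_eq
    by (intro exact_quot_eq[OF vdm_PS_Var_cancel]) (simp_all add: vdm_mult_dser[OF True])
  with True show ?thesis by (simp add: dual_schur_series_def)
next
  case False
  then show ?thesis by (simp add: dual_schur_series_def PS_restrict_dser_eq_0)
qed

lemma PS_restrict_dser: "PS_restrict {1..} (dser \<nu>) = dser \<nu>"
proof (rule mfps_eqI)
  fix m
  show "mcoeff (PS_restrict {1..} (dser \<nu>)) m = mcoeff (dser \<nu>) m"
  proof (cases "Poly_Mapping.keys m \<subseteq> {1..}")
    case False
    then have "0 \<in> Poly_Mapping.keys m" by (metis atLeast_iff less_one not_le subsetI)
    with False show ?thesis by (simp add: mcoeff_PS_restrict mcoeff_dser_0)
  qed (simp add: mcoeff_PS_restrict)
qed

text \<open>The limit exists because \<open>dser \<nu>\<close> is already a series in all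
  variables.\<close>

lemma dual_schur_eq: "dual_schur \<nu> = dser \<nu>"
  unfolding dual_schur_def
  by (rule stable_limit_eq) (simp_all add: PS_restrict_dser dual_schur_series_eq)

section \<open>Symmetric series\<close>

text \<open>Restriction to {1..} excludes the variable of index 0, which the permutations considered
  here fix.\<close>

definition sym_series :: "xseries \<Rightarrow> bool"
  where "sym_series G \<longleftrightarrow> PS_restrict {1..} G = G \<and>
    (\<forall>n \<pi>. \<pi> permutes {1..n} \<longrightarrow> PS_perm \<pi> G = G)"

lemma sym_series_mult:
  assumes "sym_series F" "sym_series G"
  shows "sym_series (F * G)"
  unfolding sym_series_def
proof (intro conjI allI impI)
  interpret r: comm_ring_hom "PS_restrict {1..} :: xseries \<Rightarrow> _" by (rule PS_restrict_hom)
  show "PS_restrict {1..} (F * G) = F * G"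
    using assms by (simp only: r.hom_mult sym_series_def)
  fix n and \<pi> :: "nat \<Rightarrow> nat" assume \<pi>: "\<pi> permutes {1..n}"
  interpret p: comm_ring_hom "PS_perm \<pi> :: xseries \<Rightarrow> _" by (rule PS_perm_hom[OF permutes_bij[OF \<pi>]])
  have "PS_perm \<pi> F = F" "PS_perm \<pi> G = G" using assms \<pi> unfolding sym_series_def by blast+
  then show "PS_perm \<pi> (F * G) = F * G" by (simp only: p.hom_mult)
qed

lemma sym_series_diff:
  assumes "sym_series F" "sym_series G"
  shows "sym_series (F - G)"
  unfolding sym_series_def
proof (intro conjI allI impI)
  interpret r: comm_ring_hom "PS_restrict {1..} :: xseries \<Rightarrow> _" by (rule PS_restrict_hom)
  show "PS_restrict {1..} (F - G) = F - G"
    using assms by (simp only: r.hom_minus sym_series_def)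
  fix n and \<pi> :: "nat \<Rightarrow> nat" assume \<pi>: "\<pi> permutes {1..n}"
  interpret p: comm_ring_hom "PS_perm \<pi> :: xseries \<Rightarrow> _" by (rule PS_perm_hom[OF permutes_bij[OF \<pi>]])
  have "PS_perm \<pi> F = F" "PS_perm \<pi> G = G" using assms \<pi> unfolding sym_series_def by blast+
  then show "PS_perm \<pi> (F - G) = F - G" by (simp only: p.hom_minus)
qed

lemma sym_series_coeff:
  assumes "sym_series G" "\<pi> permutes {1..n}"
  shows "mcoeff G (Poly_Mapping.map_key \<pi> m) = mcoeff G m"
proof -
  have "PS_perm \<pi> G = G" using assms unfolding sym_series_def by blast
  then have "mcoeff (PS_perm \<pi> G) m = mcoeff G m" by (rule arg_cong)
  then show ?thesis by simp
qed

lemma sym_series_coeff_0: "sym_series G \<Longrightarrow> 0 \<in> Poly_Mapping.keys m \<Longrightarrow> mcoeff G m = 0"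
proof -
  assume "sym_series G" and m: "0 \<in> Poly_Mapping.keys m"
  then have "mcoeff G m = mcoeff (PS_restrict {1..} G) m" by (simp only: sym_series_def)
  also have "\<dots> = 0"
  proof -
    have "\<not> Poly_Mapping.keys m \<subseteq> {1..}" using m by auto
    then show ?thesis by (simp only: mcoeff_PS_restrict if_False)
  qed
  finally show ?thesis .
qed

lemma sym_seriesI:
  assumes "\<And>m. 0 \<in> Poly_Mapping.keys m \<Longrightarrow> mcoeff G m = 0"
    "\<And>n \<pi> m. \<pi> permutes {1..n} \<Longrightarrow> mcoeff G (Poly_Mapping.map_key \<pi> m) = mcoeff G m"
  shows "sym_series G"
  unfolding sym_series_def
proof (intro conjI allI impI mfps_eqI)
  fix m
  show "mcoeff (PS_restrict {1..} G) m = mcoeff G m"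
  proof (cases "0 \<in> Poly_Mapping.keys m")
    case False
    then have "Poly_Mapping.keys m \<subseteq> {1..}" by (metis Suc_leI atLeast_iff not_gr_zero One_nat_def subsetI)
    then show ?thesis by (simp add: mcoeff_PS_restrict)
  qed (simp add: mcoeff_PS_restrict assms(1))
next
  fix n m and \<pi> :: "nat \<Rightarrow> nat" assume "\<pi> permutes {1..n}"
  then show "mcoeff (PS_perm \<pi> G) m = mcoeff G m" unfolding mcoeff_PS_perm by (rule assms(2))
qed

lemma zero_mem_keys_map_key:
  fixes n :: nat
  assumes "\<pi> permutes {1..n}"
  shows "0 \<in> Poly_Mapping.keys (Poly_Mapping.map_key \<pi> m) \<longleftrightarrow> 0 \<in> Poly_Mapping.keys m"
proof -
  have "\<pi> 0 = 0" by (rule permutes_not_in[OF assms]) simp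
  then show ?thesis by (simp add: keys_map_key_bij[OF permutes_bij[OF assms]])
qed

lemma hmono_map_key:
  assumes \<pi>: "\<pi> permutes {1..n}"
  shows "hmono (Poly_Mapping.map_key \<pi> m) = hmono m"
proof -
  have b: "bij_betw \<pi> (Poly_Mapping.keys (Poly_Mapping.map_key \<pi> m)) (Poly_Mapping.keys m)"
    unfolding bij_betw_def
  proof
    show "inj_on \<pi> (Poly_Mapping.keys (Poly_Mapping.map_key \<pi> m))"
      using permutes_inj[OF \<pi>] by (rule inj_on_subset) simp
    show "\<pi> ` Poly_Mapping.keys (Poly_Mapping.map_key \<pi> m) = Poly_Mapping.keys m"
    proof (intro equalityI subsetI)
      fix i assume "i \<in> Poly_Mapping.keys m"
      then have "inv_into UNIV \<pi> i \<in> Poly_Mapping.keys (Poly_Mapping.map_key \<pi> m)"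
        by (simp add: keys_map_key_bij[OF permutes_bij[OF \<pi>]] permutes_inverses[OF \<pi>])
      then show "i \<in> \<pi> ` Poly_Mapping.keys (Poly_Mapping.map_key \<pi> m)"
        by (rule rev_image_eqI) (simp add: permutes_inverses[OF \<pi>])
    qed (auto simp: keys_map_key_bij[OF permutes_bij[OF \<pi>]])
  qed
  show ?thesis
    unfolding hmono_def lookup_map_key[OF permutes_inj[OF \<pi>]]
    by (rule prod.reindex_bij_betw[OF b])
qed

lemma sym_series_dser: "sym_series (dser \<nu>)"
proof (rule sym_seriesI)
  fix n m and \<pi> :: "nat \<Rightarrow> nat" assume "\<pi> permutes {1..n}"
  then show "mcoeff (dser \<nu>) (Poly_Mapping.map_key \<pi> m) = mcoeff (dser \<nu>) m"
    by (cases "0 \<in> Poly_Mapping.keys m")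
      (simp_all add: mcoeff_dser mcoeff_dser_0 zero_mem_keys_map_key hmono_map_key)
qed (rule mcoeff_dser_0)

lemma alternating_vdm_mult_sym:
  assumes "sym_series G"
  shows "alternating n (vdm n PS_Var * PS_restrict {1..n} G)"
proof (rule alternating_vdm_mult)
  fix \<pi> :: "nat \<Rightarrow> nat" assume \<pi>: "\<pi> permutes {1..n}"
  show "PS_perm \<pi> (PS_restrict {1..n} G) = PS_restrict {1..n} G"
  proof (rule mfps_eqI)
    fix m :: "nat \<Rightarrow>\<^sub>0 nat"
    have "Poly_Mapping.keys (Poly_Mapping.map_key \<pi> m) \<subseteq> {1..n} \<longleftrightarrow> Poly_Mapping.keys m \<subseteq> {1..n}"
    proof -
      have "\<pi> i \<in> Poly_Mapping.keys m \<longleftrightarrow> i \<in> Poly_Mapping.keys (Poly_Mapping.map_key \<pi> m)" for i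
        by (simp add: keys_map_key_bij[OF permutes_bij[OF \<pi>]])
      then show ?thesis
        using permutes_in_image[OF \<pi>] permutes_surj[OF \<pi>] by (metis subset_iff surjD)
    qed
    then show "mcoeff (PS_perm \<pi> (PS_restrict {1..n} G)) m = mcoeff (PS_restrict {1..n} G) m"
      by (simp add: mcoeff_PS_restrict sym_series_coeff[OF assms \<pi>])
  qed
next
  show "PS_restrict {1..n} (PS_restrict {1..n} G) = PS_restrict {1..n} G"
    by (simp add: PS_restrict_restrict)
qed

text \<open>The coefficient of the ordinary Schur function \<open>s\<^sub>\<nu>\<close> in the symmetric series \<open>G\<close>. It may be computed
  in any number \<open>n \<ge> plength \<nu>\<close> of variables.\<close>

definition chi :: "partition \<Rightarrow> xseries \<Rightarrow> qa"
  where "chi \<nu> G = mcoeff (vdm (plength \<nu>) PS_Var * PS_restrict {1..plength \<nu>} G)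
    (mono_of (plength \<nu>) (stair (plength \<nu>) \<nu>))"

lemma mcoeff_prod_PS_Var_mult:
  assumes "finite A"
  shows "mcoeff ((\<Prod>i\<in>A. PS_Var i) * F) (m + (\<Sum>i\<in>A. Poly_Mapping.single i 1)) = mcoeff F m"
  using assms
proof (induction A arbitrary: m rule: finite_induct)
  case (insert i A)
  have "mcoeff ((\<Prod>i\<in>insert i A. PS_Var i) * F) (m + (\<Sum>i\<in>insert i A. Poly_Mapping.single i 1)) =
      mcoeff (PS_Var i * ((\<Prod>i\<in>A. PS_Var i) * F)) (m + (\<Sum>i\<in>A. Poly_Mapping.single i 1) + Poly_Mapping.single i 1)"
    using insert by (simp add: mult.assoc add_ac)
  also have "\<dots> = mcoeff F m"
    unfolding mcoeff_PS_Var_mult using insert by (simp add: lookup_add)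
  finally show ?case .
qed simp

text \<open>The last exponent of the larger staircase is 0, so the last variable may be set to 0.
  The Vandermonde product then becomes the smaller one times all remaining variables, which accounts
  for the other exponents being larger by one.\<close>

lemma chi_level:
  assumes "plength \<nu> \<le> n"
  shows "mcoeff (vdm n PS_Var * PS_restrict {1..n} G) (mono_of n (stair n \<nu>)) = chi \<nu> G"
  using assms
proof (induction rule: dec_induct)
  case base
  show ?case by (simp add: chi_def)
next
  case (step n)
  interpret r: comm_ring_hom "PS_restrict {1..n} :: xseries \<Rightarrow> _" by (rule PS_restrict_hom)
  let ?m = "mono_of n (stair n \<nu>)" and ?m' = "mono_of (Suc n) (stair (Suc n) \<nu>)"
  have zero: "stair (Suc n) \<nu> (Suc n) = 0"
    using step part_eq_0_iff[of "Suc n" \<nu>] by (simp add: stair_def)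
  have st: "stair (Suc n) \<nu> j = stair n \<nu> j + 1" if "j \<in> {1..n}" for j
    using that by (auto simp: stair_def)
  have "?m' = (\<Sum>j\<in>{1..n}. Poly_Mapping.single j (stair (Suc n) \<nu> j))"
    by (simp add: mono_of_def zero)
  also have "\<dots> = (\<Sum>j\<in>{1..n}. Poly_Mapping.single j (stair n \<nu> j) + Poly_Mapping.single j 1)"
    by (rule sum.cong[OF refl]) (simp only: st single_add)
  also have "\<dots> = ?m + (\<Sum>j\<in>{1..n}. Poly_Mapping.single j 1)"
    by (simp add: sum.distrib mono_of_def)
  finally have m': "?m' = ?m + (\<Sum>j\<in>{1..n}. Poly_Mapping.single j 1)" .
  have "Poly_Mapping.keys ?m' \<subseteq> {1..n}"
  proof
    fix j assume "j \<in> Poly_Mapping.keys ?m'"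
    then have "j \<in> {1..Suc n}" "stair (Suc n) \<nu> j \<noteq> 0"
      by (auto simp: in_keys_iff lookup_mono_of split: if_splits)
    with zero show "j \<in> {1..n}" by (auto simp: le_Suc_eq)
  qed
  then have "mcoeff (vdm (Suc n) PS_Var * PS_restrict {1..Suc n} G) ?m' =
      mcoeff (PS_restrict {1..n} (vdm (Suc n) PS_Var * PS_restrict {1..Suc n} G)) ?m'"
    by (simp add: mcoeff_PS_restrict)
  also have "PS_restrict {1..n} (vdm (Suc n) PS_Var * PS_restrict {1..Suc n} G) =
      vdm n PS_Var * (\<Prod>i\<in>{1..n}. PS_Var i) * PS_restrict ({1..n} \<inter> {1..Suc n}) G"
    by (simp only: r.hom_mult PS_restrict_vdm_Suc PS_restrict_restrict)
  also have "\<dots> = (\<Prod>i\<in>{1..n}. PS_Var i) * (vdm n PS_Var * PS_restrict {1..n} G)"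
  proof -
    have "{1..n} \<inter> {1..Suc n} = {1..n}" by auto
    then show ?thesis by (simp only: mult_ac)
  qed
  also have "mcoeff \<dots> ?m' = mcoeff (vdm n PS_Var * PS_restrict {1..n} G) ?m"
    unfolding m' by (rule mcoeff_prod_PS_Var_mult) simp
  finally show ?case using step by simp
qed

lemma series_eq_0I:
  assumes "PS_restrict {1..} G = G" "\<And>n. PS_restrict {1..n} G = (0 :: xseries)"
  shows "G = 0"
proof -
  have z: "PS_restrict A 0 = (0 :: xseries)" for A :: "nat set"
    by (rule mfps_eqI) (simp add: mcoeff_PS_restrict)
  have "stable_limit (\<lambda>_. 0) = G" by (rule stable_limit_eq[OF assms])
  moreover have "stable_limit (\<lambda>_. 0) = 0" by (rule stable_limit_eq) (simp_all only: z)
  ultimately show ?thesis by simp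
qed

text \<open>Times the Vandermonde product, each restriction is alternating, and its staircase
  coefficients are values of \<open>chi\<close>; by \<open>alternating_coeff\<close> it is zero if
  these are.\<close>

lemma sym_series_eq_0I:
  assumes G: "sym_series G" and chi: "\<And>\<nu>. chi \<nu> G = 0"
  shows "G = 0"
proof (rule series_eq_0I)
  show "PS_restrict {1..} G = G" using G unfolding sym_series_def by blast
  fix n
  have "vdm n PS_Var * PS_restrict {1..n} G = 0"
  proof (rule mfps_eqI, rule ccontr)
    fix m assume "mcoeff (vdm n PS_Var * PS_restrict {1..n} G) m \<noteq> mcoeff 0 m"
    then have nz: "mcoeff (vdm n PS_Var * PS_restrict {1..n} G) m \<noteq> 0" by simp
    obtain \<nu> where "plength \<nu> \<le> n" "mcoeff (vdm n PS_Var * PS_restrict {1..n} G) (mono_of n (stair n \<nu>)) \<noteq> 0"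
      using alternating_coeff[OF alternating_vdm_mult_sym[OF G] nz] by blast
    then show False by (simp add: chi_level chi)
  qed
  then show "PS_restrict {1..n} G = 0" by (rule vdm_PS_Var_cancel)
qed

text \<open>By homogeneity of the Vandermonde product, \<open>chi \<nu>\<close> depends only on the
  component of degree |\<nu>|. For this reason it can be computed on infinite sums by
  truncation.\<close>

lemma chi_eq_sum:
  "chi \<nu> G = (\<Sum>(u, v) | (u, v) \<in> mono_splits (mono_of (plength \<nu>) (stair (plength \<nu>) \<nu>)) \<and> mono_deg v = psize \<nu>.
    mcoeff (vdm (plength \<nu>) PS_Var) u * mcoeff (PS_restrict {1..plength \<nu>} G) v)"
proof -
  let ?n = "plength \<nu>" and ?m = "mono_of (plength \<nu>) (stair (plength \<nu>) \<nu>)"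
  have "mcoeff (vdm ?n PS_Var) u = (0 :: qa)" if "u + v = ?m" "mono_deg v \<noteq> psize \<nu>" for u v
  proof (rule ccontr)
    assume "mcoeff (vdm ?n PS_Var) u \<noteq> (0 :: qa)"
    then have "mono_deg u = tri ?n" using homogeneous_vdm[of ?n, where 'c = qa] unfolding homogeneous_def by blast
    moreover have "mono_deg u + mono_deg v = psize \<nu> + tri ?n"
      using that(1) sum_stair[of \<nu> ?n] by (simp add: mono_deg_mono_of flip: mono_deg_add)
    ultimately show False using that(2) by simp
  qed
  then show ?thesis
    unfolding chi_def mcoeff_mult
    by (intro sum.mono_neutral_right) (auto, metis)
qed

lemma chi_cong:
  assumes "\<And>m. mono_deg m = psize \<nu> \<Longrightarrow> mcoeff F m = mcoeff G m"
  shows "chi \<nu> F = chi \<nu> G"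
  unfolding chi_eq_sum using assms by (intro sum.cong) (auto simp: mcoeff_PS_restrict)

lemma chi_diff: "chi \<nu> (F - G) = chi \<nu> F - chi \<nu> G"
proof -
  interpret r: comm_ring_hom "PS_restrict A :: xseries \<Rightarrow> _" for A :: "nat set" by (rule PS_restrict_hom)
  show ?thesis by (simp add: chi_def r.hom_minus right_diff_distrib)
qed

lemma chi_combination: "chi \<nu> (\<Sum>i\<in>I. PS_Const (c i) * F i) = (\<Sum>i\<in>I. c i * chi \<nu> (F i))"
proof -
  interpret r: comm_ring_hom "PS_restrict A :: xseries \<Rightarrow> _" for A :: "nat set" by (rule PS_restrict_hom)
  have C: "PS_restrict A (PS_Const c) = (PS_Const c :: xseries)" for A :: "nat set" and c
    by (rule mfps_eqI) (auto simp: mcoeff_PS_restrict mcoeff_PS_Const)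
  show ?thesis
    unfolding chi_def r.hom_sum r.hom_mult C sum_distrib_left mult.left_commute[of _ "PS_Const _"]
    by simp
qed

text \<open>Forward substitution by size for a linear system with matrix \<open>T\<close>, intended
  for matrices that are the identity within one size and vanish from larger to smaller
  sizes.\<close>

function tri_solve :: "(partition \<Rightarrow> qa) \<Rightarrow> (partition \<Rightarrow> partition \<Rightarrow> qa) \<Rightarrow> partition \<Rightarrow> qa"
  where "tri_solve g T \<mu> = g \<mu> - (\<Sum>\<nu>\<in>{\<nu>. psize \<nu> < psize \<mu>}. tri_solve g T \<nu> * T \<mu> \<nu>)"
  by pat_completeness auto
termination by (relation "measure (\<lambda>(g, T, \<mu>). psize \<mu>)") auto

declare tri_solve.simps [simp del]

text \<open>Makes only finitely many members contribute to each coefficient of a formal sum.\<close>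

definition graded_family :: "(partition \<Rightarrow> xseries) \<Rightarrow> bool"
  where "graded_family t \<longleftrightarrow> (\<forall>\<nu> m. mono_deg m < psize \<nu> \<longrightarrow> mcoeff (t \<nu>) m = 0)"

lemma has_formal_sum_graded:
  assumes "graded_family t"
  shows "has_formal_sum (\<lambda>\<nu>. PS_Const (c \<nu>) * t \<nu>) F \<longleftrightarrow>
    (\<forall>m. mcoeff F m = (\<Sum>\<nu> | psize \<nu> \<le> mono_deg m. c \<nu> * mcoeff (t \<nu>) m))"
proof -
  have sub: "{\<nu>. mcoeff (PS_Const (c \<nu>) * t \<nu>) m \<noteq> 0} \<subseteq> {\<nu>. psize \<nu> \<le> mono_deg m}" for m
    using assms by (auto simp: graded_family_def not_less[symmetric])
  have "(\<Sum>\<nu> | mcoeff (PS_Const (c \<nu>) * t \<nu>) m \<noteq> 0. mcoeff (PS_Const (c \<nu>) * t \<nu>) m) =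
      (\<Sum>\<nu> | psize \<nu> \<le> mono_deg m. c \<nu> * mcoeff (t \<nu>) m)" for m
    using sum.mono_neutral_left[OF finite_psize sub[of m], of "\<lambda>\<nu>. mcoeff (PS_Const (c \<nu>) * t \<nu>) m"] by simp
  then show ?thesis
    unfolding has_formal_sum_def using finite_subset[OF sub finite_psize] by simp
qed

text \<open>Choose the coefficients so that \<open>chi\<close> vanishes on the difference. The
  family is kept general because the result serves twice, for the dual Schur functions and for the
  ordinary ones.\<close>

lemma sym_series_expansion:
  assumes t: "graded_family t" and sym: "\<And>\<nu>. sym_series (t \<nu>)"
    and chi: "\<And>\<mu> \<nu>. psize \<mu> \<le> psize \<nu> \<Longrightarrow> chi \<mu> (t \<nu>) = (if \<mu> = \<nu> then 1 else 0)"
    and G: "sym_series G"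
  shows "\<exists>c. has_formal_sum (\<lambda>\<nu>. PS_Const (c \<nu>) * t \<nu>) G"
proof -
  define c where "c = tri_solve (\<lambda>\<mu>. chi \<mu> G) (\<lambda>\<mu> \<nu>. chi \<mu> (t \<nu>))"
  define S where "S = MFPS (\<lambda>m. \<Sum>\<nu> | psize \<nu> \<le> mono_deg m. c \<nu> * mcoeff (t \<nu>) m)"
  have S: "has_formal_sum (\<lambda>\<nu>. PS_Const (c \<nu>) * t \<nu>) S"
    unfolding has_formal_sum_graded[OF t] by (simp add: S_def)
  \<comment> \<open>Up to degree \<open>N\<close> the infinite sum agrees with a finite one, on
    which symmetry and \<open>chi\<close> can be checked.\<close>
  have trunc: "mcoeff S m = mcoeff (\<Sum>\<nu> | psize \<nu> \<le> N. PS_Const (c \<nu>) * t \<nu>) m" if "mono_deg m \<le> N" for m N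
  proof -
    have "mcoeff S m = (\<Sum>\<nu> | psize \<nu> \<le> N. c \<nu> * mcoeff (t \<nu>) m)"
      unfolding S_def mcoeff_MFPS
      by (rule sum.mono_neutral_left) (use that t in \<open>auto simp: finite_psize graded_family_def\<close>)
    then show ?thesis by simp
  qed
  have "sym_series S"
  proof (rule sym_seriesI)
    fix m :: "nat \<Rightarrow>\<^sub>0 nat" assume "0 \<in> Poly_Mapping.keys m"
    then show "mcoeff S m = 0" by (simp add: S_def sym_series_coeff_0[OF sym])
  next
    fix n and m :: "nat \<Rightarrow>\<^sub>0 nat" and \<pi> :: "nat \<Rightarrow> nat" assume \<pi>: "\<pi> permutes {1..n}"
    let ?m = "Poly_Mapping.map_key \<pi> m" let ?N = "mono_deg m + mono_deg ?m"
    show "mcoeff S ?m = mcoeff S m"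
      by (simp add: trunc[of _ ?N] sym_series_coeff[OF sym \<pi>])
  qed
  then have D: "sym_series (G - S)" by (rule sym_series_diff[OF G])
  have "chi \<mu> (G - S) = 0" for \<mu>
  proof -
    have "chi \<mu> S = chi \<mu> (\<Sum>\<nu> | psize \<nu> \<le> psize \<mu>. PS_Const (c \<nu>) * t \<nu>)"
      by (rule chi_cong) (simp only: trunc order_refl)
    also have "\<dots> = (\<Sum>\<nu> | psize \<nu> \<le> psize \<mu>. c \<nu> * chi \<mu> (t \<nu>))"
      by (rule chi_combination)
    also have "\<dots> = (\<Sum>\<nu>\<in>insert \<mu> {\<nu>. psize \<nu> < psize \<mu>}. c \<nu> * chi \<mu> (t \<nu>))"
      by (rule sum.mono_neutral_right) (auto simp: finite_psize chi)
    also have "\<dots> = c \<mu> + (\<Sum>\<nu> | psize \<nu> < psize \<mu>. c \<nu> * chi \<mu> (t \<nu>))"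
    proof -
      have "finite {\<nu>. psize \<nu> < psize \<mu>}"
        by (rule finite_subset[OF _ finite_psize[of "psize \<mu>"]]) auto
      then show ?thesis by (simp add: chi)
    qed
    also have "\<dots> = chi \<mu> G"
      unfolding c_def by (subst tri_solve.simps) simp
    finally show ?thesis by (simp add: chi_diff)
  qed
  then have "G - S = 0" by (rule sym_series_eq_0I[OF D])
  then show ?thesis using S by auto
qed

lemma graded_family_dser: "graded_family dser"
  unfolding graded_family_def using dser_deg by blast

text \<open>The value is a minor of the coefficient matrix of the series \<open>fa n m\<close>,
  which start with y^m and so form a unitriangular matrix.\<close>

lemma chi_dser:
  assumes "psize \<mu> \<le> psize \<nu>"
  shows "chi \<mu> (dser \<nu>) = (if \<mu> = \<nu> then 1 else 0)"
proof -
  define n where "n = max (plength \<mu>) (plength \<nu>)"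
  have n: "plength \<mu> \<le> n" "plength \<nu> \<le> n" by (auto simp: n_def)
  have "chi \<mu> (dser \<nu>) = mcoeff (falt n \<nu>) (mono_of n (stair n \<mu>))"
    unfolding chi_level[OF n(1), symmetric] vdm_mult_dser[OF n(2)] ..
  also have "\<dots> = alt n (\<lambda>i j. fps_nth (fa n (stair n \<nu> j)) (stair n \<mu> i))"
    unfolding mcoeff_falt[OF keys_mono_of] by (rule alt_cong) (simp add: lookup_mono_of)
  also have "\<dots> = (if \<mu> = \<nu> then 1 else 0)"
    by (rule alt_stair_triangular[of "\<lambda>k b. fps_nth (fa n k) b"]) (use assms n in \<open>auto simp: fser_nth\<close>)
  finally show ?thesis .
qed

lemma exact_quot_vdm: "vdm n PS_Var * r = p \<Longrightarrow> exact_quot p (vdm n PS_Var) = r"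
  by (rule exact_quot_eq) (rule vdm_PS_Var_cancel)

text \<open>At a = 0 the entries of the dual determinant become pure powers. Stability, symmetry and
  unitriangularity of the ordinary Schur functions are all inherited in this way.\<close>

lemma schur_eq: "schur \<kappa> = map_mfps (subst (\<lambda>_. 0)) (dser \<kappa>)"
proof -
  interpret z: comm_ring_hom "subst (\<lambda>_. 0) :: qa \<Rightarrow> qa" by (rule subst_hom)
  interpret m: comm_ring_hom "map_mfps (subst (\<lambda>_. 0)) :: xseries \<Rightarrow> xseries" by (rule z.map_mfps_hom)
  have restr: "PS_restrict A (map_mfps (subst (\<lambda>_. 0)) F) = map_mfps (subst (\<lambda>_. 0)) (PS_restrict A F)"
    for A and F :: xseries
    by (rule mfps_eqI) (simp add: mcoeff_PS_restrict)
  have geo0: "geo 0 = (1 :: qa fps)"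
    by (rule fps_ext) (simp add: power_0_left)
  have f0: "fser (\<lambda>_. 0 :: qa) n k = fps_X ^ k" for n k
    by (simp add: fser_def qser_def geo0)
  show ?thesis
    unfolding schur_def
  proof (rule stable_limit_eq)
    show "PS_restrict {1..} (map_mfps (subst (\<lambda>_. 0)) (dser \<kappa>)) = map_mfps (subst (\<lambda>_. 0)) (dser \<kappa>)"
      by (simp only: restr PS_restrict_dser)
    fix n
    show "PS_restrict {1..n} (map_mfps (subst (\<lambda>_. 0)) (dser \<kappa>)) =
        (if plength \<kappa> \<le> n then bialternant n (\<lambda>i j. PS_Var i ^ (part \<kappa> j + n - j)) PS_Var else 0)"
    proof (cases "plength \<kappa> \<le> n")
      case True
      have "vdm n PS_Var * map_mfps (subst (\<lambda>_. 0)) (PS_restrict {1..n} (dser \<kappa>)) =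
          map_mfps (subst (\<lambda>_. 0)) (falt n \<kappa>)"
        by (simp only: vdm_mult_dser[OF True, symmetric] m.hom_mult map_mfps_vdm[OF z.comm_ring_hom_axioms])
      also have "\<dots> = alt n (\<lambda>i j. fps_at i (fps_X ^ stair n \<kappa> j))"
        by (simp add: falt_def m.hom_alt z.map_mfps_fps_at z.map_fps_fser f0)
      also have "\<dots> = alt n (\<lambda>i j. PS_Var i ^ (part \<kappa> j + n - j))"
      proof (rule alt_cong)
        fix i j
        interpret f: comm_ring_hom "fps_at i :: qa fps \<Rightarrow> xseries" by (rule fps_at_hom)
        show "fps_at i (fps_X ^ stair n \<kappa> j) = (PS_Var i ^ (part \<kappa> j + n - j) :: xseries)"
          by (simp add: f.hom_power fps_at_X stair_def)
      qed
      finally have "bialternant n (\<lambda>i j. PS_Var i ^ (part \<kappa> j + n - j)) PS_Var =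
          map_mfps (subst (\<lambda>_. 0)) (PS_restrict {1..n} (dser \<kappa>))"
        unfolding bialternant_eq by (rule exact_quot_vdm)
      with True show ?thesis by (simp add: restr)
    next
      case False
      then have "PS_restrict {1..n} (dser \<kappa>) = 0" by (simp add: PS_restrict_dser_eq_0)
      with False show ?thesis by (simp add: restr m.hom_zero)
    qed
  qed
qed

lemma sym_series_in_hat_lam:
  assumes "sym_series G"
  shows "G \<in> hat_lam"
proof -
  interpret z: comm_ring_hom "subst (\<lambda>_. 0) :: qa \<Rightarrow> qa" by (rule subst_hom)
  interpret m: comm_ring_hom "map_mfps (subst (\<lambda>_. 0)) :: xseries \<Rightarrow> xseries" by (rule z.map_mfps_hom)
  have restr: "PS_restrict A (map_mfps (subst (\<lambda>_. 0)) F) = map_mfps (subst (\<lambda>_. 0)) (PS_restrict A F)"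
    for A and F :: xseries
    by (rule mfps_eqI) (simp add: mcoeff_PS_restrict)
  have "\<exists>c. has_formal_sum (\<lambda>\<nu>. PS_Const (c \<nu>) * schur \<nu>) G"
  proof (rule sym_series_expansion[OF _ _ _ assms])
    show "graded_family schur"
      using dser_deg by (simp add: graded_family_def schur_eq)
    show "sym_series (schur \<nu>)" for \<nu>
      unfolding schur_eq
      by (rule sym_seriesI)
        (simp_all add: sym_series_coeff_0[OF sym_series_dser] sym_series_coeff[OF sym_series_dser])
    show "chi \<mu> (schur \<nu>) = (if \<mu> = \<nu> then 1 else 0)" if "psize \<mu> \<le> psize \<nu>" for \<mu> \<nu>
    proof -
      have "chi \<mu> (schur \<nu>) = subst (\<lambda>_. 0) (chi \<mu> (dser \<nu>))"
        unfolding chi_def schur_eq restr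
        using map_mfps_vdm[OF z.comm_ring_hom_axioms, of "plength \<mu>"]
          m.hom_mult[of "vdm (plength \<mu>) PS_Var" "PS_restrict {1..plength \<mu>} (dser \<nu>)"]
        by (metis mcoeff_map_mfps)
      then show ?thesis by (simp add: chi_dser[OF that])
    qed
  qed
  then show ?thesis by (simp add: hat_lam_def)
qed

section \<open>The tensor square\<close>

lemma tensor_null_add_left: "pair_gen (P + P') Q - pair_gen P Q - pair_gen P' Q \<in> tensor_null"
  using tensor_null.add_left[OF tensor_null.zero, of 1 P P' Q] by simp

lemma tensor_null_add_right: "pair_gen P (Q + Q') - pair_gen P Q - pair_gen P Q' \<in> tensor_null"
  using tensor_null.add_right[OF tensor_null.zero, of 1 P Q Q'] by simp

lemma tensor_null_scale_left: "pair_gen (lam_const c * P) Q - Const c * pair_gen P Q \<in> tensor_null"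
  using tensor_null.scale_left[OF tensor_null.zero, of 1 c P Q] by simp

lemma tensor_null_scale_right: "pair_gen P (lam_const c * Q) - Const c * pair_gen P Q \<in> tensor_null"
  using tensor_null.scale_right[OF tensor_null.zero, of 1 P c Q] by simp

lemma tensor_rel_refl: "f = g \<Longrightarrow> tensor_rel f g"
  by (simp add: tensor_rel_def tensor_null.zero)

lemma tensor_add_left: "(P + P') \<otimes>\<^sub>\<Lambda> Q = P \<otimes>\<^sub>\<Lambda> Q + P' \<otimes>\<^sub>\<Lambda> Q"
  by transfer (use tensor_null_add_left in \<open>simp add: tensor_rel_def diff_diff_eq\<close>)

lemma tensor_add_right: "P \<otimes>\<^sub>\<Lambda> (Q + Q') = P \<otimes>\<^sub>\<Lambda> Q + P \<otimes>\<^sub>\<Lambda> Q'"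
  by transfer (use tensor_null_add_right in \<open>simp add: tensor_rel_def diff_diff_eq\<close>)

lemma tensor_scale_left: "(lam_const c * P) \<otimes>\<^sub>\<Lambda> Q = tensor_const c * (P \<otimes>\<^sub>\<Lambda> Q)"
  by transfer (use tensor_null_scale_left in \<open>simp add: tensor_rel_def\<close>)

lemma tensor_scale_right: "P \<otimes>\<^sub>\<Lambda> (lam_const c * Q) = tensor_const c * (P \<otimes>\<^sub>\<Lambda> Q)"
  by transfer (use tensor_null_scale_right in \<open>simp add: tensor_rel_def\<close>)

lemma Mul_mult: "Mul (P * Q) = Mul P + Mul Q"
  by (simp add: plus_mul_def Mul_inverse)

lemma Mul_1: "Mul 1 = 0"
  by (simp add: zero_mul_def)

lemma pair_gen_mult: "pair_gen P Q * pair_gen P' Q' = pair_gen (P * P') (Q * Q')"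
  by (simp add: pair_gen_def mult_single Mul_mult)

lemma tensor_mult: "(P \<otimes>\<^sub>\<Lambda> Q) * (P' \<otimes>\<^sub>\<Lambda> Q') = (P * P') \<otimes>\<^sub>\<Lambda> (Q * Q')"
  by transfer (rule tensor_rel_refl[OF pair_gen_mult])

lemma pair_gen_1: "pair_gen 1 1 = 1"
  by (simp add: pair_gen_def Mul_1 zero_prod_def[symmetric] single_one)

lemma tensor_unit: "(1 \<otimes>\<^sub>\<Lambda> 1) * t = t"
  by transfer (rule tensor_rel_refl, simp add: pair_gen_1)

lemma tensor_const_add: "tensor_const (c + d) = tensor_const c + tensor_const d"
  by transfer (rule tensor_rel_refl[OF Const_add])

lemma tensor_const_mult: "tensor_const (c * d) = tensor_const c * tensor_const d"
  by transfer (rule tensor_rel_refl[OF Const_mult])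

lemma tensor_const_1: "tensor_const 1 * t = t"
  by transfer (rule tensor_rel_refl, simp)

lemma tensor_const_0: "tensor_const 0 = 0"
  using tensor_const_add[of 0 0] by simp

lemma tensor_const_sum: "tensor_const (\<Sum>i\<in>I. c i) = (\<Sum>i\<in>I. tensor_const (c i))"
  by (induction I rule: infinite_finite_induct) (simp_all add: tensor_const_0 tensor_const_add)

lemma tensor_0_left: "0 \<otimes>\<^sub>\<Lambda> Q = 0"
  using tensor_add_left[of 0 0 Q] by simp

lemma tensor_0_right: "P \<otimes>\<^sub>\<Lambda> 0 = 0"
  using tensor_add_right[of P 0 0] by simp

lemma tensor_sum_left: "(\<Sum>i\<in>I. F i) \<otimes>\<^sub>\<Lambda> Q = (\<Sum>i\<in>I. F i \<otimes>\<^sub>\<Lambda> Q)"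
  by (induction I rule: infinite_finite_induct) (simp_all add: tensor_0_left tensor_add_left)

lemma tensor_sum_right: "P \<otimes>\<^sub>\<Lambda> (\<Sum>i\<in>I. F i) = (\<Sum>i\<in>I. P \<otimes>\<^sub>\<Lambda> F i)"
  by (induction I rule: infinite_finite_induct) (simp_all add: tensor_0_right tensor_add_right)

section \<open>Coordinates on the tensor square\<close>

definition pairs_coef :: "partition \<Rightarrow> partition \<Rightarrow> lam_pairs \<Rightarrow> qa"
  where "pairs_coef \<kappa> \<mu> f =
    (\<Sum>(P, Q)\<in>Poly_Mapping.keys f. Poly_Mapping.lookup f (P, Q) * (coef \<kappa> (unmul P) * coef \<mu> (unmul Q)))"

lemma pairs_coef_superset:
  assumes "finite A" "Poly_Mapping.keys f \<subseteq> A"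
  shows "pairs_coef \<kappa> \<mu> f = (\<Sum>(P, Q)\<in>A. Poly_Mapping.lookup f (P, Q) * (coef \<kappa> (unmul P) * coef \<mu> (unmul Q)))"
  unfolding pairs_coef_def
  by (rule sum.mono_neutral_left) (use assms in \<open>auto simp: in_keys_iff\<close>)

lemma pairs_coef_add: "pairs_coef \<kappa> \<mu> (f + g) = pairs_coef \<kappa> \<mu> f + pairs_coef \<kappa> \<mu> g"
proof -
  let ?A = "Poly_Mapping.keys f \<union> Poly_Mapping.keys g"
  have sub: "finite ?A" "Poly_Mapping.keys (f + g) \<subseteq> ?A" "Poly_Mapping.keys f \<subseteq> ?A" "Poly_Mapping.keys g \<subseteq> ?A"
    using keys_add[of f g] by auto
  show ?thesis
    unfolding pairs_coef_superset[OF sub(1,2)] pairs_coef_superset[OF sub(1,3)] pairs_coef_superset[OF sub(1,4)]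
    by (simp add: lookup_add case_prod_unfold distrib_right sum.distrib)
qed

lemma pairs_coef_single:
  "pairs_coef \<kappa> \<mu> (Poly_Mapping.single (P, Q) c) = c * (coef \<kappa> (unmul P) * coef \<mu> (unmul Q))"
  by (cases "c = 0") (simp_all add: pairs_coef_def)

lemma pairs_coef_0: "pairs_coef \<kappa> \<mu> 0 = 0"
  by (simp add: pairs_coef_def)

lemma pairs_coef_uminus: "pairs_coef \<kappa> \<mu> (- f) = - pairs_coef \<kappa> \<mu> f"
  using pairs_coef_add[of \<kappa> \<mu> f "- f"] by (simp add: pairs_coef_0 eq_neg_iff_add_eq_0 add.commute)

lemma pairs_coef_diff: "pairs_coef \<kappa> \<mu> (f - g) = pairs_coef \<kappa> \<mu> f - pairs_coef \<kappa> \<mu> g"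
  using pairs_coef_add[of \<kappa> \<mu> f "- g"] by (simp add: pairs_coef_uminus)

lemma pairs_coef_single_mult:
  "pairs_coef \<kappa> \<mu> (Poly_Mapping.single (Mul U, Mul V) c * pair_gen P Q) = c * (coef \<kappa> (U * P) * coef \<mu> (V * Q))"
  by (simp add: pair_gen_def mult_single pairs_coef_single flip: Mul_mult) (simp add: Mul_inverse)

lemma pairs_coef_scale: "pairs_coef \<kappa> \<mu> (Const c * f) = c * pairs_coef \<kappa> \<mu> f"
proof (induction f rule: poly_mapping_single_add_induct)
  case (add f m d)
  obtain P Q where "m = (P, Q)" by (cases m)
  with add show ?case
    by (simp add: distrib_left pairs_coef_add Const_def mult_single pairs_coef_single mult.assoc)
qed (simp add: pairs_coef_0)

text \<open>By additivity it is enough to test cofactors that are multiples of a single symbol, and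
  these carry a bilinearity relation to one of the same kind.\<close>

lemma pairs_coef_mult_eq_0:
  assumes "\<And>U V c. pairs_coef \<kappa> \<mu> (Poly_Mapping.single (Mul U, Mul V) c * r) = 0"
  shows "pairs_coef \<kappa> \<mu> (f * r) = 0"
proof (induction f rule: poly_mapping_single_add_induct)
  case (add f m c)
  obtain U V where "m = (Mul U, Mul V)" by (metis Mul_cases surj_pair)
  with add show ?case by (simp add: distrib_right pairs_coef_add assms)
qed (simp add: pairs_coef_0)

lemma pairs_coef_null: "f \<in> tensor_null \<Longrightarrow> pairs_coef \<kappa> \<mu> f = 0"
proof (induction rule: tensor_null.induct)
  case (add_left g f P P' Q)
  have "pairs_coef \<kappa> \<mu> (f * (pair_gen (P + P') Q - pair_gen P Q - pair_gen P' Q)) = 0"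
    by (rule pairs_coef_mult_eq_0)
      (simp add: right_diff_distrib pairs_coef_diff pairs_coef_single_mult coef_add distrib_left distrib_right)
  with add_left show ?case by (simp add: pairs_coef_add)
next
  case (add_right g f P Q Q')
  have "pairs_coef \<kappa> \<mu> (f * (pair_gen P (Q + Q') - pair_gen P Q - pair_gen P Q')) = 0"
    by (rule pairs_coef_mult_eq_0)
      (simp add: right_diff_distrib pairs_coef_diff pairs_coef_single_mult coef_add distrib_left distrib_right)
  with add_right show ?case by (simp add: pairs_coef_add)
next
  case (scale_left g f c P Q)
  have "pairs_coef \<kappa> \<mu> (f * (pair_gen (lam_const c * P) Q - Const c * pair_gen P Q)) = 0"
    by (rule pairs_coef_mult_eq_0)
      (simp add: right_diff_distrib pairs_coef_diff pairs_coef_single_mult mult.left_commute[of _ "Const c"]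
        mult.left_commute[of _ "lam_const c"] pairs_coef_scale coef_scale)
  with scale_left show ?case by (simp add: pairs_coef_add)
next
  case (scale_right g f P c Q)
  have "pairs_coef \<kappa> \<mu> (f * (pair_gen P (lam_const c * Q) - Const c * pair_gen P Q)) = 0"
    by (rule pairs_coef_mult_eq_0)
      (simp add: right_diff_distrib pairs_coef_diff pairs_coef_single_mult mult.left_commute[of _ "Const c"]
        mult.left_commute[of _ "lam_const c"] pairs_coef_scale coef_scale)
  with scale_right show ?case by (simp add: pairs_coef_add)
qed (rule pairs_coef_0)

text \<open>The coordinate at s_\<kappa> \<otimes> s_\<mu>. It is well defined because products of
  two linear coefficients respect all four kinds of relations, and it shows that the tensors of
  basis elements are linearly independent.\<close>

lift_definition tensor_coef :: "partition \<Rightarrow> partition \<Rightarrow> lam_tensor \<Rightarrow> qa" is pairs_coef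
  unfolding tensor_rel_def using pairs_coef_null pairs_coef_diff by (metis eq_iff_diff_eq_0)

lemma tensor_coef_tensor: "tensor_coef \<kappa> \<mu> (P \<otimes>\<^sub>\<Lambda> Q) = coef \<kappa> P * coef \<mu> Q"
  by transfer (simp add: pair_gen_def pairs_coef_single Mul_inverse)

lemma tensor_coef_add: "tensor_coef \<kappa> \<mu> (s + t) = tensor_coef \<kappa> \<mu> s + tensor_coef \<kappa> \<mu> t"
  by transfer (rule pairs_coef_add)

lemma tensor_coef_scale: "tensor_coef \<kappa> \<mu> (tensor_const c * t) = c * tensor_coef \<kappa> \<mu> t"
  by transfer (rule pairs_coef_scale)

lemma tensor_coef_0: "tensor_coef \<kappa> \<mu> 0 = 0"
  by transfer (rule pairs_coef_0)

lemma tensor_coef_sum: "tensor_coef \<kappa> \<mu> (\<Sum>i\<in>I. t i) = (\<Sum>i\<in>I. tensor_coef \<kappa> \<mu> (t i))"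
  by (induction I rule: infinite_finite_induct) (simp_all add: tensor_coef_0 tensor_coef_add)

lemma tensor_coef_combination:
  assumes "finite S"
  shows "tensor_coef \<kappa> \<mu> (\<Sum>(\<kappa>', \<mu>')\<in>S. tensor_const (c (\<kappa>', \<mu>')) * (double_schur \<kappa>' \<otimes>\<^sub>\<Lambda> double_schur \<mu>')) =
    (if (\<kappa>, \<mu>) \<in> S then c (\<kappa>, \<mu>) else 0)"
proof -
  have "tensor_coef \<kappa> \<mu> (\<Sum>(\<kappa>', \<mu>')\<in>S. tensor_const (c (\<kappa>', \<mu>')) * (double_schur \<kappa>' \<otimes>\<^sub>\<Lambda> double_schur \<mu>')) =
      (\<Sum>p\<in>S. if p = (\<kappa>, \<mu>) then c p else 0)"
    unfolding tensor_coef_sum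
    by (rule sum.cong) (auto simp: tensor_coef_scale tensor_coef_tensor coef_double_schur split: if_splits)
  then show ?thesis using assms by simp
qed

section \<open>The comultiplication\<close>

text \<open>The first sum is the staircase coefficient of the kernel times the Vandermonde product.
  Its coordinates in the basis are \<open>chi \<nu> (dser \<mu>)\<close>, so it equals s_\<nu>(x||a)
  plus terms of smaller size: unitriangularity on the dual side expresses the basis through the
  h_\<beta>.\<close>

lemma double_schur_eq_hmono:
  "double_schur \<nu> = (\<Sum>(u, v)\<in>mono_splits (mono_of (plength \<nu>) (stair (plength \<nu>) \<nu>)).
      lam_const (mcoeff (vdm (plength \<nu>) PS_Var) u) * hmono v) -
    (\<Sum>\<mu> | psize \<mu> < psize \<nu>. lam_const (chi \<nu> (dser \<mu>)) * double_schur \<mu>)"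
proof -
  let ?n = "plength \<nu>" let ?\<gamma> = "mono_of ?n (stair ?n \<nu>)"
  let ?W = "\<Sum>(u, v)\<in>mono_splits ?\<gamma>. lam_const (mcoeff (vdm ?n PS_Var) u) * hmono v"
  have coef: "coef \<mu> ?W = chi \<nu> (dser \<mu>)" for \<mu>
  proof -
    have "chi \<nu> (dser \<mu>) = (\<Sum>(u, v)\<in>mono_splits ?\<gamma>. mcoeff (vdm ?n PS_Var) u * coef \<mu> (hmono v))"
      unfolding chi_def mcoeff_mult
    proof (rule sum.cong[OF refl], clarify)
      fix u v assume "(u, v) \<in> mono_splits ?\<gamma>"
      then have "u + v = ?\<gamma>" by simp
      then have "Poly_Mapping.keys v \<subseteq> {1..?n}" using keys_mono_of[of ?n "stair ?n \<nu>"] keys_add_nat[of u v] by auto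
      then have "mcoeff (PS_restrict {1..?n} (dser \<mu>)) v = coef \<mu> (hmono v)"
        by (subst mcoeff_dser[symmetric]) (auto simp: mcoeff_PS_restrict)
      then show "mcoeff (vdm ?n PS_Var) u * mcoeff (PS_restrict {1..?n} (dser \<mu>)) v =
          mcoeff (vdm ?n PS_Var) u * coef \<mu> (hmono v)" by simp
    qed
    then show ?thesis by (simp add: coef_sum coef_scale case_prod_unfold)
  qed
  \<comment> \<open>By homogeneity of the Vandermonde product only h_v with |v| = |\<nu>|
    occur.\<close>
  have deg: "lam_deg ?W (psize \<nu>)"
    unfolding lam_deg_def lam_seq.hom_sum
  proof (intro allI deg_le_sum, clarify)
    fix n u v assume "(u, v) \<in> mono_splits ?\<gamma>"
    then have "mono_deg u + mono_deg v = psize \<nu> + tri ?n"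
      using sum_stair[of \<nu> ?n] by (simp add: mono_deg_mono_of flip: mono_deg_add)
    then have "mcoeff (vdm ?n PS_Var) u = (0 :: qa) \<or> mono_deg v = psize \<nu>"
      using homogeneous_vdm[of ?n, where 'c = qa] unfolding homogeneous_def by fastforce
    then show "deg_le (lam_seq (lam_const (mcoeff (vdm ?n PS_Var) u) * hmono v) n) (psize \<nu>)"
    proof
      assume "mcoeff (vdm ?n PS_Var) u = (0 :: qa)"
      then show ?thesis by (simp add: lam_const.hom_zero lam_seq.hom_zero)
    next
      assume "mono_deg v = psize \<nu>"
      with hmono_deg[of v] have "deg_le (lam_seq (hmono v) n) (psize \<nu>)" unfolding lam_deg_def by simp
      from deg_le_mult[OF deg_le_Const[of _ 0] this] show ?thesis
        by (simp add: lam_seq.hom_mult lam_seq_lam_const)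
    qed
  qed
  have fin: "finite {\<mu>. psize \<mu> < psize \<nu>}"
    by (rule finite_subset[OF _ finite_psize[of "psize \<nu>"]]) auto
  have "?W = (\<Sum>\<mu> | psize \<mu> \<le> psize \<nu>. lam_const (chi \<nu> (dser \<mu>)) * double_schur \<mu>)"
    using coef_expansion[OF deg] unfolding coef .
  also have "\<dots> = (\<Sum>\<mu>\<in>insert \<nu> {\<mu>. psize \<mu> < psize \<nu>}. lam_const (chi \<nu> (dser \<mu>)) * double_schur \<mu>)"
    by (rule sum.mono_neutral_right) (auto simp: finite_psize chi_dser lam_const.hom_zero)
  also have "\<dots> = double_schur \<nu> + (\<Sum>\<mu> | psize \<mu> < psize \<nu>. lam_const (chi \<nu> (dser \<mu>)) * double_schur \<mu>)"
    using fin by (simp add: chi_dser lam_const.hom_one)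
  finally show ?thesis by simp
qed

text \<open>Induction on the size of the partition with \<open>double_schur_eq_hmono\<close> reaches
  the double Schur functions, and these span.\<close>

lemma lam_induct [case_names zero add scale hmono]:
  assumes zero: "\<Phi> 0" and add: "\<And>P Q. \<Phi> P \<Longrightarrow> \<Phi> Q \<Longrightarrow> \<Phi> (P + Q)"
    and scale: "\<And>c P. \<Phi> P \<Longrightarrow> \<Phi> (lam_const c * P)"
    and hmono: "\<And>\<beta>. 0 \<notin> Poly_Mapping.keys \<beta> \<Longrightarrow> \<Phi> (hmono \<beta>)"
  shows "\<Phi> P"
proof -
  have sum: "\<Phi> (\<Sum>i\<in>I. F i)" if "\<And>i. i \<in> I \<Longrightarrow> \<Phi> (F i)" for I and F :: "'i \<Rightarrow> lam"
    using that by (induction I rule: infinite_finite_induct) (auto intro: zero add)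
  have minus: "\<Phi> (P - Q)" if "\<Phi> P" "\<Phi> Q" for P Q
  proof -
    have "\<Phi> (P + lam_const (- 1) * Q)" by (intro add scale that)
    then show ?thesis by (simp add: lam_const.hom_uminus lam_const.hom_one)
  qed
  have schur: "\<Phi> (double_schur \<nu>)" for \<nu>
  proof (induction "psize \<nu>" arbitrary: \<nu> rule: less_induct)
    case less
    show ?case
    proof (subst double_schur_eq_hmono, intro minus sum scale, clarify)
      fix u v assume "(u, v) \<in> mono_splits (mono_of (plength \<nu>) (stair (plength \<nu>) \<nu>))"
      then have "u + v = mono_of (plength \<nu>) (stair (plength \<nu>) \<nu>)" by simp
      then have "Poly_Mapping.keys v \<subseteq> {1..plength \<nu>}"
        using keys_mono_of[of "plength \<nu>" "stair (plength \<nu>) \<nu>"] keys_add_nat[of u v] by auto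
      then have "0 \<notin> Poly_Mapping.keys v" by auto
      then show "\<Phi> (lam_const (mcoeff (vdm (plength \<nu>) PS_Var) u) * hmono v)"
        by (intro scale hmono)
    qed (use less in auto)
  qed
  obtain d where "lam_deg P d" using lam_deg_exists by blast
  then show ?thesis by (subst coef_expansion) (auto intro!: sum scale schur)
qed

text \<open>Structure constants of the dual Schur functions, fixed before their relation to the
  comultiplication is known.\<close>

definition lr :: "partition \<Rightarrow> partition \<Rightarrow> partition \<Rightarrow> qa"
  where "lr \<kappa> \<mu> = (SOME c. has_formal_sum (\<lambda>\<nu>. PS_Const (c \<nu>) * dser \<nu>) (dser \<kappa> * dser \<mu>))"

lemma lr: "has_formal_sum (\<lambda>\<nu>. PS_Const (lr \<kappa> \<mu> \<nu>) * dser \<nu>) (dser \<kappa> * dser \<mu>)"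
proof -
  have "\<exists>c. has_formal_sum (\<lambda>\<nu>. PS_Const (c \<nu>) * dser \<nu>) (dser \<kappa> * dser \<mu>)"
    by (rule sym_series_expansion)
      (simp_all add: graded_family_dser sym_series_dser chi_dser sym_series_mult)
  from someI_ex[OF this] show ?thesis unfolding lr_def .
qed

lemma mcoeff_dser_mult:
  assumes "mono_deg m \<le> N"
  shows "mcoeff (dser \<kappa> * dser \<mu>) m = (\<Sum>\<nu> | psize \<nu> \<le> N. lr \<kappa> \<mu> \<nu> * mcoeff (dser \<nu>) m)"
proof -
  have "mcoeff (dser \<kappa> * dser \<mu>) m = (\<Sum>\<nu> | psize \<nu> \<le> mono_deg m. lr \<kappa> \<mu> \<nu> * mcoeff (dser \<nu>) m)"
    using lr[of \<kappa> \<mu>] unfolding has_formal_sum_graded[OF graded_family_dser] by blast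
  also have "\<dots> = (\<Sum>\<nu> | psize \<nu> \<le> N. lr \<kappa> \<mu> \<nu> * mcoeff (dser \<nu>) m)"
    by (rule sum.mono_neutral_left) (use assms in \<open>auto simp: finite_psize dser_deg\<close>)
  finally show ?thesis .
qed

text \<open>The product starts in degree |\<kappa>| + |\<mu>|, so \<open>chi \<nu>\<close> vanishes
  on it; in the expansion, induction on size leaves only the term of \<nu>. Consequently the image
  of s_\<nu>(x||a) is a finite sum.\<close>

lemma lr_eq_0:
  assumes "psize \<nu> < psize \<kappa> + psize \<mu>"
  shows "lr \<kappa> \<mu> \<nu> = 0"
  using assms
proof (induction "psize \<nu>" arbitrary: \<nu> rule: less_induct)
  case less
  have "chi \<nu> (dser \<kappa> * dser \<mu>) = chi \<nu> (\<Sum>\<rho> | psize \<rho> \<le> psize \<nu>. PS_Const (lr \<kappa> \<mu> \<rho>) * dser \<rho>)"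
    by (rule chi_cong) (simp add: mcoeff_dser_mult)
  also have "\<dots> = (\<Sum>\<rho> | psize \<rho> \<le> psize \<nu>. lr \<kappa> \<mu> \<rho> * chi \<nu> (dser \<rho>))"
    by (rule chi_combination)
  also have "\<dots> = (\<Sum>\<rho>\<in>{\<nu>}. lr \<kappa> \<mu> \<rho> * chi \<nu> (dser \<rho>))"
  proof (rule sum.mono_neutral_right[OF finite_psize])
    show "\<forall>\<rho>\<in>{\<rho>. psize \<rho> \<le> psize \<nu>} - {\<nu>}. lr \<kappa> \<mu> \<rho> * chi \<nu> (dser \<rho>) = 0"
    proof
      fix \<rho> assume "\<rho> \<in> {\<rho>. psize \<rho> \<le> psize \<nu>} - {\<nu>}"
      then have "psize \<rho> < psize \<nu> \<or> psize \<nu> \<le> psize \<rho> \<and> \<nu> \<noteq> \<rho>" by auto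
      then show "lr \<kappa> \<mu> \<rho> * chi \<nu> (dser \<rho>) = 0"
      proof
        assume "psize \<rho> < psize \<nu>"
        then have "lr \<kappa> \<mu> \<rho> = 0" using less.prems by (intro less.hyps) simp_all
        then show ?thesis by simp
      qed (simp add: chi_dser)
    qed
  qed simp
  also have "\<dots> = lr \<kappa> \<mu> \<nu>" by (simp add: chi_dser)
  also have "chi \<nu> (dser \<kappa> * dser \<mu>) = chi \<nu> 0"
  proof (rule chi_cong)
    fix m :: "nat \<Rightarrow>\<^sub>0 nat" assume m: "mono_deg m = psize \<nu>"
    have "mcoeff (dser \<kappa> * dser \<mu>) m = 0"
    proof (rule mcoeff_mult_eq_0)
      fix u v assume "u + v = m"
      then have "mono_deg u < psize \<kappa> \<or> mono_deg v < psize \<mu>"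
        using m less.prems by (auto simp: mono_deg_add)
      then show "mcoeff (dser \<kappa>) u * mcoeff (dser \<mu>) v = 0" using dser_deg by auto
    qed
    then show "mcoeff (dser \<kappa> * dser \<mu>) m = mcoeff 0 m" by simp
  qed
  also have "chi \<nu> 0 = 0" using chi_diff[of \<nu> 0 0] by simp
  finally show ?case by simp
qed

definition comult_schur :: "partition \<Rightarrow> lam_tensor"
  where "comult_schur \<nu> = (\<Sum>(\<kappa>, \<mu>)\<in>{\<kappa>. psize \<kappa> \<le> psize \<nu>} \<times> {\<mu>. psize \<mu> \<le> psize \<nu>}.
    tensor_const (lr \<kappa> \<mu> \<nu>) * (double_schur \<kappa> \<otimes>\<^sub>\<Lambda> double_schur \<mu>))"

definition comult' :: "lam \<Rightarrow> lam_tensor"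
  where "comult' P = (\<Sum>\<nu> | coef \<nu> P \<noteq> 0. tensor_const (coef \<nu> P) * comult_schur \<nu>)"

text \<open>Provides one range of summation for all partitions up to a given size.\<close>

lemma comult_schur_eq:
  assumes "psize \<nu> \<le> N"
  shows "comult_schur \<nu> = (\<Sum>(\<kappa>, \<mu>)\<in>{\<kappa>. psize \<kappa> \<le> N} \<times> {\<mu>. psize \<mu> \<le> N}.
    tensor_const (lr \<kappa> \<mu> \<nu>) * (double_schur \<kappa> \<otimes>\<^sub>\<Lambda> double_schur \<mu>))"
  unfolding comult_schur_def
proof (rule sum.mono_neutral_left)
  show "\<forall>p\<in>{\<kappa>. psize \<kappa> \<le> N} \<times> {\<mu>. psize \<mu> \<le> N} - {\<kappa>. psize \<kappa> \<le> psize \<nu>} \<times> {\<mu>. psize \<mu> \<le> psize \<nu>}.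
      (case p of (\<kappa>, \<mu>) \<Rightarrow> tensor_const (lr \<kappa> \<mu> \<nu>) * (double_schur \<kappa> \<otimes>\<^sub>\<Lambda> double_schur \<mu>)) = 0"
  proof
    fix p assume *: "p \<in> {\<kappa>. psize \<kappa> \<le> N} \<times> {\<mu>. psize \<mu> \<le> N} - {\<kappa>. psize \<kappa> \<le> psize \<nu>} \<times> {\<mu>. psize \<mu> \<le> psize \<nu>}"
    obtain \<kappa> \<mu> where p: "p = (\<kappa>, \<mu>)" by (cases p)
    with * have "psize \<nu> < psize \<kappa> + psize \<mu>" by auto
    then show "(case p of (\<kappa>, \<mu>) \<Rightarrow> tensor_const (lr \<kappa> \<mu> \<nu>) * (double_schur \<kappa> \<otimes>\<^sub>\<Lambda> double_schur \<mu>)) = 0"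
      by (simp add: p lr_eq_0 tensor_const_0)
  qed
qed (use assms in \<open>auto simp: finite_psize\<close>)

lemma comult'_eq:
  assumes "lam_deg P d"
  shows "comult' P = (\<Sum>\<nu> | psize \<nu> \<le> d. tensor_const (coef \<nu> P) * comult_schur \<nu>)"
  unfolding comult'_def
proof (rule sum.mono_neutral_left[OF finite_psize])
  show "{\<nu>. coef \<nu> P \<noteq> 0} \<subseteq> {\<nu>. psize \<nu> \<le> d}"
    using coef_eq_0[OF assms] by (auto simp: not_less[symmetric])
qed (auto simp: tensor_const_0)

lemma comult'_add: "comult' (P + Q) = comult' P + comult' Q"
proof -
  obtain d e where "lam_deg P d" "lam_deg Q e" using lam_deg_exists by metis
  then have d: "lam_deg P (max d e)" "lam_deg Q (max d e)" using lam_deg_mono by auto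
  then have "lam_deg (P + Q) (max d e)" by (simp add: lam_deg_def lam_seq.hom_add deg_le_add)
  with d show ?thesis
    by (simp add: comult'_eq coef_add tensor_const_add distrib_right sum.distrib)
qed

lemma comult'_scale: "comult' (lam_const c * P) = tensor_const c * comult' P"
proof -
  obtain d where d: "lam_deg P d" using lam_deg_exists by metis
  have "lam_deg (lam_const c * P) d"
    unfolding lam_deg_def
  proof
    fix n
    have "deg_le (lam_seq P n) d" using d by (simp add: lam_deg_def)
    from deg_le_mult[OF deg_le_Const[of c 0] this] show "deg_le (lam_seq (lam_const c * P) n) d"
      by (simp add: lam_seq.hom_mult lam_seq_lam_const)
  qed
  with d show ?thesis
    by (simp add: comult'_eq coef_scale tensor_const_mult sum_distrib_left mult.assoc)
qed

lemma comult'_sum: "comult' (\<Sum>i\<in>I. F i) = (\<Sum>i\<in>I. comult' (F i))"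
proof -
  have "comult' 0 = 0" using comult'_add[of 0 0] by simp
  then show ?thesis by (induction I rule: infinite_finite_induct) (simp_all add: comult'_add)
qed

text \<open>The coefficient at s_\<kappa> \<otimes> s_\<mu> is the sum over \<nu> of
  \<open>lr \<kappa> \<mu> \<nu>\<close> times the coefficient of y^\<beta> in
  \<open>dser \<nu>\<close>. This is the coefficient of y^\<beta> in
  \<open>dser \<kappa> * dser \<mu>\<close>, and multiplying the two series splits \<beta>.\<close>

lemma comult'_hmono:
  assumes \<beta>: "0 \<notin> Poly_Mapping.keys \<beta>"
  shows "comult' (hmono \<beta>) = (\<Sum>(u, v)\<in>mono_splits \<beta>. hmono u \<otimes>\<^sub>\<Lambda> hmono v)"
proof -
  let ?N = "mono_deg \<beta>"
  let ?S = "{\<kappa>. psize \<kappa> \<le> ?N}"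
  let ?t = "\<lambda>\<kappa> \<mu>. double_schur \<kappa> \<otimes>\<^sub>\<Lambda> double_schur \<mu>"
  have "comult' (hmono \<beta>) = (\<Sum>\<nu>\<in>?S. tensor_const (mcoeff (dser \<nu>) \<beta>) *
      (\<Sum>(\<kappa>, \<mu>)\<in>?S \<times> ?S. tensor_const (lr \<kappa> \<mu> \<nu>) * ?t \<kappa> \<mu>))"
    unfolding comult'_eq[OF hmono_deg]
    by (rule sum.cong) (simp_all add: mcoeff_dser[OF \<beta>] comult_schur_eq[of _ ?N])
  \<comment> \<open>Exchanging the sums forms the coefficient at each pair first.\<close>
  also have "\<dots> = (\<Sum>p\<in>?S \<times> ?S. \<Sum>\<nu>\<in>?S. tensor_const (lr (fst p) (snd p) \<nu> * mcoeff (dser \<nu>) \<beta>) * ?t (fst p) (snd p))"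
    unfolding sum_distrib_left case_prod_unfold
    by (subst sum.swap) (simp add: tensor_const_mult mult_ac)
  also have "\<dots> = (\<Sum>p\<in>?S \<times> ?S. tensor_const (mcoeff (dser (fst p) * dser (snd p)) \<beta>) * ?t (fst p) (snd p))"
    by (simp add: mcoeff_dser_mult[OF order_refl] tensor_const_sum sum_distrib_right)
  also have "\<dots> = (\<Sum>p\<in>?S \<times> ?S. \<Sum>(u, v)\<in>mono_splits \<beta>.
      (lam_const (coef (fst p) (hmono u)) * double_schur (fst p)) \<otimes>\<^sub>\<Lambda> (lam_const (coef (snd p) (hmono v)) * double_schur (snd p)))"
  proof (rule sum.cong[OF refl])
    fix p
    have "tensor_const (mcoeff (dser (fst p) * dser (snd p)) \<beta>) * ?t (fst p) (snd p) =
        (\<Sum>(u, v)\<in>mono_splits \<beta>. tensor_const (mcoeff (dser (fst p)) u * mcoeff (dser (snd p)) v) * ?t (fst p) (snd p))"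
      unfolding mcoeff_mult by (simp add: tensor_const_sum sum_distrib_right case_prod_unfold)
    also have "\<dots> = (\<Sum>(u, v)\<in>mono_splits \<beta>.
      (lam_const (coef (fst p) (hmono u)) * double_schur (fst p)) \<otimes>\<^sub>\<Lambda> (lam_const (coef (snd p) (hmono v)) * double_schur (snd p)))"
    proof (rule sum.cong[OF refl], clarify)
      fix u v assume "(u, v) \<in> mono_splits \<beta>"
      then have "0 \<notin> Poly_Mapping.keys u" "0 \<notin> Poly_Mapping.keys v"
        using \<beta> by (auto simp: keys_add_nat)
      then show "tensor_const (mcoeff (dser (fst p)) u * mcoeff (dser (snd p)) v) * ?t (fst p) (snd p) =
          (lam_const (coef (fst p) (hmono u)) * double_schur (fst p)) \<otimes>\<^sub>\<Lambda> (lam_const (coef (snd p) (hmono v)) * double_schur (snd p))"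
        unfolding tensor_scale_left tensor_scale_right tensor_const_mult
        by (simp add: mcoeff_dser mult_ac)
    qed
    finally show "tensor_const (mcoeff (dser (fst p) * dser (snd p)) \<beta>) * ?t (fst p) (snd p) = \<dots>" .
  qed
  also have "\<dots> = (\<Sum>(u, v)\<in>mono_splits \<beta>. \<Sum>p\<in>?S \<times> ?S.
      (lam_const (coef (fst p) (hmono u)) * double_schur (fst p)) \<otimes>\<^sub>\<Lambda> (lam_const (coef (snd p) (hmono v)) * double_schur (snd p)))"
    unfolding case_prod_unfold by (rule sum.swap)
  also have "\<dots> = (\<Sum>(u, v)\<in>mono_splits \<beta>. hmono u \<otimes>\<^sub>\<Lambda> hmono v)"
  proof (rule sum.cong[OF refl], clarify)
    fix u v assume "(u, v) \<in> mono_splits \<beta>"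
    then have le: "mono_deg u \<le> ?N" "mono_deg v \<le> ?N" by (auto simp: mono_deg_add)
    have "hmono u \<otimes>\<^sub>\<Lambda> hmono v =
        (\<Sum>\<kappa>\<in>?S. lam_const (coef \<kappa> (hmono u)) * double_schur \<kappa>) \<otimes>\<^sub>\<Lambda> (\<Sum>\<mu>\<in>?S. lam_const (coef \<mu> (hmono v)) * double_schur \<mu>)"
      using coef_expansion[OF lam_deg_mono[OF hmono_deg le(1)]] coef_expansion[OF lam_deg_mono[OF hmono_deg le(2)]]
      by simp
    also have "\<dots> = (\<Sum>p\<in>?S \<times> ?S.
      (lam_const (coef (fst p) (hmono u)) * double_schur (fst p)) \<otimes>\<^sub>\<Lambda> (lam_const (coef (snd p) (hmono v)) * double_schur (snd p)))"
      unfolding tensor_sum_left unfolding tensor_sum_right sum.cartesian_product by (simp only: case_prod_unfold)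
    finally show "(\<Sum>p\<in>?S \<times> ?S.
      (lam_const (coef (fst p) (hmono u)) * double_schur (fst p)) \<otimes>\<^sub>\<Lambda> (lam_const (coef (snd p) (hmono v)) * double_schur (snd p))) =
      hmono u \<otimes>\<^sub>\<Lambda> hmono v" by simp
  qed
  finally show ?thesis .
qed

section \<open>Multiplicativity of the map\<close>

definition hlam_comult :: "nat \<Rightarrow> lam_tensor"
  where "hlam_comult k = (\<Sum>r\<in>{0..k}. hlam r \<otimes>\<^sub>\<Lambda> hlam (k - r))"

lemma hmono_add_single:
  assumes "i \<notin> Poly_Mapping.keys \<beta>"
  shows "hmono (\<beta> + Poly_Mapping.single i k) = hmono \<beta> * hlam k"
proof -
  let ?A = "insert i (Poly_Mapping.keys \<beta>)"
  have sub: "Poly_Mapping.keys (\<beta> + Poly_Mapping.single i k) \<subseteq> ?A"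
    by (auto simp: keys_add_nat)
  have "hmono (\<beta> + Poly_Mapping.single i k) =
      hlam k * (\<Prod>j\<in>Poly_Mapping.keys \<beta>. hlam (Poly_Mapping.lookup (\<beta> + Poly_Mapping.single i k) j))"
    using assms by (subst hmono_superset[OF _ sub]) (auto simp: lookup_add in_keys_iff)
  also have "(\<Prod>j\<in>Poly_Mapping.keys \<beta>. hlam (Poly_Mapping.lookup (\<beta> + Poly_Mapping.single i k) j)) = hmono \<beta>"
    unfolding hmono_def by (rule prod.cong) (use assms in \<open>auto simp: lookup_add lookup_single when_def\<close>)
  finally show ?thesis by (simp add: mult.commute)
qed

lemma update_0_add_single: "Poly_Mapping.update i 0 u + Poly_Mapping.single i (Poly_Mapping.lookup u i) = u"
  by (rule poly_mapping_eqI) (auto simp: lookup_add lookup_update lookup_single when_def)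

lemma comult'_hmono_add_single:
  assumes \<beta>: "0 \<notin> Poly_Mapping.keys \<beta>" and i: "i \<notin> Poly_Mapping.keys \<beta>" "i \<noteq> 0"
  shows "comult' (hmono (\<beta> + Poly_Mapping.single i k)) = comult' (hmono \<beta>) * hlam_comult k"
proof -
  let ?s = "\<lambda>r. Poly_Mapping.single i r"
  let ?g = "\<lambda>((u :: nat \<Rightarrow>\<^sub>0 nat, v :: nat \<Rightarrow>\<^sub>0 nat), r). (u + ?s r, v + ?s (k - r))"
  let ?h = "\<lambda>(u :: nat \<Rightarrow>\<^sub>0 nat, v :: nat \<Rightarrow>\<^sub>0 nat). ((Poly_Mapping.update i 0 u, Poly_Mapping.update i 0 v), Poly_Mapping.lookup u i)"
  have "0 \<notin> Poly_Mapping.keys (\<beta> + ?s k)" using \<beta> i by (auto simp: keys_add_nat)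
  then have "comult' (hmono (\<beta> + ?s k)) = (\<Sum>(u, v)\<in>mono_splits (\<beta> + ?s k). hmono u \<otimes>\<^sub>\<Lambda> hmono v)"
    by (rule comult'_hmono)
  also have "\<dots> = (\<Sum>((u, v), r)\<in>mono_splits \<beta> \<times> {0..k}. (hmono u \<otimes>\<^sub>\<Lambda> hmono v) * (hlam r \<otimes>\<^sub>\<Lambda> hlam (k - r)))"
  proof (rule sum.reindex_bij_witness[of _ ?g ?h])
    fix p assume "p \<in> mono_splits (\<beta> + ?s k)"
    then obtain u v where p: "p = (u, v)" and uv: "u + v = \<beta> + ?s k" by (cases p) auto
    have look: "Poly_Mapping.lookup u j + Poly_Mapping.lookup v j = Poly_Mapping.lookup \<beta> j + Poly_Mapping.lookup (?s k) j" for j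
      using arg_cong[OF uv, of "\<lambda>m. Poly_Mapping.lookup m j"] by (simp add: lookup_add)
    have \<beta>i: "Poly_Mapping.lookup \<beta> i = 0" using i by (simp add: in_keys_iff)
    have k: "Poly_Mapping.lookup u i + Poly_Mapping.lookup v i = k" using look[of i] \<beta>i by simp
    then have kv: "k - Poly_Mapping.lookup u i = Poly_Mapping.lookup v i" by simp
    show gh: "?g (?h p) = p" by (simp add: p kv update_0_add_single)
    have "Poly_Mapping.update i 0 u + Poly_Mapping.update i 0 v = \<beta>"
    proof (rule poly_mapping_eqI)
      fix j
      show "Poly_Mapping.lookup (Poly_Mapping.update i 0 u + Poly_Mapping.update i 0 v) j = Poly_Mapping.lookup \<beta> j"
        using look[of j] \<beta>i by (cases "j = i") (simp_all add: lookup_add lookup_update lookup_single)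
    qed
    with k show "?h p \<in> mono_splits \<beta> \<times> {0..k}" by (simp add: p)
    have "i \<notin> Poly_Mapping.keys (Poly_Mapping.update i 0 u)" "i \<notin> Poly_Mapping.keys (Poly_Mapping.update i 0 v)"
      by (simp_all add: in_keys_iff lookup_update)
    then have "hmono u = hmono (Poly_Mapping.update i 0 u) * hlam (Poly_Mapping.lookup u i)"
      "hmono v = hmono (Poly_Mapping.update i 0 v) * hlam (Poly_Mapping.lookup v i)"
      by (simp_all add: update_0_add_single flip: hmono_add_single)
    then show "(\<lambda>((u, v), r). (hmono u \<otimes>\<^sub>\<Lambda> hmono v) * (hlam r \<otimes>\<^sub>\<Lambda> hlam (k - r))) (?h p) =
        (\<lambda>(u, v). hmono u \<otimes>\<^sub>\<Lambda> hmono v) p"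
      by (simp add: p tensor_mult kv)
  next
    fix q assume "q \<in> mono_splits \<beta> \<times> {0..k}"
    then obtain u v r where q: "q = ((u, v), r)" and uv: "u + v = \<beta>" and r: "r \<le> k" by auto
    have "i \<notin> Poly_Mapping.keys u" "i \<notin> Poly_Mapping.keys v" using i uv keys_add_nat[of u v] by auto
    then have z: "Poly_Mapping.lookup u i = 0" "Poly_Mapping.lookup v i = 0" by (simp_all add: in_keys_iff)
    have "Poly_Mapping.update i 0 (w + ?s l) = w" if "Poly_Mapping.lookup w i = 0" for w :: "nat \<Rightarrow>\<^sub>0 nat" and l
      by (rule poly_mapping_eqI) (use that in \<open>auto simp: lookup_add lookup_update lookup_single when_def\<close>)
    with z show "?h (?g q) = q" by (simp add: q lookup_add)
    have "u + ?s r + (v + ?s (k - r)) = \<beta> + (?s r + ?s (k - r))" by (simp add: uv[symmetric] add_ac)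
    also have "?s r + ?s (k - r) = ?s k" unfolding single_add[symmetric] using r by simp
    finally show "?g q \<in> mono_splits (\<beta> + ?s k)" by (simp add: q)
  qed
  also have "\<dots> = (\<Sum>(u, v)\<in>mono_splits \<beta>. hmono u \<otimes>\<^sub>\<Lambda> hmono v) * hlam_comult k"
    unfolding hlam_comult_def sum_product sum.cartesian_product by (simp only: case_prod_unfold)
  finally show ?thesis by (simp add: comult'_hmono[OF \<beta>])
qed

lemma hmono_0: "hmono 0 = 1"
  by (simp add: hmono_def)

lemma comult'_1: "comult' 1 = 1 \<otimes>\<^sub>\<Lambda> 1"
proof -
  have z: "u = 0 \<and> v = 0" if "u + v = 0" for u v :: "nat \<Rightarrow>\<^sub>0 nat"
  proof -
    have "Poly_Mapping.keys u \<union> Poly_Mapping.keys v = {}"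
      unfolding keys_add_nat[symmetric] that by simp
    then show ?thesis by simp
  qed
  have "mono_splits 0 = {(0, 0 :: nat \<Rightarrow>\<^sub>0 nat)}"
  proof (intro equalityI subsetI)
    fix p :: "(nat \<Rightarrow>\<^sub>0 nat) \<times> (nat \<Rightarrow>\<^sub>0 nat)" assume "p \<in> mono_splits 0"
    then obtain u v where p: "p = (u, v)" and "u + v = 0" by (cases p) simp
    from z[OF this(2)] show "p \<in> {(0, 0)}" unfolding p by simp
  qed simp
  moreover have "comult' (hmono 0) = (\<Sum>(u, v)\<in>mono_splits 0. hmono u \<otimes>\<^sub>\<Lambda> hmono v)"
    by (rule comult'_hmono) simp
  ultimately show ?thesis by (simp add: hmono_0)
qed

lemma comult'_hlam: "comult' (hlam k) = hlam_comult k"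
proof -
  have "hmono (0 + Poly_Mapping.single 1 k) = hlam k"
    by (subst hmono_add_single) (simp_all add: hmono_0)
  moreover have "comult' (hmono (0 + Poly_Mapping.single 1 k)) = comult' (hmono 0) * hlam_comult k"
    by (rule comult'_hmono_add_single) simp_all
  ultimately show ?thesis by (simp only: hmono_0 comult'_1 tensor_unit)
qed

lemma comult'_hlam_mult: "comult' (hlam k * Q) = comult' (hlam k) * comult' Q"
proof (induction Q rule: lam_induct)
  case zero
  have "comult' 0 = 0" using comult'_add[of 0 0] by simp
  then show ?case by simp
next
  case (add P Q)
  then show ?case by (simp add: distrib_left comult'_add)
next
  case (scale c P)
  then show ?case by (simp add: mult.left_commute[of _ "lam_const c"] mult.left_commute[of _ "tensor_const c"] comult'_scale)
next
  case (hmono \<beta>)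
  \<comment> \<open>Index 0 is avoided as well, since \<open>dser\<close> has no terms in that
    variable.\<close>
  obtain i where "i \<notin> insert 0 (Poly_Mapping.keys \<beta>)"
    using ex_new_if_finite[OF infinite_UNIV_nat, of "insert 0 (Poly_Mapping.keys \<beta>)"] by auto
  then have i: "i \<notin> Poly_Mapping.keys \<beta>" "i \<noteq> 0" by auto
  show ?case
    using comult'_hmono_add_single[OF hmono i, of k]
    by (simp add: hmono_add_single[OF i(1)] comult'_hlam mult.commute)
qed

text \<open>It suffices that multiplication by each \<open>hlam k\<close> is respected, since these generate the ring; and
  \<open>hlam k * hmono \<beta>\<close> is again of the form \<open>hmono \<beta>'\<close>, with a fresh variable for the exponent \<open>k\<close>.\<close>

lemma comult'_mult: "comult' (P * Q) = comult' P * comult' Q"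
proof (induction P arbitrary: Q rule: lam_induct)
  case zero
  have "comult' 0 = 0" using comult'_add[of 0 0] by simp
  then show ?case by simp
next
  case (add P P')
  then show ?case by (simp add: distrib_right comult'_add)
next
  case (scale c P)
  then show ?case by (simp add: mult.assoc comult'_scale)
next
  case (hmono \<beta>)
  have "comult' ((\<Prod>j\<in>A. hlam (f j)) * Q) = comult' (\<Prod>j\<in>A. hlam (f j)) * comult' Q" if "finite A" for A :: "nat set" and f Q
    using that
    by (induction A rule: finite_induct)
      (simp_all add: comult'_1 tensor_unit mult.assoc comult'_hlam_mult)
  then show ?case unfolding hmono_def by simp
qed

section \<open>Newton's identities and primitivity of the power sums\<close>

lemma geo_deriv: "fps_X * fps_deriv (geo x) = (geo x - 1) * geo (x :: 'r::comm_ring_1)"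
proof -
  have X: "fps_const x * fps_X * geo x = geo x - 1"
    using geo_mult[of x] by (simp add: algebra_simps)
  have "fps_deriv (geo x) * (1 - fps_const x * fps_X) = fps_const x * geo x"
  proof -
    have "fps_deriv (geo x * (1 - fps_const x * fps_X)) = 0" by (simp add: geo_mult)
    then show ?thesis by (simp add: algebra_simps)
  qed
  then have "fps_deriv (geo x) * (geo x * (1 - fps_const x * fps_X)) = fps_const x * geo x * geo x"
    by (metis mult.assoc mult.left_commute mult.commute)
  then have "fps_deriv (geo x) = fps_const x * geo x * geo x" by (simp add: geo_mult)
  then have "fps_X * fps_deriv (geo x) = (fps_const x * fps_X * geo x) * geo x" by (simp add: mult_ac)
  then show ?thesis by (simp only: X)
qed

text \<open>The logarithmic derivative of one factor of the kernel, cleared of denominators.\<close>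

lemma hser_factor_deriv:
  fixes x c :: "'r::comm_ring_1"
  defines "F \<equiv> (1 - fps_const c * fps_X) * geo x"
  shows "fps_X * fps_deriv F = (geo x - geo c) * F"
proof -
  have c: "geo c * (1 - fps_const c * fps_X) = 1" by (rule geo_mult)
  have "fps_X * fps_deriv F = (1 - fps_const c * fps_X) * (fps_X * fps_deriv (geo x)) - fps_const c * fps_X * geo x"
    by (simp add: F_def algebra_simps)
  also have "\<dots> = (1 - fps_const c * fps_X) * geo x * geo x - geo x"
    unfolding geo_deriv by (simp add: algebra_simps)
  also have "\<dots> = geo x * F - (geo c * (1 - fps_const c * fps_X)) * geo x"
    unfolding c by (simp add: F_def mult_ac)
  also have "\<dots> = geo x * F - geo c * F" by (simp only: F_def mult_ac)
  also have "\<dots> = (geo x - geo c) * F" by (simp only: left_diff_distrib)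
  finally show ?thesis .
qed

lemma hser_deriv:
  "fps_X * fps_deriv (hser n) = (\<Sum>i\<in>{1..n}. geo (Var i) - geo (Const (a (int i)))) * hser n"
proof (induction n)
  case (Suc n)
  let ?F = "(1 - fps_const (Const (a (int (Suc n)))) * fps_X) * geo (Var (Suc n)) :: xpoly fps"
  have h: "hser (Suc n) = hser n * ?F" by (simp add: hser_def)
  have "fps_X * fps_deriv (hser (Suc n)) = (fps_X * fps_deriv (hser n)) * ?F + hser n * (fps_X * fps_deriv ?F)"
    unfolding h fps_deriv_mult by (simp only: distrib_left mult_ac add.commute)
  also have "\<dots> = (\<Sum>i\<in>{1..n}. geo (Var i) - geo (Const (a (int i)))) * hser n * ?F +
      hser n * ((geo (Var (Suc n)) - geo (Const (a (int (Suc n))))) * ?F)"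
    unfolding Suc hser_factor_deriv ..
  also have "\<dots> = (\<Sum>i\<in>{1..Suc n}. geo (Var i) - geo (Const (a (int i)))) * hser (Suc n)"
  proof -
    have S: "(\<Sum>i\<in>{1..Suc n}. geo (Var i) - geo (Const (a (int i)))) =
        (\<Sum>i\<in>{1..n}. geo (Var i) - geo (Const (a (int i)))) + (geo (Var (Suc n)) - geo (Const (a (int (Suc n)))) :: xpoly fps)"
      by simp
    show ?thesis unfolding S h distrib_right by (simp only: mult_ac)
  qed
  finally show ?case .
qed (simp add: hser_def)

text \<open>X times the logarithmic derivative of the kernel is the generating series of the double
  power sums. The index 0 may be included because p_0 = 0.\<close>

lemma newton_hlam: "of_nat k * hlam k = (\<Sum>i\<in>{0..k}. power_sum i * hlam (k - i))"
proof (rule lam_eqI)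
  fix n
  have p: "lam_seq (power_sum i) n = fps_nth (\<Sum>j\<in>{1..n}. geo (Var j) - geo (Const (a (int j)))) i" for i
    by (simp add: power_sum.rep_eq fps_sum_nth)
  have "fps_nth (fps_X * fps_deriv (hser n)) k = of_nat k * fps_nth (hser n) k"
    by (cases k) (simp_all add: One_nat_def)
  then have "of_nat k * fps_nth (hser n) k = (\<Sum>i\<in>{0..k}. lam_seq (power_sum i) n * fps_nth (hser n) (k - i))"
    unfolding hser_deriv fps_mult_nth p by simp
  then show "lam_seq (of_nat k * hlam k) n = lam_seq (\<Sum>i\<in>{0..k}. power_sum i * hlam (k - i)) n"
    by (simp add: lam_seq.hom_mult lam_seq.hom_of_nat lam_seq.hom_sum lam_seq_hlam)
qed

lemma power_sum_0: "power_sum 0 = 0"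
  by (rule lam_eqI) (simp add: power_sum.rep_eq zero_lam.rep_eq)

lemma of_nat_lam: "of_nat k * P = lam_const (of_nat k) * P"
  by (simp add: lam_const.hom_of_nat)

definition primitive :: "nat \<Rightarrow> lam_tensor"
  where "primitive k = power_sum k \<otimes>\<^sub>\<Lambda> 1 + 1 \<otimes>\<^sub>\<Lambda> power_sum k"

text \<open>Write k = r + (k - r) and apply Newton's identity to the left factor with r and to the
  right factor with k - r. Both double sums, reindexed by the index of the power sum, combine to the
  primitive elements.\<close>

lemma newton_hlam_comult:
  "tensor_const (of_nat k) * hlam_comult k = (\<Sum>i\<in>{0..k}. primitive i * hlam_comult (k - i))"
proof -
  have "tensor_const (of_nat k) * (hlam r \<otimes>\<^sub>\<Lambda> hlam (k - r)) =
      (\<Sum>i\<in>{0..r}. (power_sum i * hlam (r - i)) \<otimes>\<^sub>\<Lambda> hlam (k - r)) +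
      (\<Sum>i\<in>{0..k - r}. hlam r \<otimes>\<^sub>\<Lambda> (power_sum i * hlam (k - r - i)))" if "r \<le> k" for r
  proof -
    have "tensor_const (of_nat k) * (hlam r \<otimes>\<^sub>\<Lambda> hlam (k - r)) =
        tensor_const (of_nat r + of_nat (k - r)) * (hlam r \<otimes>\<^sub>\<Lambda> hlam (k - r))"
      using that by (simp flip: of_nat_add)
    also have "\<dots> = (of_nat r * hlam r) \<otimes>\<^sub>\<Lambda> hlam (k - r) + hlam r \<otimes>\<^sub>\<Lambda> (of_nat (k - r) * hlam (k - r))"
      unfolding tensor_const_add of_nat_lam tensor_scale_left tensor_scale_right by (rule distrib_right)
    finally show ?thesis by (simp only: newton_hlam tensor_sum_left tensor_sum_right)
  qed
  then have "tensor_const (of_nat k) * hlam_comult k =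
      (\<Sum>r\<in>{0..k}. \<Sum>i\<in>{0..r}. (power_sum i * hlam (r - i)) \<otimes>\<^sub>\<Lambda> hlam (k - r)) +
      (\<Sum>r\<in>{0..k}. \<Sum>i\<in>{0..k - r}. hlam r \<otimes>\<^sub>\<Lambda> (power_sum i * hlam (k - r - i)))"
    unfolding hlam_comult_def sum_distrib_left by (simp flip: sum.distrib)
  also have "(\<Sum>r\<in>{0..k}. \<Sum>i\<in>{0..r}. (power_sum i * hlam (r - i)) \<otimes>\<^sub>\<Lambda> hlam (k - r)) =
      (\<Sum>i\<in>{0..k}. \<Sum>r\<in>{0..k - i}. (power_sum i * hlam r) \<otimes>\<^sub>\<Lambda> hlam (k - i - r))"
    unfolding sum.Sigma[OF finite_atLeastAtMost ballI[OF finite_atLeastAtMost]]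
    by (rule sum.reindex_bij_witness[of _ "\<lambda>(i, r). (r + i, i)" "\<lambda>(r, i). (i, r - i)"]) auto
  also have "(\<Sum>r\<in>{0..k}. \<Sum>i\<in>{0..k - r}. hlam r \<otimes>\<^sub>\<Lambda> (power_sum i * hlam (k - r - i))) =
      (\<Sum>i\<in>{0..k}. \<Sum>r\<in>{0..k - i}. hlam r \<otimes>\<^sub>\<Lambda> (power_sum i * hlam (k - i - r)))"
    unfolding sum.Sigma[OF finite_atLeastAtMost ballI[OF finite_atLeastAtMost]]
    by (rule sum.reindex_bij_witness[of _ prod.swap prod.swap]) (auto simp: add.commute)
  also have "(\<Sum>i\<in>{0..k}. \<Sum>r\<in>{0..k - i}. (power_sum i * hlam r) \<otimes>\<^sub>\<Lambda> hlam (k - i - r)) +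
      (\<Sum>i\<in>{0..k}. \<Sum>r\<in>{0..k - i}. hlam r \<otimes>\<^sub>\<Lambda> (power_sum i * hlam (k - i - r))) =
      (\<Sum>i\<in>{0..k}. primitive i * hlam_comult (k - i))"
    by (simp add: primitive_def hlam_comult_def distrib_right sum_distrib_left tensor_mult sum.distrib)
  finally show ?thesis .
qed

lemma hlam_comult_0: "hlam_comult 0 = 1 \<otimes>\<^sub>\<Lambda> 1"
  by (simp add: hlam_comult_def hlam_0)

lemma primitive_0: "primitive 0 = 0"
  by (simp add: primitive_def power_sum_0 tensor_0_left tensor_0_right)

text \<open>Both sides satisfy the same recursion, and in it the term of index \<open>k\<close> is
  multiplied by the image of h_0 = 1, so it is determined by the earlier ones.\<close>

lemma comult'_power_sum: "comult' (power_sum k) = primitive k"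
proof (induction k rule: less_induct)
  case (less k)
  have z: "comult' (power_sum i) = primitive i" if "i < k" for i using less that by blast
  have "(\<Sum>i\<in>{0..k}. comult' (power_sum i) * hlam_comult (k - i)) = comult' (of_nat k * hlam k)"
    unfolding newton_hlam comult'_sum comult'_mult comult'_hlam ..
  also have "\<dots> = (\<Sum>i\<in>{0..k}. primitive i * hlam_comult (k - i))"
    unfolding of_nat_lam comult'_scale comult'_hlam by (rule newton_hlam_comult)
  finally have "(\<Sum>i\<in>{0..k}. comult' (power_sum i) * hlam_comult (k - i)) =
      (\<Sum>i\<in>{0..k}. primitive i * hlam_comult (k - i))" .
  moreover have "{0..k} = insert k {0..<k}" by auto
  moreover have "(\<Sum>i\<in>{0..<k}. comult' (power_sum i) * hlam_comult (k - i)) = (\<Sum>i\<in>{0..<k}. primitive i * hlam_comult (k - i))"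
    by (rule sum.cong) (use z in auto)
  ultimately have "comult' (power_sum k) * (1 \<otimes>\<^sub>\<Lambda> 1) = primitive k * (1 \<otimes>\<^sub>\<Lambda> 1)"
    by (simp add: hlam_comult_0)
  then show ?case by (simp add: mult.commute[of _ "1 \<otimes>\<^sub>\<Lambda> 1"] tensor_unit)
qed

lemma is_comult_comult': "is_comult comult'"
  unfolding is_comult_def
proof (intro conjI allI impI)
  show "comult' (power_sum k) = power_sum k \<otimes>\<^sub>\<Lambda> 1 + 1 \<otimes>\<^sub>\<Lambda> power_sum k" for k
    unfolding comult'_power_sum primitive_def ..
qed (rule comult'_1 comult'_add comult'_mult comult'_scale)+

text \<open>Primitive power sums force Newton's recursion on the images of the h_k. As positive
  integers are invertible in the rationals, it determines these images, and products of the h_k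
  span.\<close>

lemma is_comult_unique:
  assumes D: "is_comult D"
  shows "D = comult'"
proof
  fix P
  have one: "D 1 = 1 \<otimes>\<^sub>\<Lambda> 1" and add: "D (P + Q) = D P + D Q" and mult: "D (P * Q) = D P * D Q"
    and scale: "D (lam_const c * P) = tensor_const c * D P"
    and prim: "1 \<le> k \<Longrightarrow> D (power_sum k) = primitive k" for P Q c k
    using D unfolding is_comult_def primitive_def by blast+
  have D_0: "D 0 = 0" using add[of 0 0] by simp
  have sum: "D (\<Sum>i\<in>I. F i) = (\<Sum>i\<in>I. D (F i))" for I :: "nat set" and F
    by (induction I rule: infinite_finite_induct) (simp_all add: D_0 add)
  \<comment> \<open>The prescribed values start at k = 1, while Newton's identities as used here
    also contain the zero term of index 0.\<close>
  have prim': "D (power_sum k) = primitive k" for k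
    by (cases "k = 0") (simp_all add: prim power_sum_0 primitive_0 D_0)
  have h: "D (hlam k) = hlam_comult k" for k
  proof (induction k rule: less_induct)
    case (less k)
    show ?case
    proof (cases "k = 0")
      case True
      then show ?thesis by (simp add: hlam_0 one hlam_comult_0)
    next
      case False
      have "tensor_const (of_nat k) * D (hlam k) = D (of_nat k * hlam k)"
        by (simp only: of_nat_lam scale)
      also have "\<dots> = (\<Sum>i\<in>{0..k}. primitive i * D (hlam (k - i)))"
        by (simp only: newton_hlam sum mult prim')
      also have "\<dots> = (\<Sum>i\<in>{0..k}. primitive i * hlam_comult (k - i))"
      proof (rule sum.cong[OF refl])
        fix i assume "i \<in> {0..k}"
        \<comment> \<open>For i = 0 the induction hypothesis does not apply to h_k itself, but the
          factor is zero.\<close>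
        show "primitive i * D (hlam (k - i)) = primitive i * hlam_comult (k - i)"
          by (cases "i = 0") (use False less in \<open>simp_all add: primitive_0\<close>)
      qed
      also have "\<dots> = tensor_const (of_nat k) * hlam_comult k"
        by (rule newton_hlam_comult[symmetric])
      finally have "tensor_const (Const (1 / of_nat k)) * (tensor_const (of_nat k) * D (hlam k)) =
          tensor_const (Const (1 / of_nat k)) * (tensor_const (of_nat k) * hlam_comult k)" by simp
      moreover have "Const (1 / of_nat k) * of_nat k = (1 :: qa)"
      proof -
        interpret C: comm_ring_hom "Const :: rat \<Rightarrow> qa" by (rule Const_hom)
        have "Const (1 / of_nat k) * of_nat k = (Const (1 / of_nat k * of_nat k) :: qa)"
          by (simp only: C.hom_mult C.hom_of_nat)
        with False show ?thesis by simp
      qed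
      ultimately show ?thesis
        by (simp only: mult.assoc[symmetric] tensor_const_mult[symmetric] tensor_const_1)
    qed
  qed
  show "D P = comult' P"
  proof (induction P rule: lam_induct)
    case zero
    show ?case using D_0 comult'_add[of 0 0] by simp
  next
    case (hmono \<beta>)
    have "D (\<Prod>j\<in>A. hlam (f j)) = comult' (\<Prod>j\<in>A. hlam (f j))" if "finite A" for A :: "nat set" and f
      using that by (induction A rule: finite_induct)
        (simp_all add: one comult'_1 mult comult'_mult h comult'_hlam)
    then show ?case unfolding hmono_def by simp
  qed (simp_all add: add scale comult'_add comult'_scale)
qed

section \<open>Identification with the dual Littlewood-Richardson polynomials\<close>

lemma comult_eq: "comult = comult'"
  unfolding comult_def by (rule the_equality) (rule is_comult_comult', rule is_comult_unique)

lemma comult_double_schur: "comult (double_schur \<nu>) = comult_schur \<nu>"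
proof -
  have "{\<mu>. coef \<mu> (double_schur \<nu>) \<noteq> 0} = {\<nu>}" by (auto simp: coef_double_schur split: if_splits)
  then show ?thesis by (simp add: comult_eq comult'_def coef_double_schur tensor_const_1)
qed

text \<open>The structure constants of bounded size form a suitable finitely supported family, and
  \<open>tensor_coef\<close> recovers any such family from its sum. Outside the bounded range
  \<open>lr\<close> is zero for degree reasons.\<close>

lemma dual_LR_eq: "dual_LR \<kappa> \<mu> \<nu> = lr \<kappa> \<mu> \<nu>"
proof -
  define S where "S = {\<kappa>. psize \<kappa> \<le> psize \<nu>} \<times> {\<mu>. psize \<mu> \<le> psize \<nu>}"
  have S: "finite S" by (simp add: S_def finite_psize)
  define f where "f = (\<lambda>p. if p \<in> S then lr (fst p) (snd p) \<nu> else 0)"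
  define c where "c = Abs_poly_mapping f"
  have "finite {p. f p \<noteq> 0}"
    by (rule finite_subset[OF _ S]) (auto simp: f_def split: if_splits)
  then have look: "Poly_Mapping.lookup c = f" by (simp add: c_def Abs_poly_mapping_inverse)
  have keys: "Poly_Mapping.keys c \<subseteq> S" by (auto simp: in_keys_iff look f_def split: if_splits)
  let ?sum = "\<lambda>c. \<Sum>(\<kappa>, \<mu>)\<in>Poly_Mapping.keys c.
      tensor_const (Poly_Mapping.lookup c (\<kappa>, \<mu>)) * (double_schur \<kappa> \<otimes>\<^sub>\<Lambda> double_schur \<mu>)"
  have c: "comult (double_schur \<nu>) = ?sum c"
  proof -
    have "comult (double_schur \<nu>) = (\<Sum>(\<kappa>, \<mu>)\<in>S. tensor_const (Poly_Mapping.lookup c (\<kappa>, \<mu>)) * (double_schur \<kappa> \<otimes>\<^sub>\<Lambda> double_schur \<mu>))"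
      unfolding comult_double_schur comult_schur_def S_def[symmetric]
      by (rule sum.cong) (auto simp: look f_def)
    also have "\<dots> = ?sum c"
      by (rule sum.mono_neutral_right[OF S keys]) (auto simp: in_keys_iff tensor_const_0)
    finally show ?thesis .
  qed
  have uniq: "c' = c" if "comult (double_schur \<nu>) = ?sum c'" for c'
  proof (rule poly_mapping_eqI)
    fix p :: "partition \<times> partition"
    obtain \<kappa> \<mu> where p: "p = (\<kappa>, \<mu>)" by (cases p)
    have *: "tensor_coef \<kappa> \<mu> (?sum d) = Poly_Mapping.lookup d (\<kappa>, \<mu>)" for d
      using tensor_coef_combination[of "Poly_Mapping.keys d" \<kappa> \<mu> "Poly_Mapping.lookup d"]
      by (simp add: in_keys_iff)
    have "?sum c' = ?sum c" by (rule trans[OF that[symmetric] c])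
    then have "tensor_coef \<kappa> \<mu> (?sum c') = tensor_coef \<kappa> \<mu> (?sum c)" by (rule arg_cong)
    then show "Poly_Mapping.lookup c' p = Poly_Mapping.lookup c p" unfolding * p .
  qed
  have "comult_coeffs \<nu> = c"
    unfolding comult_coeffs_def
  proof (rule the_equality)
    show "comult (double_schur \<nu>) = ?sum c" by (rule c)
    show "c' = c" if "comult (double_schur \<nu>) = ?sum c'" for c' using that by (rule uniq)
  qed
  then have "dual_LR \<kappa> \<mu> \<nu> = f (\<kappa>, \<mu>)" by (simp add: dual_LR_def look)
  also have "\<dots> = lr \<kappa> \<mu> \<nu>"
    using lr_eq_0[of \<nu> \<kappa> \<mu>] by (auto simp: f_def S_def not_le)
  finally show ?thesis .
qed

theorem theorem4p3:
  fixes \<kappa> \<mu> :: partition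
  shows "range dual_schur \<subseteq> hat_lam \<and>
    dual_schur \<kappa> * dual_schur \<mu> \<in> hat_lam \<and>
    has_formal_sum (\<lambda>\<nu>. PS_Const (dual_LR \<kappa> \<mu> \<nu>) * dual_schur \<nu>)
      (dual_schur \<kappa> * dual_schur \<mu>)"
proof (intro conjI)
  show "range dual_schur \<subseteq> hat_lam"
    by (auto simp: dual_schur_eq intro: sym_series_in_hat_lam sym_series_dser)
  show "dual_schur \<kappa> * dual_schur \<mu> \<in> hat_lam"
    unfolding dual_schur_eq by (intro sym_series_in_hat_lam sym_series_mult sym_series_dser)
  show "has_formal_sum (\<lambda>\<nu>. PS_Const (dual_LR \<kappa> \<mu> \<nu>) * dual_schur \<nu>) (dual_schur \<kappa> * dual_schur \<mu>)"
    unfolding dual_schur_eq dual_LR_eq by (rule lr)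
qed

end
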